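(* For every integer $k\ge0$, the $u$-expansion of $x_k$ is of the form $$x_k=(-1)^{k+1}L_ku^{q^k}+\cdots,$$ where the dots denote terms of higher degree in $u$. In particular, $\nu_\infty(x_k)=q^k$.
   Context: Let $p$ be a prime, $q=p^e$ with $e\ge1$, $A=\mathbb{F}_q[\theta]$, $K=\mathbb{F}_q(\theta)$, $K_\infty=\mathbb{F}_q((1/\theta))$, $C$ the completion of an algebraic closure of $K_\infty$, and $\Omega=C\setminus K_\infty$. For $k\ge1$ put $[k]=\theta^{q^k}-\theta$, $L_k=[k][k-1]\cdots[1]$, and $L_0=1$. The Carlitz exponential is $e_{\mathcal C}(z)=\sum_{i\ge0}z^{q^i}/d_i$ with $d_i=\prod_{j=0}^{i-1}(\theta^{q^i}-\theta^{q^j})$; its kernel is $\widetilde{\pi}A$ for a fixed $\widetilde{\pi}\in C$; put $u(z)=1/e_{\mathcal C}(\widetilde{\pi}z)$. Put $D_1=(-\widetilde{\pi})^{-1}\frac{d}{dz}$. Gekeler's functions on $\Omega$: $E(z)=\frac{1}{\widetilde{\pi}}\sum_{a\in A\text{ monic}}\bigl(\sum_{b\in A}\frac{a}{az+b}\bigr)$; $g(z)=\widetilde{\pi}^{1-q}[1]\sum_{(a,b)\in A^2\setminus\{(0,0)\}}(az+b)^{1-q}$; $h=-D_1g-Eg$; and $\Delta=-h^{q-1}$. They are algebraically independent over $C$; put $\widetilde{M}=C[E,g,h]$. Each $f\in\widetilde{M}$ has a $u$-expansion $\sum_{i\ge0}c_iu^i$ (giving an injection $\widetilde{M}\hookrightarrow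 C[[u]]$), and $\nu_\infty(f)=\min\{i: c_i\neq0\}$ for $f\ne 0$. The sequence $(x_k)_{k\ge0}$ is defined by $x_0=-E$, $x_1=-Eg-h$, $x_k=x_{k-1}g^{q^{k-1}}-[k-1]x_{k-2}\Delta^{q^{k-2}}$ for $k\ge2$. *)

theory Defs
  imports "HOL-Analysis.Analysis" "HOL-Algebra.Algebraic_Closure_Type"
begin

text \<open>
  Fields with a non-archimedean absolute value. The class \<open>real_normed_field\<close> cannot be used:
  a real algebra has characteristic 0.
\<close>

class nonarch_field = field + metric_space +
  fixes absv :: "'a \<Rightarrow> real"
  assumes dist_absv: "dist x y = absv (x - y)"
    and absv_eq_0: "absv x = 0 \<longleftrightarrow> x = 0"
    and absv_mult: "absv (x * y) = absv x * absv y"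
    and absv_add: "absv (x + y) \<le> max (absv x) (absv y)"
begin

lemma absv_nonneg: "0 \<le> absv x"
  using zero_le_dist[of x 0] by (simp add: dist_absv)

lemma absv_triangle: "absv (x + y) \<le> absv x + absv y"
  using absv_add[of x y] absv_nonneg[of x] absv_nonneg[of y] by simp

lemma absv_minus_commute: "absv (x - y) = absv (y - x)"
  using dist_commute[of x y] by (simp add: dist_absv)

end

text \<open>This instance makes \<open>infsum\<close> (unconditional summation) and \<open>suminf\<close> well behaved.\<close>

instance nonarch_field \<subseteq> topological_group_add
proof
  fix a b :: 'a
  have "((\<lambda>x. dist (fst x + snd x) (a + b)) \<longlongrightarrow> 0) (nhds a \<times>\<^sub>F nhds b)"
  proof (rule tendsto_sandwich[OF _ _ tendsto_const])
    have "absv (x + y - (a + b)) \<le> absv (x - a) + absv (y - b)" for x y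
      using absv_triangle[of "x - a" "y - b"] by (simp add: algebra_simps)
    then show "\<forall>\<^sub>F x in nhds a \<times>\<^sub>F nhds b.
        dist (fst x + snd x) (a + b) \<le> dist (fst x) a + dist (snd x) b"
      by (simp add: dist_absv)
    have "((\<lambda>x. dist (fst x) a) \<longlongrightarrow> 0) (nhds a \<times>\<^sub>F nhds b)"
      using filterlim_fst[of "nhds a" "nhds b"] by (rule tendsto_dist_iff[THEN iffD1])
    moreover have "((\<lambda>x. dist (snd x) b) \<longlongrightarrow> 0) (nhds a \<times>\<^sub>F nhds b)"
      using filterlim_snd[of "nhds b" "nhds a"] by (rule tendsto_dist_iff[THEN iffD1])
    ultimately show "((\<lambda>x. dist (fst x) a + dist (snd x) b) \<longlongrightarrow> 0) (nhds a \<times>\<^sub>F nhds b)"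
      using tendsto_add by fastforce
  qed simp_all
  then show "((\<lambda>x. fst x + snd x) \<longlongrightarrow> a + b) (nhds a \<times>\<^sub>F nhds b)"
    by (rule tendsto_dist_iff[THEN iffD2])
next
  fix a :: 'a
  have "dist (- x) (- a) = dist x a" for x
    by (simp add: dist_absv absv_minus_commute[of a x])
  moreover have "((\<lambda>x. dist x a) \<longlongrightarrow> 0) (nhds a)"
    using filterlim_ident[of "nhds a"] by (rule tendsto_dist_iff[THEN iffD1])
  ultimately show "(uminus \<longlongrightarrow> - a) (nhds a)"
    by (subst tendsto_dist_iff) simp
qed

text \<open>
  \<open>K\<^sub>\<infinity>\<close> is \<open>'f fls\<close>, the field of Laurent series over the finite field \<open>'f\<close>, with the
  variable \<open>fls_X\<close> standing for \<open>1/\<theta>\<close>. The absolute value is normalised by \<open>|\<theta>| = q\<close>.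
\<close>

definition abs_infty :: "'f::{field,finite} fls \<Rightarrow> real" where
  "abs_infty f = (if f = 0 then 0 else real CARD('f) powi (- fls_subdegree f))"

text \<open>
  The field \<open>'c\<close> is a completion, via \<open>\<iota>\<close>, of the algebraic closure of \<open>K\<^sub>\<infinity>\<close>: it is complete,
  \<open>\<iota>\<close> has dense image, and the absolute value extends the one of \<open>K\<^sub>\<infinity>\<close>. Since that extension
  to the algebraic closure is unique, this determines \<open>'c\<close> up to isometric isomorphism.
\<close>

locale carlitz_setting =
  fixes p e q :: nat
    and \<iota> :: "'f::{field,finite} fls alg_closure \<Rightarrow> 'c::{nonarch_field,complete_space}"
  assumes prime_p: "Factorial_Ring.prime p"
    and e_ge_1: "e \<ge> 1"
    and q_eq: "q = p ^ e"
    and card_f: "CARD('f) = q"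
    and iota_1: "\<iota> 1 = 1"
    and iota_add: "\<iota> (x + y) = \<iota> x + \<iota> y"
    and iota_mult: "\<iota> (x * y) = \<iota> x * \<iota> y"
    and absv_iota: "absv (\<iota> (to_ac f)) = abs_infty f"
    and dense_iota: "closure (range \<iota>) = UNIV"
begin

definition of_Kinf :: "'f fls \<Rightarrow> 'c" where
  "of_Kinf f = \<iota> (to_ac f)"

definition \<Omega> :: "'c set" where
  "\<Omega> = - range of_Kinf"

definition \<theta> :: 'c where
  "\<theta> = of_Kinf fls_X_inv"

text \<open>The embedding of \<open>A\<close>, modelled by the type \<open>'f poly\<close>: evaluation of polynomials at \<open>\<theta>\<close>.\<close>

definition of_A :: "'f poly \<Rightarrow> 'c" where
  "of_A a = poly (map_poly (\<lambda>c. of_Kinf (fls_const c)) a) \<theta>"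

definition bracket :: "nat \<Rightarrow> 'c" where
  "bracket k = \<theta> ^ (q ^ k) - \<theta>"

definition L :: "nat \<Rightarrow> 'c" where
  "L k = (\<Prod>j=1..k. bracket j)"

definition d :: "nat \<Rightarrow> 'c" where
  "d i = (\<Prod>j<i. \<theta> ^ (q ^ i) - \<theta> ^ (q ^ j))"

definition carlitz_exp :: "'c \<Rightarrow> 'c" where
  "carlitz_exp z = (\<Sum>i. z ^ (q ^ i) / d i)"

end

text \<open>
  That \<open>\<pi>\<close> (written with a tilde in the literature) is nonzero is part of its being a period:
  it is used as a denominator below.
\<close>

locale drinfeld_setting = carlitz_setting p e q \<iota>
  for p e q :: nat
    and \<iota> :: "'f::{field,finite} fls alg_closure \<Rightarrow> 'c::{nonarch_field,complete_space}" +
  fixes \<pi> :: 'c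
  assumes kernel_carlitz_exp: "{z. carlitz_exp z = 0} = range (\<lambda>a. \<pi> * of_A a)"
    and pi_nonzero: "\<pi> \<noteq> 0"
begin

definition u :: "'c \<Rightarrow> 'c" where
  "u z = 1 / carlitz_exp (\<pi> * z)"

text \<open>
  Functions on \<open>\<Omega>\<close> are represented by total functions whose values outside \<open>\<Omega>\<close> are irrelevant;
  in particular the limit defining \<open>d/dz\<close> at a point of \<open>\<Omega>\<close> does not see them, because \<open>\<Omega>\<close>
  is open.
\<close>

definition D1 :: "('c \<Rightarrow> 'c) \<Rightarrow> 'c \<Rightarrow> 'c" where
  "D1 f z = inverse (- \<pi>) * Lim (at z) (\<lambda>w. (f w - f z) / (w - z))"

definition E :: "'c \<Rightarrow> 'c" where
  "E z = 1 / \<pi> * (\<Sum>\<^sub>\<infinity>a\<in>{a. Polynomial.lead_coeff a = 1}. \<Sum>\<^sub>\<infinity>b\<in>UNIV. of_A a / (of_A a * z + of_A b))"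

definition g :: "'c \<Rightarrow> 'c" where
  "g z = \<pi> powi (1 - int q) * bracket 1 *
     (\<Sum>\<^sub>\<infinity>(a, b)\<in>UNIV - {(0, 0)}. (of_A a * z + of_A b) powi (1 - int q))"

definition h :: "'c \<Rightarrow> 'c" where
  "h z = - D1 g z - E z * g z"

definition \<Delta> :: "'c \<Rightarrow> 'c" where
  "\<Delta> z = - (h z ^ (q - 1))"

text \<open>
  A power series is a \<open>u\<close>-expansion of a function if it represents that function near infinity,
  i.e. where \<open>|u(z)|\<close> is small (equivalently, where the distance of \<open>z\<close> to \<open>K\<^sub>\<infinity>\<close> is large).
\<close>

definition has_u_expansion :: "('c \<Rightarrow> 'c) \<Rightarrow> 'c fps \<Rightarrow> bool" where
  "has_u_expansion f F \<longleftrightarrow>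
     (\<exists>r>0. \<forall>z\<in>\<Omega>. absv (u z) < r \<longrightarrow> (\<lambda>i. fps_nth F i * u z ^ i) sums f z)"

definition u_expansion :: "('c \<Rightarrow> 'c) \<Rightarrow> 'c fps" where
  "u_expansion f = (THE F. has_u_expansion f F)"

definition nu_infty :: "('c \<Rightarrow> 'c) \<Rightarrow> nat" where
  "nu_infty f = (LEAST i. fps_nth (u_expansion f) i \<noteq> 0)"

fun x :: "nat \<Rightarrow> 'c \<Rightarrow> 'c" where
  "x 0 z = - E z"
| "x (Suc 0) z = - E z * g z - h z"
| "x (Suc (Suc k)) z =
     x (Suc k) z * g z ^ (q ^ Suc k) - bracket (Suc k) * x k z * \<Delta> z ^ (q ^ k)"

end

end

theory Submission
  imports Defs "HOL-Number_Theory.Residues"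
begin

hide_const (open) Polynomials.degree Polynomials.lead_coeff up_ring.monom up_ring.coeff module.smult

section \<open>The u-expansions of the sequence x\<close>

text \<open>
  For \<open>z\<close> close to infinity put \<open>u\<^sub>a = u (a z)\<close> and \<open>T\<^sub>k = \<Sum> a u\<^sub>a^(q^k)\<close>, summed over the monic
  \<open>a \<in> A\<close>. The claim is that \<open>x\<^sub>k = (-1)\<^sup>k\<^sup>+\<^sup>1 L\<^sub>k T\<^sub>k\<close>, from which the leading term is visible since
  \<open>u\<^sub>a\<close> is a power series in \<open>u\<close> of order \<open>q ^ deg a\<close>. For \<open>k = 0\<close> this is \<open>E = \<Sum> a u\<^sub>a\<close>, and for
  \<open>k = 1\<close> it says \<open>D\<^sub>1 g = [1] T\<^sub>1\<close>, by termwise differentiation and Frobenius.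

  The recurrence for larger \<open>k\<close> comes from the lattice of the numbers \<open>1 / u\<^sub>a\<close>, on which \<open>\<theta>\<close> acts
  through the Carlitz module. Its exponential intertwines the Carlitz module with a Drinfeld module
  of rank 2 with coefficients \<open>g\<close> and \<open>\<Delta>'\<close>. Interpolating \<open>1 / u\<^sub>a \<mapsto> a(t)\<close> by additive polynomials
  on the finite sublattices gives, in the limit, a three term recurrence in \<open>k\<close> for
  \<open>\<Sum> a(t) u\<^sub>a^(q^k)\<close>, which for \<open>t = \<theta>\<close> is the one required, with \<open>\<Delta>'\<close> in place of
  \<open>\<Delta> = - h\<^sup>q\<^sup>-\<^sup>1\<close>. That \<open>\<Delta>' = \<Delta>\<close> is a Legendre relation; it follows by pairing the recurrence
  with its adjoint, which is solved by a quotient of Anderson generating functions.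
\<close>

subsection \<open>Non-archimedean fields\<close>

text \<open>The recurrence for \<open>x\<close> relates values at one point, so everything before
  the expansions is proved at a fixed z near infinity. There \<open>g\<close> and \<Delta>' are mere
  numbers, and \<Delta>' = \<Delta> cannot be read off from a space of modular forms. The lattice of
  the 1 / u_a is the right one because the exponential of \<pi>(Az + A) is the Carlitz exponential
  followed by the exponential of this lattice. The variable t stays free because Frobenius carries
  the sum of a(t) u_a^(q^k) to the sum of a(t^q) u_a^(q^(k+1)): it relates t = \<theta> to t =
  \<theta>^q and says nothing about \<theta> alone. Once the pairing vanishes, the values at these
  two parameters can be compared, and the outcome is h^q = - \<Delta>' h. All convergence rests on
  |\<theta>|^2 |u| < 1; the exponent 2 is dictated by the estimates at q = 2 for |t| \<le>
  |\<theta>|^q. Identities for exponentials are proved for polynomials on finite sublattices and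
  then passed to the limit.\<close>

lemma absv_0 [simp]: "absv (0::'a::nonarch_field) = 0"
  by (simp add: absv_eq_0)

lemma absv_1 [simp]: "absv (1::'a::nonarch_field) = 1"
  using absv_mult[of 1 "1::'a"] absv_eq_0[of "1::'a"] by simp

lemma absv_pos [simp]: "0 < absv x \<longleftrightarrow> x \<noteq> (0::'a::nonarch_field)"
  using absv_nonneg[of x] absv_eq_0[of x] by linarith

lemma absv_minus [simp]: "absv (- x) = absv (x::'a::nonarch_field)"
  using absv_minus_commute[of x 0] by simp

lemma absv_power: "absv (x ^ n) = absv (x::'a::nonarch_field) ^ n"
  by (induction n) (simp_all add: absv_mult)

lemma absv_inverse: "absv (inverse x) = inverse (absv (x::'a::nonarch_field))"
proof (cases "x = 0")
  case False
  then have "absv x * absv (inverse x) = 1"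
    by (simp flip: absv_mult)
  then show ?thesis
    by (rule inverse_unique[symmetric])
qed simp

lemma absv_divide: "absv (x / y) = absv x / absv (y::'a::nonarch_field)"
  by (simp add: divide_inverse absv_mult absv_inverse)

lemma absv_prod: "absv (prod f A) = (\<Prod>i\<in>A. absv (f i :: 'a::nonarch_field))"
  by (induction A rule: infinite_finite_induct) (simp_all add: absv_mult)

lemma absv_add_le: "absv x \<le> B \<Longrightarrow> absv y \<le> B \<Longrightarrow> absv (x + y) \<le> (B::real)" for x y :: "'a::nonarch_field"
  using absv_add[of x y] by linarith

lemma absv_diff_le: "absv x \<le> B \<Longrightarrow> absv y \<le> B \<Longrightarrow> absv (x - y) \<le> (B::real)" for x y :: "'a::nonarch_field"
  using absv_add_le[of x B "- y"] by simp

lemma absv_add_less: "absv x < B \<Longrightarrow> absv y < B \<Longrightarrow> absv (x + y) < (B::real)" for x y :: "'a::nonarch_field"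
  using absv_add[of x y] by linarith

lemma absv_add_eq_left:
  assumes "absv y < absv x"
  shows "absv (x + y) = absv (x::'a::nonarch_field)"
proof (rule antisym)
  show "absv (x + y) \<le> absv x"
    using assms by (intro absv_add_le) auto
  have "absv x \<le> max (absv (x + y)) (absv y)"
    using absv_add[of "x + y" "- y"] by simp
  then show "absv x \<le> absv (x + y)"
    using assms by linarith
qed

lemma absv_add_eq_right: "absv x < absv y \<Longrightarrow> absv (x + y) = absv (y::'a::nonarch_field)"
  using absv_add_eq_left[of x y] by (simp add: add.commute)

lemma absv_diff_eq_left: "absv y < absv x \<Longrightarrow> absv (x - y) = absv (x::'a::nonarch_field)"
  using absv_add_eq_left[of "- y" x] by simp

lemma absv_sum_le:
  fixes f :: "'b \<Rightarrow> 'a::nonarch_field"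
  assumes "\<And>i. i \<in> A \<Longrightarrow> absv (f i) \<le> B" "0 \<le> B"
  shows "absv (sum f A) \<le> B"
  using assms
  by (induction A rule: infinite_finite_induct) (auto intro!: absv_add_le)

instance nonarch_field \<subseteq> topological_ab_group_add ..

lemma tendsto_absv_iff:
  fixes l :: "'a::nonarch_field"
  shows "(f \<longlongrightarrow> l) F \<longleftrightarrow> ((\<lambda>x. absv (f x - l)) \<longlongrightarrow> 0) F"
  using tendsto_dist_iff[of f l F] by (simp add: dist_absv)

instance nonarch_field \<subseteq> topological_monoid_mult
proof
  fix a b :: 'a
  let ?F = "nhds a \<times>\<^sub>F nhds b"
  have 1: "((\<lambda>x. absv (fst x - a)) \<longlongrightarrow> 0) ?F" "((\<lambda>x. absv (snd x - b)) \<longlongrightarrow> 0) ?F"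
    using filterlim_fst[of "nhds a" "nhds b"] filterlim_snd[of "nhds b" "nhds a"]
    by (simp_all flip: tendsto_absv_iff)
  have "((\<lambda>x. absv (fst x * snd x - a * b)) \<longlongrightarrow> 0) ?F"
  proof (rule tendsto_sandwich[OF _ _ tendsto_const])
    have "absv (x * y - a * b) \<le> absv (x - a) * absv (y - b) + absv a * absv (y - b) + absv b * absv (x - a)" for x y
    proof -
      have "x * y - a * b = (x - a) * (y - b) + a * (y - b) + b * (x - a)"
        by (simp add: algebra_simps)
      then show ?thesis
        using absv_triangle[of "(x - a) * (y - b) + a * (y - b)" "b * (x - a)"]
          absv_triangle[of "(x - a) * (y - b)" "a * (y - b)"] by (simp add: absv_mult)
    qed
    then show "\<forall>\<^sub>F x in ?F. absv (fst x * snd x - a * b) \<le> absv (fst x - a) * absv (snd x - b)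
        + absv a * absv (snd x - b) + absv b * absv (fst x - a)"
      by simp
    show "((\<lambda>x. absv (fst x - a) * absv (snd x - b)
        + absv a * absv (snd x - b) + absv b * absv (fst x - a)) \<longlongrightarrow> 0) ?F"
      by (rule tendsto_eq_intros 1 refl)+ simp
  qed (simp add: absv_nonneg)
  then show "((\<lambda>x. fst x * snd x) \<longlongrightarrow> a * b) ?F"
    by (simp add: tendsto_absv_iff)
qed

lemma abs_absv_diff_le: "\<bar>absv x - absv y\<bar> \<le> absv (x - y)" for x y :: "'a::nonarch_field"
  using absv_triangle[of "x - y" y] absv_triangle[of "y - x" x] absv_minus_commute[of x y] by simp

lemma tendsto_absv [tendsto_intros]:
  fixes f :: "'b \<Rightarrow> 'a::nonarch_field"
  assumes "(f \<longlongrightarrow> l) F"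
  shows "((\<lambda>x. absv (f x)) \<longlongrightarrow> absv l) F"
proof -
  have "((\<lambda>x. absv (f x) - absv l) \<longlongrightarrow> 0) F"
    by (rule Lim_null_comparison[OF always_eventually assms[unfolded tendsto_absv_iff]])
      (simp add: abs_absv_diff_le)
  then show ?thesis
    by (simp add: LIM_zero_iff)
qed

lemma tendsto_inverse_nonarch:
  fixes f :: "'b \<Rightarrow> 'a::nonarch_field"
  assumes f: "(f \<longlongrightarrow> l) F" and l: "l \<noteq> 0"
  shows "((\<lambda>x. inverse (f x)) \<longlongrightarrow> inverse l) F"
proof -
  have lim: "((\<lambda>x. absv (f x - l) / (absv (f x) * absv l)) \<longlongrightarrow> 0) F"
    by (rule tendsto_eq_intros tendsto_absv f assms(1)[unfolded tendsto_absv_iff] refl)+ (use l in \<open>auto simp: absv_eq_0\<close>)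
  have "\<forall>\<^sub>F x in F. f x \<noteq> 0"
    using f l by (rule tendsto_imp_eventually_ne)
  then have "\<forall>\<^sub>F x in F. absv (f x - l) / (absv (f x) * absv l) = absv (inverse (f x) - inverse l)"
  proof eventually_elim
    case (elim x)
    then have "inverse (f x) - inverse l = (l - f x) / (f x * l)"
      using l by (simp add: field_simps)
    then show ?case
      by (simp add: absv_divide absv_mult absv_minus_commute)
  qed
  with lim show ?thesis
    unfolding tendsto_absv_iff[of "\<lambda>x. inverse (f x)"] by (rule Lim_transform_eventually)
qed

lemma tendsto_divide_nonarch:
  fixes f g :: "'b \<Rightarrow> 'a::nonarch_field"
  assumes "(f \<longlongrightarrow> l) F" "(g \<longlongrightarrow> m) F" "m \<noteq> 0"
  shows "((\<lambda>x. f x / g x) \<longlongrightarrow> l / m) F"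
  unfolding divide_inverse by (intro tendsto_mult tendsto_inverse_nonarch assms)

lemma absv_lim_le:
  fixes f :: "'b \<Rightarrow> 'a::nonarch_field"
  assumes "(f \<longlongrightarrow> l) F" "F \<noteq> bot" "\<forall>\<^sub>F x in F. absv (f x) \<le> B"
  shows "absv l \<le> B"
  using tendsto_upperbound[OF tendsto_absv[OF assms(1)] assms(3,2)] .

text \<open>By the strong triangle inequality a difference of two members is bounded by the largest
  increment between them, so null increments already give a Cauchy sequence.\<close>

lemma convergent_nonarch:
  fixes f :: "nat \<Rightarrow> 'a::{nonarch_field,complete_space}"
  assumes "(\<lambda>n. f (Suc n) - f n) \<longlonglongrightarrow> 0"
  shows "convergent f"
proof (rule Cauchy_convergent, rule metric_CauchyI)
  fix \<epsilon> :: real assume "\<epsilon> > 0"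
  moreover have "(\<lambda>n. absv (f (Suc n) - f n)) \<longlonglongrightarrow> 0"
    using tendsto_absv[OF assms] by simp
  ultimately have "\<forall>\<^sub>F n in sequentially. absv (f (Suc n) - f n) < \<epsilon>"
    by (auto dest: order_tendstoD(2))
  then obtain N where N: "\<And>n. n \<ge> N \<Longrightarrow> absv (f (Suc n) - f n) < \<epsilon>"
    unfolding eventually_sequentially by blast
  have *: "absv (f n - f N) < \<epsilon>" if "n \<ge> N" for n
    using that
  proof (induction n rule: dec_induct)
    case (step n)
    have "absv ((f (Suc n) - f n) + (f n - f N)) < \<epsilon>"
      using step N by (intro absv_add_less) auto
    then show ?case by simp
  qed (use \<open>\<epsilon> > 0\<close> in auto)
  have "dist (f m) (f n) < \<epsilon>" if "m \<ge> N" "n \<ge> N" for m n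
    using absv_add_less[of "f m - f N" \<epsilon> "f N - f n"] *[OF that(1)] *[OF that(2)]
    by (simp add: dist_absv absv_minus_commute)
  then show "\<exists>M. \<forall>m\<ge>M. \<forall>n\<ge>M. dist (f m) (f n) < \<epsilon>"
    by blast
qed

lemma summable_nonarch:
  fixes f :: "nat \<Rightarrow> 'a::{nonarch_field,complete_space}"
  assumes "f \<longlonglongrightarrow> 0"
  shows "summable f"
  unfolding summable_iff_convergent using assms by (intro convergent_nonarch) simp

text \<open>Two finite sets that contain the finitely many terms of size at least \<epsilon>/2 have
  sums differing by at most \<epsilon>/2; hence the net of finite sums is Cauchy.\<close>

lemma summable_on_nonarch:
  fixes f :: "'b \<Rightarrow> 'a::{nonarch_field,complete_space}"
  assumes fin: "\<And>\<epsilon>. \<epsilon> > 0 \<Longrightarrow> finite {x\<in>A. absv (f x) \<ge> \<epsilon>}"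
  shows "f summable_on A"
proof -
  let ?F = "filtermap (sum f) (finite_subsets_at_top A)"
  have "cauchy_filter ?F"
    unfolding cauchy_filter_metric_filtermap
  proof (intro allI impI)
    fix \<epsilon> :: real assume \<epsilon>: "\<epsilon> > 0"
    define S where "S = {x\<in>A. absv (f x) \<ge> \<epsilon> / 2}"
    have S: "finite S" "S \<subseteq> A"
      using fin[of "\<epsilon> / 2"] \<epsilon> by (auto simp: S_def)
    have "absv (sum f Y - sum f S) \<le> \<epsilon> / 2" if "finite Y" "S \<subseteq> Y" "Y \<subseteq> A" for Y
    proof -
      have "sum f Y - sum f S = sum f (Y - S)"
        using that by (simp add: sum_diff)
      also have "absv \<dots> \<le> \<epsilon> / 2"
        using that \<epsilon> by (intro absv_sum_le) (force simp: S_def)+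
      finally show ?thesis .
    qed
    then have le: "absv (sum f Y - sum f Z) \<le> \<epsilon> / 2"
      if "finite Y" "S \<subseteq> Y" "Y \<subseteq> A" "finite Z" "S \<subseteq> Z" "Z \<subseteq> A" for Y Z
      using absv_diff_le[of "sum f Y - sum f S" "\<epsilon> / 2" "sum f Z - sum f S"] that by simp
    have "dist (sum f Y) (sum f Z) < \<epsilon>"
      if "finite Y \<and> S \<subseteq> Y \<and> Y \<subseteq> A" "finite Z \<and> S \<subseteq> Z \<and> Z \<subseteq> A" for Y Z
      using le[of Y Z] that \<epsilon> unfolding dist_absv by linarith
    moreover have "eventually (\<lambda>Y. finite Y \<and> S \<subseteq> Y \<and> Y \<subseteq> A) (finite_subsets_at_top A)"
      using S by (auto simp: eventually_finite_subsets_at_top)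
    ultimately show "\<exists>P. eventually P (finite_subsets_at_top A) \<and>
        (\<forall>x y. P x \<and> P y \<longrightarrow> dist (sum f x) (sum f y) < \<epsilon>)"
      by (intro exI[of _ "\<lambda>Y. finite Y \<and> S \<subseteq> Y \<and> Y \<subseteq> A"]) simp
  qed
  moreover have "complete (UNIV :: 'a set)"
    using Cauchy_convergent_iff[where 'a = 'a] by (auto simp: complete_def convergent_def)
  moreover have "?F \<noteq> bot"
    by (simp add: filtermap_bot_iff)
  ultimately obtain L where "?F \<le> nhds L"
    unfolding complete_uniform by auto
  then show ?thesis
    unfolding summable_on_def has_sum_def filterlim_def by blast
qed

lemma absv_has_sum_le:
  fixes f :: "'b \<Rightarrow> 'a::nonarch_field"
  assumes "(f has_sum s) A" "\<And>x. x \<in> A \<Longrightarrow> absv (f x) \<le> B" "0 \<le> B"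
  shows "absv s \<le> B"
proof (rule absv_lim_le[OF assms(1)[unfolded has_sum_def] finite_subsets_at_top_neq_bot])
  show "\<forall>\<^sub>F x in finite_subsets_at_top A. absv (sum f x) \<le> B"
    using assms(2,3) by (intro eventually_finite_subsets_at_top_weakI absv_sum_le) auto
qed

lemma absv_sums_le:
  fixes f :: "nat \<Rightarrow> 'a::nonarch_field"
  assumes "f sums s" "\<And>i. absv (f i) \<le> B"
  shows "absv s \<le> B"
proof (rule absv_lim_le[OF assms(1)[unfolded sums_def]])
  have "0 \<le> B"
    using assms(2)[of 0] absv_nonneg[of "f 0"] by linarith
  then show "\<forall>\<^sub>F n in sequentially. absv (sum f {..<n}) \<le> B"
    using assms(2) by (intro always_eventually allI absv_sum_le) auto
qed simp

lemma has_sum_cmult_nonarch: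
  fixes f :: "'b \<Rightarrow> 'a::nonarch_field"
  assumes "(f has_sum s) A"
  shows "((\<lambda>x. c * f x) has_sum (c * s)) A"
  using assms unfolding has_sum_def sum_distrib_left[symmetric] by (intro tendsto_intros)

lemma has_sum_diff_nonarch:
  fixes f :: "'b \<Rightarrow> 'a::nonarch_field"
  assumes "(f has_sum s) A" "(g has_sum t) A"
  shows "((\<lambda>x. f x - g x) has_sum (s - t)) A"
  using assms unfolding has_sum_def sum_subtractf by (intro tendsto_intros)

lemma sums_cmult_nonarch:
  fixes f :: "nat \<Rightarrow> 'a::nonarch_field"
  assumes "f sums s"
  shows "(\<lambda>x. c * f x) sums (c * s)"
  using assms unfolding sums_def sum_distrib_left[symmetric] by (intro tendsto_intros)

lemma sums_diff_nonarch:
  fixes f g :: "nat \<Rightarrow> 'a::nonarch_field"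
  assumes "f sums s" "g sums t"
  shows "(\<lambda>i. f i - g i) sums (s - t)"
  using assms unfolding sums_def sum_subtractf by (intro tendsto_intros)

lemma sums_shift_nonarch:
  fixes f :: "nat \<Rightarrow> 'a::nonarch_field"
  assumes "f sums s"
  shows "(\<lambda>j. f (Suc j)) sums (s - f 0)"
proof -
  have "(\<lambda>n. sum f {..<Suc n} - f 0) \<longlonglongrightarrow> s - f 0"
    using assms unfolding sums_def by (intro tendsto_diff tendsto_const) (rule LIMSEQ_Suc)
  then show ?thesis
    unfolding sums_def by (simp add: sum.lessThan_Suc_shift del: sum.lessThan_Suc)
qed

text \<open>The general theorem on iterated sums asks for uniform continuity of addition, which
  holds here with \<delta> = \<epsilon>.\<close>

lemma has_sum_Sigma_nonarch:
  fixes f :: "'a \<times> 'b \<Rightarrow> 'c::nonarch_field"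
  assumes "(f has_sum s) (Sigma A B)" "\<And>x. x \<in> A \<Longrightarrow> ((\<lambda>y. f (x, y)) has_sum b x) (B x)"
  shows "(b has_sum s) A"
proof (rule has_sum_Sigma[OF _ assms])
  show "uniformly_continuous_on UNIV (\<lambda>(x::'c, y). x + y)"
    unfolding uniformly_continuous_on_def
  proof (intro allI impI)
    fix \<epsilon> :: real assume \<epsilon>: "\<epsilon> > 0"
    have *: "dist (case x' of (x, y) \<Rightarrow> x + y) (case x of (x, y) \<Rightarrow> x + y) < \<epsilon>"
      if d: "dist x' x < \<epsilon>" for x x' :: "'c \<times> 'c"
    proof -
      have "absv (fst x' - fst x) < \<epsilon>" "absv (snd x' - snd x) < \<epsilon>"
        using d dist_fst_le[of x' x] dist_snd_le[of x' x] by (simp_all add: dist_absv)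
      then have "absv ((fst x' - fst x) + (snd x' - snd x)) < \<epsilon>"
        by (rule absv_add_less)
      then show ?thesis
        by (simp add: dist_absv case_prod_beta algebra_simps)
    qed
    show "\<exists>d>0. \<forall>x\<in>UNIV. \<forall>x'\<in>UNIV. dist x' x < d \<longrightarrow>
        dist (case x' of (x, y) \<Rightarrow> x + y) (case x of (x :: 'c, y) \<Rightarrow> x + y) < \<epsilon>"
      by (rule exI[of _ \<epsilon>], intro conjI ballI impI, rule \<epsilon>, rule *, assumption)
  qed
qed

subsection \<open>Lagrange interpolation at the roots of a polynomial with derivative 1\<close>

text \<open>The quotient of G by X - x takes the value G'(x) = 1 at x and 0 at the other roots. So
  these quotients form the Lagrange basis without any denominators.\<close>

lemma lagrange_pderiv_1:
  fixes G Q :: "'a::field poly"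
  assumes fin: "finite S" and deg: "degree Q < card S" "degree G \<le> card S"
    and root: "\<And>x. x \<in> S \<Longrightarrow> poly G x = 0" and pd: "pderiv G = 1"
  obtains H where "\<And>x. x \<in> S \<Longrightarrow> G = [:- x, 1:] * H x" "Q = (\<Sum>x\<in>S. smult (poly Q x) (H x))"
proof -
  define H where "H x = G div [:- x, 1:]" for x
  have GH: "G = [:- x, 1:] * H x" if "x \<in> S" for x
    using root[OF that] unfolding H_def poly_eq_0_iff_dvd by (simp only: dvd_mult_div_cancel)
  have Hx: "poly (H x) x = 1" if "x \<in> S" for x
  proof -
    have "pderiv ([:- x, 1:] * H x) = 1"
      using GH[OF that] pd by simp
    then have "poly ([:- x, 1:] * pderiv (H x) + H x * pderiv [:- x, 1:]) x = 1"
      unfolding pderiv_mult by simp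
    then show ?thesis
      by (simp add: pderiv_pCons)
  qed
  have Hy: "poly (H x) y = 0" if "x \<in> S" "y \<in> S" "y \<noteq> x" for x y
    using root[OF that(2)] that(3) by (subst (asm) GH[OF that(1)]) simp
  have degH: "degree (H x) < card S" if "x \<in> S" for x
  proof -
    have "H x \<noteq> 0"
      using Hx[OF that] by auto
    then have "degree G = Suc (degree (H x))"
      using GH[OF that] degree_mult_eq[of "[:- x, 1:]" "H x"] by simp
    then show ?thesis using deg by simp
  qed
  have "Q = (\<Sum>x\<in>S. smult (poly Q x) (H x))"
  proof (rule poly_eqI_degree[of S])
    fix y assume y: "y \<in> S"
    have "(\<Sum>x\<in>S. poly Q x * poly (H x) y) = (\<Sum>x\<in>S. if x = y then poly Q y else 0)"
      using y by (intro sum.cong) (auto simp: Hx Hy)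
    then show "poly Q y = poly (\<Sum>x\<in>S. smult (poly Q x) (H x)) y"
      using fin y by (simp add: poly_sum)
  next
    have "degree (\<Sum>x\<in>S. smult (poly Q x) (H x)) \<le> card S - 1"
    proof (intro degree_sum_le fin)
      fix x assume "x \<in> S"
      then show "degree (smult (poly Q x) (H x)) \<le> card S - 1"
        using degH[of x] degree_smult_le[of "poly Q x" "H x"] by linarith
    qed
    then show "degree (\<Sum>x\<in>S. smult (poly Q x) (H x)) < card S"
      using deg by linarith
  qed (use deg in auto)
  with GH show thesis
    by (rule that)
qed

text \<open>Evaluation of the interpolation formula at 0, meant for the roots of a translate of a
  lattice that avoids 0.\<close>

lemma lagrange_at_0:
  fixes G Q :: "'a::field poly"
  assumes "finite S" "degree Q < card S" "degree G \<le> card S"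
    "\<And>x. x \<in> S \<Longrightarrow> poly G x = 0" "pderiv G = 1" and nz: "0 \<notin> S"
  shows "poly Q 0 = - poly G 0 * (\<Sum>x\<in>S. poly Q x / x)"
proof -
  obtain H where H: "\<And>x. x \<in> S \<Longrightarrow> G = [:- x, 1:] * H x" "Q = (\<Sum>x\<in>S. smult (poly Q x) (H x))"
    using lagrange_pderiv_1[OF assms(1-5)] by blast
  have "poly (H x) 0 = - poly G 0 / x" if "x \<in> S" for x
  proof -
    have "poly G 0 = poly ([:- x, 1:] * H x) 0"
      using H(1)[OF that] by simp
    moreover have "x \<noteq> 0"
      using that nz by auto
    ultimately show ?thesis
      by (simp add: field_simps)
  qed
  then have "poly Q 0 = (\<Sum>x\<in>S. poly Q x * (- poly G 0 / x))"
    by (subst H(2)) (simp add: poly_sum)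
  then show ?thesis
    by (simp add: sum_distrib_left sum_negf mult_ac)
qed

text \<open>If 0 is itself a root, the quotient of G by X - x has linear coefficient -1/x for every
  other root x, while the root 0 contributes nothing because Q vanishes there.\<close>

lemma lagrange_linear_coeff:
  fixes G Q :: "'a::field poly"
  assumes "finite S" "degree Q < card S" "degree G \<le> card S"
    "\<And>x. x \<in> S \<Longrightarrow> poly G x = 0" "pderiv G = 1" and z: "0 \<in> S" "poly Q 0 = 0"
  shows "coeff Q 1 = - (\<Sum>x\<in>S - {0}. poly Q x / x)"
proof -
  obtain H where H: "\<And>x. x \<in> S \<Longrightarrow> G = [:- x, 1:] * H x" "Q = (\<Sum>x\<in>S. smult (poly Q x) (H x))"
    using lagrange_pderiv_1[OF assms(1-5)] by blast
  have G: "coeff G 0 = 0" "coeff G 1 = 1"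
    using assms(4)[OF z(1)] arg_cong[OF assms(5), of "\<lambda>p. coeff p 0"]
    by (simp_all add: poly_0_coeff_0 coeff_pderiv)
  have "coeff (H x) 1 = - 1 / x" if "x \<in> S - {0}" for x
  proof -
    have x: "x \<in> S" "x \<noteq> 0" using that by auto
    then have "coeff ([:- x, 1:] * H x) 0 = 0" "coeff ([:- x, 1:] * H x) 1 = 1"
      using H(1)[of x] G by simp_all
    then have "coeff (H x) 0 = 0" "coeff (H x) 0 - x * coeff (H x) 1 = 1"
      using x by simp_all
    then have "x * coeff (H x) 1 = - 1"
      by (simp add: minus_equation_iff)
    then show ?thesis using x by (simp add: field_simps)
  qed
  then have "(\<Sum>x\<in>S - {0}. poly Q x * coeff (H x) 1) = - (\<Sum>x\<in>S - {0}. poly Q x / x)"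
    by (simp flip: sum_negf)
  moreover have "coeff Q 1 = (\<Sum>x\<in>S. poly Q x * coeff (H x) 1)"
    by (subst H(2)) (simp add: coeff_sum)
  ultimately show ?thesis
    using assms(1) z by (simp add: sum.remove[of S 0])
qed

subsection \<open>Additive polynomials\<close>

text \<open>A finite vector space over the constants. Conditions on coefficients instead of
  \<open>degree\<close> keep 0 in it, also for n = 0.\<close>

definition deg_less :: "nat \<Rightarrow> 'f::{field,finite} poly set" where
  "deg_less n = {a. \<forall>i\<ge>n. coeff a i = 0}"

lemma deg_less_0 [simp]: "deg_less 0 = {0}"
  by (auto simp: deg_less_def poly_eq_iff)

lemma deg_less_Suc: "deg_less (Suc n) = (\<lambda>(c, a). a + monom c n) ` (UNIV \<times> deg_less n)"
proof (intro equalityI subsetI)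
  fix a :: "'f::{field,finite} poly" assume "a \<in> deg_less (Suc n)"
  then have "a - monom (coeff a n) n \<in> deg_less n"
    by (auto simp: deg_less_def le_Suc_eq)
  then have "a - monom (coeff a n) n + monom (coeff a n) n \<in> (\<lambda>(c, a). a + monom c n) ` (UNIV \<times> deg_less n)"
    by (intro image_eqI[of _ _ "(coeff a n, a - monom (coeff a n) n)"]) auto
  then show "a \<in> (\<lambda>(c, a). a + monom c n) ` (UNIV \<times> deg_less n)"
    by simp
qed (auto simp: deg_less_def)

lemma finite_deg_less [simp]: "finite (deg_less n :: 'f::{field,finite} poly set)"
  by (induction n) (simp_all add: deg_less_Suc)

lemma card_deg_less: "card (deg_less n :: 'f::{field,finite} poly set) = CARD('f) ^ n"
proof (induction n)
  case (Suc n)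
  have "inj_on (\<lambda>(c, a). a + monom c n) (UNIV \<times> (deg_less n :: 'f poly set))"
  proof (rule inj_onI, clarify)
    fix c d :: 'f and a b :: "'f poly"
    assume ab: "a \<in> deg_less n" "b \<in> deg_less n" and eq: "a + monom c n = b + monom d n"
    have "coeff (a + monom c n) n = coeff (b + monom d n) n"
      using eq by simp
    then have "c = d"
      using ab by (simp add: deg_less_def)
    then show "c = d \<and> a = b"
      using eq by simp
  qed
  then show ?case
    using Suc by (simp add: deg_less_Suc card_image card_cartesian_product)
qed simp

lemma deg_less_mono: "m \<le> n \<Longrightarrow> deg_less m \<subseteq> deg_less n"
  by (auto simp: deg_less_def)

lemma deg_less_iff: "a \<in> deg_less n \<longleftrightarrow> a = 0 \<or> degree a < n"
  unfolding deg_less_def by (auto simp: coeff_eq_0) (metis leading_coeff_0_iff not_less)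

lemma monom_in_deg_less [simp]: "monom c m \<in> deg_less n \<longleftrightarrow> c = 0 \<or> m < n"
  by (auto simp: deg_less_def not_less)

lemma zero_in_deg_less [simp]: "0 \<in> deg_less n"
  by (simp add: deg_less_def)

text \<open>These subspaces exhaust the polynomial ring, so an unconditional sum is the limit of its
  sums over them. This is how identities for finite sublattices reach the whole lattice.\<close>

lemma filterlim_deg_less: "filterlim deg_less (finite_subsets_at_top UNIV) sequentially"
  unfolding filterlim_iff eventually_finite_subsets_at_top
proof (intro allI impI)
  fix P and S :: "'f::{field,finite} poly set"
  assume "\<exists>S::'f poly set. finite S \<and> S \<subseteq> UNIV \<and> (\<forall>T. finite T \<and> S \<subseteq> T \<and> T \<subseteq> UNIV \<longrightarrow> P T)"
  then obtain S :: "'f poly set" where S: "finite S" "\<And>T. finite T \<Longrightarrow> S \<subseteq> T \<Longrightarrow> P T"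
    by auto
  define N where "N = Suc (Max (insert 0 (degree ` S)))"
  have "P (deg_less n)" if "n \<ge> N" for n
  proof (rule S(2))
    show "S \<subseteq> deg_less n"
    proof
      fix a assume "a \<in> S"
      then have "degree a \<le> Max (insert 0 (degree ` S))"
        using S by (intro Max_ge) auto
      then show "a \<in> deg_less n"
        using that by (simp add: deg_less_iff N_def)
    qed
  qed simp
  then show "\<forall>\<^sub>F n in sequentially. P (deg_less n)"
    by (auto simp: eventually_sequentially)
qed

lemma has_sum_deg_less:
  fixes f :: "'f::{field,finite} poly \<Rightarrow> 'c::nonarch_field"
  assumes "(f has_sum s) UNIV"
  shows "(\<lambda>n. sum f (deg_less n)) \<longlonglongrightarrow> s"
  using filterlim_compose[OF assms[unfolded has_sum_def] filterlim_deg_less] .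

lemma has_sum_deg_less_nz:
  fixes f :: "'f::{field,finite} poly \<Rightarrow> 'c::nonarch_field"
  assumes "(f has_sum s) (UNIV - {0})"
  shows "(\<lambda>n. sum f (deg_less n - {0})) \<longlonglongrightarrow> s"
proof -
  have "((\<lambda>a. if a = 0 then 0 else f a) has_sum s) UNIV"
    using assms by (subst has_sum_cong_neutral[of "UNIV - {0}" UNIV f]) auto
  moreover have "(\<Sum>a\<in>deg_less n. if a = 0 then 0 else f a) = sum f (deg_less n - {0})" for n
    by (rule sum.mono_neutral_cong_right) auto
  ultimately show ?thesis
    using has_sum_deg_less[of "\<lambda>a. if a = 0 then 0 else f a" s] by simp
qed

section \<open>Frobenius-linear polynomials over a field of characteristic p\<close>

locale frobenius_setting =
  fixes q :: nat and \<kappa> :: "'f::{field,finite} \<Rightarrow> 'c::{nonarch_field,complete_space}"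
  assumes q_ge_2: "2 \<le> q" and card_f: "CARD('f) = q" and of_nat_q: "of_nat q = (0::'c)"
    and frob_add: "(x + y) ^ q = x ^ q + (y::'c) ^ q"
    and kappa_1: "\<kappa> 1 = 1" and kappa_add: "\<kappa> (a + b) = \<kappa> a + \<kappa> b"
    and kappa_mult: "\<kappa> (a * b) = \<kappa> a * \<kappa> b" and kappa_power_q: "\<kappa> a ^ q = \<kappa> a"
begin

lemma kappa_0 [simp]: "\<kappa> 0 = 0"
  using kappa_add[of 0 0] by (metis add_0 add_cancel_right_right)

lemma q_pos [simp]: "0 < q" "q \<noteq> 0" "0 < q ^ k" "1 \<le> q ^ k" "Suc 0 < q" "Suc 0 \<le> q ^ k"
  using q_ge_2 by (auto simp: Suc_le_eq)

lemma q_power_inj [simp]: "q ^ i = q ^ j \<longleftrightarrow> i = j"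
  using q_ge_2 by simp

lemma kappa_nonzero: "c \<noteq> 0 \<Longrightarrow> \<kappa> c \<noteq> 0"
  using kappa_mult[of c "inverse c"] kappa_1 by auto

text \<open>A nonzero constant is a root of unity of order dividing q - 1.\<close>

lemma absv_kappa: "c \<noteq> 0 \<Longrightarrow> absv (\<kappa> c) = 1"
proof -
  assume "c \<noteq> 0"
  then have "absv (\<kappa> c) > 0" "absv (\<kappa> c) ^ q = absv (\<kappa> c)"
    using kappa_nonzero kappa_power_q[of c] by (auto simp flip: absv_power)
  then have "absv (\<kappa> c) ^ (q - 1) * absv (\<kappa> c) = 1 * absv (\<kappa> c)"
    by (subst power_minus_mult) simp_all
  then have "absv (\<kappa> c) ^ (q - 1) = 1"
    using \<open>absv (\<kappa> c) > 0\<close> by simp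
  then show "absv (\<kappa> c) = 1"
    using q_ge_2 absv_nonneg[of "\<kappa> c"] power_eq_1_iff[of "absv (\<kappa> c)" "q - 1"] by simp
qed

lemma absv_kappa_le: "absv (\<kappa> c) \<le> 1"
  by (cases "c = 0") (simp_all add: absv_kappa)

lemma kappa_power_qk: "\<kappa> c ^ (q ^ k) = \<kappa> c"
  by (induction k) (simp_all add: power_mult kappa_power_q)

lemma frob_minus: "(- x) ^ q = - ((x::'c) ^ q)"
  using frob_add[of x "- x"] q_ge_2 by (simp add: eq_neg_iff_add_eq_0 add.commute power_0_left)

lemma frob_diff: "(x - y) ^ q = x ^ q - (y::'c) ^ q"
  using frob_add[of x "- y"] by (simp add: frob_minus)

lemma frob_add_k: "(x + y) ^ (q ^ k) = x ^ (q ^ k) + (y::'c) ^ (q ^ k)"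
  by (induction k) (simp_all add: power_mult frob_add mult.commute[of q])

lemma frob_diff_k: "(x - y) ^ (q ^ k) = x ^ (q ^ k) - (y::'c) ^ (q ^ k)"
  by (induction k) (simp_all add: power_mult frob_diff mult.commute[of q])

lemma frob_sum_k: "(\<Sum>i\<in>A. f i) ^ (q ^ k) = (\<Sum>i\<in>A. (f i :: 'c) ^ (q ^ k))"
  by (induction A rule: infinite_finite_induct) (simp_all add: power_0_left frob_add_k)

lemma has_sum_frob:
  assumes "((f :: 'b \<Rightarrow> 'c) has_sum s) A"
  shows "((\<lambda>x. f x ^ (q ^ k)) has_sum s ^ (q ^ k)) A"
  using assms unfolding has_sum_def frob_sum_k[symmetric] by (intro tendsto_intros)

text \<open>The value at x of the twisted polynomial with coefficients c in \<tau> = Frobenius. The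
  bound n truncates: coefficients from index n on are ignored.\<close>

definition tau_poly :: "nat \<Rightarrow> (nat \<Rightarrow> 'c) \<Rightarrow> 'c \<Rightarrow> 'c" where
  "tau_poly n c x = (\<Sum>j<n. c j * x ^ (q ^ j))"

definition tau_poly' :: "nat \<Rightarrow> (nat \<Rightarrow> 'c) \<Rightarrow> 'c poly" where
  "tau_poly' n c = (\<Sum>j<n. monom (c j) (q ^ j))"

lemma poly_tau_poly' [simp]: "poly (tau_poly' n c) x = tau_poly n c x"
  by (simp add: tau_poly'_def tau_poly_def poly_sum poly_monom)

lemma coeff_tau_poly': "coeff (tau_poly' n c) (q ^ j) = (if j < n then c j else 0)"
  by (auto simp: tau_poly'_def coeff_sum)

lemma degree_tau_poly': "degree (tau_poly' (Suc n) c) \<le> q ^ n"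
  unfolding tau_poly'_def
proof (intro degree_sum_le)
  fix j assume "j \<in> {..<Suc n}"
  then have "q ^ j \<le> q ^ n"
    using q_ge_2 by (intro power_increasing) auto
  then show "degree (monom (c j) (q ^ j)) \<le> q ^ n"
    using degree_monom_le order_trans by blast
qed simp

lemma degree_tau_poly'_less: "degree (tau_poly' n c) < q ^ n"
proof (cases n)
  case (Suc m)
  then show ?thesis
    using degree_tau_poly'[of m c] power_strict_increasing[of m n q] q_ge_2 by (metis lessI less_le_trans not_less order_less_le_trans Suc_1 Suc_le_lessD le_less_trans)
qed (simp add: tau_poly'_def)

lemma pderiv_tau_poly': "pderiv (tau_poly' (Suc n) c) = [:c 0:]"
proof -
  have "pderiv (monom (c (Suc j)) (q ^ Suc j)) = 0" for j
    by (simp add: pderiv_monom of_nat_q)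
  then show ?thesis
    using higher_pderiv_sum[of 1 "\<lambda>j. monom (c j) (q ^ j)" "{..<Suc n}"]
    unfolding tau_poly'_def by (simp add: sum.lessThan_Suc_shift pderiv_monom monom_0 of_nat_q del: sum.lessThan_Suc)
qed

lemma tau_poly_add: "tau_poly n c (x + y) = tau_poly n c x + tau_poly n c y"
  by (simp add: tau_poly_def frob_add_k ring_distribs sum.distrib)

lemma tau_poly_0 [simp]: "tau_poly n c 0 = 0"
  by (simp add: tau_poly_def power_0_left)

lemma tau_poly_kappa: "tau_poly n c (\<kappa> s * x) = \<kappa> s * tau_poly n c x"
  by (simp add: tau_poly_def power_mult_distrib kappa_power_qk sum_distrib_left mult_ac)

lemma tau_poly_extend:
  assumes "n \<le> m" "\<And>j. n \<le> j \<Longrightarrow> j < m \<Longrightarrow> c j = 0"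
  shows "tau_poly m c x = tau_poly n c x"
  unfolding tau_poly_def using assms by (intro sum.mono_neutral_right) auto

lemma tau_poly_unique:
  assumes "finite S" "q ^ n \<le> card S" "\<And>x. x \<in> S \<Longrightarrow> tau_poly n c x = 0" "j < n"
  shows "c j = 0"
proof -
  have "tau_poly' n c = 0"
    using assms(1-3) degree_tau_poly'_less[of n c] q_pos(3)[of n]
    by (intro poly_eqI_degree[of S]) (auto simp del: q_pos)
  then show ?thesis
    using coeff_tau_poly'[of n c j] assms(4) by simp
qed

end

subsection \<open>Exponentials of lattices\<close>

declare absv_eq_0 [simp]

lemma absv_le_0_iff [simp]: "absv x \<le> 0 \<longleftrightarrow> x = (0::'a::nonarch_field)"
  using absv_pos[of x] by (simp del: absv_pos add: not_less[symmetric])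

text \<open>\<open>mu_growth\<close> says that each monomial dominates everything of smaller degree,
  so the images of the monomials are an orthogonal basis; together with \<open>mu_unbounded\<close>
  this makes the lattice discrete.\<close>

locale additive_lattice = frobenius_setting q \<kappa>
  for q and \<kappa> :: "'f::{field,finite} \<Rightarrow> 'c::{nonarch_field,complete_space}" +
  fixes \<mu> :: "'f poly \<Rightarrow> 'c"
  assumes mu_add: "\<mu> (a + b) = \<mu> a + \<mu> b" and mu_smult: "\<mu> (smult c a) = \<kappa> c * \<mu> a"
    and mu_growth: "a \<in> deg_less n \<Longrightarrow> absv (\<mu> a) < absv (\<mu> (monom 1 n))"
    and mu_unbounded: "filterlim (\<lambda>n. absv (\<mu> (monom 1 n))) at_top sequentially"
begin

definition bas :: "nat \<Rightarrow> 'c" where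
  "bas n = \<mu> (monom 1 n)"

lemmas growth = mu_growth[folded bas_def]

lemma mu_0 [simp]: "\<mu> 0 = 0"
  using mu_add[of 0 0] by (metis add_0 add_cancel_right_right)

lemma mu_minus: "\<mu> (- a) = - \<mu> a"
  using mu_add[of a "- a"] by (simp add: eq_neg_iff_add_eq_0 add.commute)

lemma mu_diff: "\<mu> (a - b) = \<mu> a - \<mu> b"
  using mu_add[of a "- b"] by (simp add: mu_minus)

lemma mu_monom: "\<mu> (monom c n) = \<kappa> c * bas n"
  using mu_smult[of c "monom 1 n"] by (simp add: smult_monom bas_def)

lemma bas_nonzero [simp]: "bas n \<noteq> 0"
  using growth[of 0 n] by auto

lemma absv_bas_strict_mono: "m < n \<Longrightarrow> absv (bas m) < absv (bas n)"
  using growth[of "monom 1 m" n] by (simp add: bas_def)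

lemma absv_bas_mono: "m \<le> n \<Longrightarrow> absv (bas m) \<le> absv (bas n)"
  using absv_bas_strict_mono[of m n] by (cases "m = n") auto

lemma absv_mu:
  assumes "a \<noteq> 0"
  shows "absv (\<mu> a) = absv (bas (degree a))"
proof -
  define r where "r = a - monom (lead_coeff a) (degree a)"
  have "r \<in> deg_less (degree a)"
    by (auto simp: r_def deg_less_def coeff_eq_0)
  moreover have "absv (\<mu> (monom (lead_coeff a) (degree a))) = absv (bas (degree a))"
    using assms by (simp add: mu_monom absv_mult absv_kappa)
  moreover have "\<mu> a = \<mu> (monom (lead_coeff a) (degree a)) + \<mu> r"
    by (simp add: r_def flip: mu_add)
  ultimately show ?thesis
    using growth[of r "degree a"] by (simp add: absv_add_eq_left)
qed

lemma mu_eq_0_iff [simp]: "\<mu> a = 0 \<longleftrightarrow> a = 0"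
  using absv_mu[of a] absv_pos[of "bas (degree a)"] by (cases "a = 0") auto

lemma inj_mu: "inj \<mu>"
  by (rule injI) (metis mu_diff mu_eq_0_iff eq_iff_diff_eq_0)

lemma card_mu: "card (\<mu> ` deg_less n) = q ^ n"
  using inj_mu by (simp add: card_image inj_on_subset card_deg_less card_f)

text \<open>
  \<open>al n\<close> lists the coefficients of the additive polynomial with linear coefficient 1 whose roots
  are \<open>\<mu> ` deg_less n\<close>; the recursion is E. H. Moore's.
\<close>

primrec al :: "nat \<Rightarrow> nat \<Rightarrow> 'c" where
  "al 0 = (\<lambda>j. if j = 0 then 1 else 0)"
| "al (Suc n) = (\<lambda>j. al n j -
     (case j of 0 \<Rightarrow> 0 | Suc i \<Rightarrow> al n i ^ q) / tau_poly (Suc n) (al n) (bas n) ^ (q - 1))"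

declare al.simps(2) [simp del]

text \<open>This is x times the product of the 1 - x / \<mu> a over the nonzero a in
  \<open>deg_less n\<close>, the exponential of a finite sublattice.\<close>

definition en :: "nat \<Rightarrow> 'c \<Rightarrow> 'c" where
  "en n x = tau_poly (Suc n) (al n) x"

lemma al_0 [simp]: "al n 0 = 1"
  by (induction n) (simp_all add: al.simps(2))

lemma al_Suc_Suc: "al (Suc n) (Suc j) = al n (Suc j) - al n j ^ q / en n (bas n) ^ (q - 1)"
  by (simp add: al.simps(2) en_def)

lemma al_eq_0: "n < j \<Longrightarrow> al n j = 0"
proof (induction n arbitrary: j)
  case (Suc n)
  then show ?case
    by (cases j) (auto simp: al_Suc_Suc power_0_left)
qed simp

lemma en_conv_tau_poly: "n < m \<Longrightarrow> tau_poly m (al n) x = en n x"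
  unfolding en_def by (intro tau_poly_extend) (auto simp: al_eq_0)

lemma en_add: "en n (x + y) = en n x + en n y"
  by (simp add: en_def tau_poly_add)

lemma en_0 [simp]: "en n 0 = 0"
  by (simp add: en_def)

lemma en_diff: "en n (x - y) = en n x - en n y"
  using en_add[of n "x - y" y] by (simp add: algebra_simps)

lemma en_kappa: "en n (\<kappa> c * x) = \<kappa> c * en n x"
  by (simp add: en_def tau_poly_kappa)

lemma en_zero_index [simp]: "en 0 x = x"
  by (simp add: en_def tau_poly_def)

text \<open>Left multiplication by f \<tau>^m in the ring of twisted polynomials: it shifts the
  coefficients by m and raises them to the power q^m.\<close>

lemma tau_poly_shift:
  "tau_poly (n + m) (\<lambda>j. if m \<le> j then f * c (j - m) ^ (q ^ m) else 0) x = f * tau_poly n c x ^ (q ^ m)"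
proof -
  have "tau_poly (n + m) (\<lambda>j. if m \<le> j then f * c (j - m) ^ (q ^ m) else 0) x
      = (\<Sum>j\<in>{m..<n + m}. f * c (j - m) ^ (q ^ m) * x ^ (q ^ j))"
    unfolding tau_poly_def by (rule sum.mono_neutral_cong_right) auto
  also have "\<dots> = (\<Sum>j<n. f * c j ^ (q ^ m) * x ^ (q ^ (j + m)))"
    by (rule sum.reindex_bij_witness[of _ "\<lambda>j. j + m" "\<lambda>j. j - m"]) auto
  also have "\<dots> = f * tau_poly n c x ^ (q ^ m)"
    by (simp add: tau_poly_def frob_sum_k sum_distrib_left power_mult_distrib power_add mult_ac
        flip: power_mult)
  finally show ?thesis .
qed

lemma tau_poly_diff_coeff: "tau_poly n (\<lambda>j. c j - b j) x = tau_poly n c x - tau_poly n b x"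
  by (simp add: tau_poly_def ring_distribs sum_subtractf)

lemma tau_poly_add_coeff: "tau_poly n (\<lambda>j. c j + b j) x = tau_poly n c x + tau_poly n b x"
  by (simp add: tau_poly_def ring_distribs sum.distrib)

lemma tau_poly_cmult_coeff: "tau_poly n (\<lambda>j. s * c j) x = s * tau_poly n c x"
  by (simp add: tau_poly_def sum_distrib_left mult_ac)

lemma en_Suc: "en (Suc n) x = en n x - en n x ^ q / en n (bas n) ^ (q - 1)"
proof -
  have "al (Suc n) = (\<lambda>j. al n j - (if 1 \<le> j then inverse (en n (bas n) ^ (q - 1)) * al n (j - 1) ^ (q ^ 1) else 0))"
    by (auto simp: fun_eq_iff al_Suc_Suc divide_inverse mult.commute not_le gr0_conv_Suc split: nat.splits simp: al.simps(2) en_def)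
  then have "en (Suc n) x = tau_poly (Suc n + 1) (al n) x
      - inverse (en n (bas n) ^ (q - 1)) * tau_poly (Suc n) (al n) x ^ (q ^ 1)"
    unfolding en_def[of "Suc n"] by (simp add: tau_poly_diff_coeff tau_poly_shift[of "Suc n" 1, simplified])
  then show ?thesis
    by (simp add: en_conv_tau_poly divide_inverse mult.commute)
qed

text \<open>The two claims need each other. In the step, the second one applied to
  \<open>bas n\<close> gives |en n (bas n)| < |en n x|, and then the q-th power term of
  \<open>en_Suc\<close> dominates the other one.\<close>

lemma en_growth:
  assumes "\<And>m. m < n \<Longrightarrow> absv (bas m) < absv x"
  shows "absv x \<le> absv (en n x)" "absv y < absv x \<Longrightarrow> absv (en n y) < absv (en n x)"
proof -
  have "absv x \<le> absv (en n x) \<and> (\<forall>y. absv y < absv x \<longrightarrow> absv (en n y) < absv (en n x))"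
    using assms
  proof (induction n arbitrary: x)
    case (Suc n)
    define b where "b = absv (en n (bas n))"
    define B where "B = absv (en n x)"
    have IH: "absv x \<le> B" "\<And>y. absv y < absv x \<Longrightarrow> absv (en n y) < B"
      using Suc.IH[of x] Suc.prems by (auto simp: B_def)
    have b: "0 < b" "b < B"
      using Suc.IH[of "bas n"] absv_bas_strict_mono IH(2)[of "bas n"] Suc.prems
      by (auto simp: b_def intro: less_le_trans[of 0 "absv (bas n)"])
    have pw: "t ^ q / b ^ (q - 1) = t * (t / b) ^ (q - 1)" for t :: real
      using b by (simp add: power_divide power_minus_mult[of q t] flip: power_Suc)
    have big: "B < B ^ q / b ^ (q - 1)"
    proof -
      have "1 < (B / b) ^ (q - 1)"
        using b q_ge_2 by (intro one_less_power) auto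
      then show ?thesis
        using b unfolding pw by (simp add: mult_less_cancel_left1[of B])
    qed
    have en_x: "absv (en (Suc n) x) = B ^ q / b ^ (q - 1)"
      using big unfolding en_Suc absv_minus_commute[of "en n x"]
      by (subst absv_diff_eq_left) (simp_all add: absv_divide absv_power B_def b_def)
    moreover have "absv (en (Suc n) y) < B ^ q / b ^ (q - 1)" if "absv y < absv x" for y
    proof -
      have y: "absv (en n y) < B"
        using IH that by simp
      then have "absv (en n y) ^ q < B ^ q"
        using q_ge_2 by (intro power_strict_mono absv_nonneg) auto
      then have "absv (en n y ^ q / en n (bas n) ^ (q - 1)) < B ^ q / b ^ (q - 1)"
        using b by (simp add: absv_divide absv_power b_def divide_strict_right_mono)
      then show ?thesis
        using y big unfolding en_Suc
        by (intro le_less_trans[OF absv_diff_le[OF max.cobounded1 max.cobounded2]]) auto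
    qed
    ultimately show ?case
      using IH big by auto
  qed simp
  then show "absv x \<le> absv (en n x)" "absv y < absv x \<Longrightarrow> absv (en n y) < absv (en n x)"
    by auto
qed

lemma absv_en_bas_ge: "absv (bas n) \<le> absv (en n (bas n))"
  by (rule en_growth(1)) (rule absv_bas_strict_mono)

lemma en_bas_nonzero [simp]: "en n (bas n) \<noteq> 0"
  using absv_en_bas_ge[of n] absv_pos[of "bas n"] by auto

text \<open>On a constant multiple of \<open>bas n\<close> the two terms of \<open>en_Suc\<close>
  cancel, because constants equal their q-th powers.\<close>

lemma en_mu_eq_0: "a \<in> deg_less n \<Longrightarrow> en n (\<mu> a) = 0"
proof (induction n arbitrary: a)
  case (Suc n)
  then obtain c b where a: "a = b + monom c n" "b \<in> deg_less n"
    by (auto simp: deg_less_Suc)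
  have "en n (\<mu> a) = \<kappa> c * en n (bas n)"
    using Suc.IH[OF a(2)] by (simp add: a mu_add mu_monom en_add en_kappa)
  then show ?case
    by (simp add: en_Suc power_mult_distrib kappa_power_q power_minus_mult divide_simps
        flip: power_Suc)
qed simp

section \<open>Division, interpolation and power sums on finite sublattices\<close>

lemma al_top_nonzero: "al n n \<noteq> 0"
  by (induction n) (simp_all add: al_Suc_Suc al_eq_0)

lemma tau_poly_mu_unique:
  assumes "\<And>a. a \<in> deg_less n \<Longrightarrow> tau_poly n c (\<mu> a) = 0" "j < n"
  shows "c j = 0"
  using assms by (intro tau_poly_unique[of "\<mu> ` deg_less n" n c j]) (auto simp: card_mu)

text \<open>In the ring of twisted polynomials, one that kills the kernel of \<open>en n\<close> is
  divisible by \<open>en n\<close> from the right; the sum lists the coefficients of the product of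
  f and \<open>en n\<close>. The induction removes the top coefficient by a multiple of \<tau>^m
  \<open>en n\<close>, and the base case counts roots.\<close>

lemma right_division:
  assumes "\<And>j. n + m \<le> j \<Longrightarrow> c j = 0" "\<And>a. a \<in> deg_less n \<Longrightarrow> tau_poly (n + m) c (\<mu> a) = 0"
  shows "\<exists>f. \<forall>j. c j = (\<Sum>i<m. if i \<le> j then f i * al n (j - i) ^ (q ^ i) else 0)"
  using assms
proof (induction m arbitrary: c)
  case 0
  then have "c j = 0" for j
    using tau_poly_mu_unique[of n c j] by (cases "j < n") auto
  then show ?case
    by simp
next
  case (Suc m)
  define s where "s = c (n + m) / al n n ^ (q ^ m)"
  define t where "t j = (if m \<le> j then s * al n (j - m) ^ (q ^ m) else 0)" for j
  have t_top: "t (n + m) = c (n + m)" "\<And>j. n + m < j \<Longrightarrow> t j = 0"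
    by (auto simp: t_def s_def al_top_nonzero al_eq_0 power_0_left)
  have "\<exists>f. \<forall>j. c j - t j = (\<Sum>i<m. if i \<le> j then f i * al n (j - i) ^ (q ^ i) else 0)"
  proof (rule Suc.IH)
    show z: "c j - t j = 0" if "n + m \<le> j" for j
      using that Suc.prems(1)[of j] t_top by (cases "j = n + m") auto
    fix a :: "'f poly" assume a: "a \<in> deg_less n"
    have "tau_poly (n + m) (\<lambda>j. c j - t j) (\<mu> a) = tau_poly (n + Suc m) (\<lambda>j. c j - t j) (\<mu> a)"
      by (rule tau_poly_extend[symmetric]) (use z in auto)
    also have "\<dots> = - tau_poly (Suc n + m) t (\<mu> a)"
      using Suc.prems(2)[OF a] by (simp add: tau_poly_diff_coeff)
    also have "\<dots> = - (s * en n (\<mu> a) ^ (q ^ m))"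
      unfolding t_def tau_poly_shift by (simp add: en_def)
    finally show "tau_poly (n + m) (\<lambda>j. c j - t j) (\<mu> a) = 0"
      using a by (simp add: en_mu_eq_0 power_0_left)
  qed
  then obtain f where f: "\<And>j. c j - t j = (\<Sum>i<m. if i \<le> j then f i * al n (j - i) ^ (q ^ i) else 0)"
    by blast
  have "c j = (\<Sum>i<Suc m. if i \<le> j then (f(m := s)) i * al n (j - i) ^ (q ^ i) else 0)" for j
    using f[of j] by (simp add: t_def algebra_simps cong: if_cong)
  then show ?case
    by blast
qed

text \<open>Newton interpolation: a multiple of \<open>en n\<close> corrects the value at
  \<open>bas n\<close> and leaves the values on \<open>deg_less n\<close> unchanged.\<close>

lemma interpolation:
  assumes w: "\<And>a b. w (a + b) = w a + w b" "\<And>c a. w (smult c a) = \<kappa> c * w a"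
  shows "\<exists>c. (\<forall>j\<ge>n. c j = 0) \<and> (\<forall>a\<in>deg_less n. tau_poly n c (\<mu> a) = w a)"
proof (induction n)
  case 0
  have "w 0 = 0"
    using w(1)[of 0 0] by (metis add_0 add_cancel_right_right)
  then show ?case
    by (intro exI[of _ "\<lambda>_. 0"]) simp
next
  case (Suc n)
  then obtain c where c: "\<And>j. j \<ge> n \<Longrightarrow> c j = 0" "\<And>a. a \<in> deg_less n \<Longrightarrow> tau_poly n c (\<mu> a) = w a"
    by blast
  define s where "s = (w (monom 1 n) - tau_poly n c (bas n)) / en n (bas n)"
  have val: "tau_poly (Suc n) (\<lambda>j. c j + s * al n j) x = tau_poly n c x + s * en n x" for x
    using tau_poly_extend[of n "Suc n" c x] c(1)
    by (simp add: tau_poly_add_coeff tau_poly_cmult_coeff en_def)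
  have "tau_poly (Suc n) (\<lambda>j. c j + s * al n j) (\<mu> a) = w a" if aS: "a \<in> deg_less (Suc n)" for a
  proof -
    obtain d b where a: "a = b + monom d n" "b \<in> deg_less n"
      using aS by (auto simp: deg_less_Suc)
    have "w (monom d n) = \<kappa> d * w (monom 1 n)"
      using w(2)[of d "monom 1 n"] by (simp add: smult_monom)
    moreover have "s * en n (\<mu> a) = \<kappa> d * (w (monom 1 n) - tau_poly n c (bas n))"
      using en_mu_eq_0[OF a(2)] by (simp add: a mu_add mu_monom en_add en_kappa s_def)
    moreover have "tau_poly n c (\<mu> a) = w b + \<kappa> d * tau_poly n c (bas n)"
      using c(2)[OF a(2)] by (simp add: a mu_add mu_monom tau_poly_add tau_poly_kappa)
    ultimately show ?thesis
      by (simp add: val a w algebra_simps)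
  qed
  moreover have "\<forall>j\<ge>Suc n. c j + s * al n j = 0"
    using c(1) by (simp add: al_eq_0)
  ultimately show ?case
    by (intro exI[of _ "\<lambda>j. c j + s * al n j"]) simp
qed

text \<open>This turns weighted sums of reciprocal lattice points into coefficients of interpolating
  polynomials, which division can handle.\<close>

lemma tau_poly_linear_coeff:
  assumes "0 < n"
  shows "c 0 = - (\<Sum>a\<in>deg_less n - {0}. tau_poly n c (\<mu> a) / \<mu> a)"
proof -
  have "coeff (tau_poly' n c) 1 = - (\<Sum>x\<in>\<mu> ` deg_less n - {0}. poly (tau_poly' n c) x / x)"
  proof (rule lagrange_linear_coeff[where G = "tau_poly' (Suc n) (al n)"])
    show "degree (tau_poly' n c) < card (\<mu> ` deg_less n)"
      unfolding card_mu by (rule degree_tau_poly'_less)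
    show "degree (tau_poly' (Suc n) (al n)) \<le> card (\<mu> ` deg_less n)"
      unfolding card_mu by (rule degree_tau_poly')
    show "poly (tau_poly' (Suc n) (al n)) x = 0" if "x \<in> \<mu> ` deg_less n" for x
      using that en_mu_eq_0 by (auto simp: en_def)
    show "0 \<in> \<mu> ` deg_less n"
      by (rule image_eqI[of _ _ 0]) auto
  qed (auto simp: pderiv_tau_poly' one_pCons)
  moreover have "coeff (tau_poly' n c) 1 = c 0"
    using coeff_tau_poly'[of n c 0] assms by simp
  moreover have "\<mu> ` deg_less n - {0} = \<mu> ` (deg_less n - {0})"
    by auto
  ultimately show ?thesis
    using inj_mu by (simp add: sum.reindex inj_on_subset)
qed

text \<open>Dropping the linear term of \<open>en n\<close> makes it divisible by x^q; division by
  x^j then brings the degree below the number q^n of nodes, so Lagrange interpolation applies. A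
  linear term survives only as x^q / x^(q-1).\<close>

lemma en_minus_id_over_power:
  assumes "1 \<le> j" "j \<le> q - 1"
  obtains Q where "degree Q < q ^ n" "poly Q 0 = 0" "coeff Q 1 = (if j = q - 1 then al n 1 else 0)"
    "\<And>x. x \<noteq> 0 \<Longrightarrow> poly Q x = (en n x - x) / x ^ j"
proof -
  define Q where "Q = (\<Sum>i<n. monom (al n (Suc i)) (q ^ Suc i - j))"
  have ge: "q \<le> q ^ Suc i" for i
    by simp
  have pos: "0 < q ^ Suc i - j" for i
    using ge[of i] assms q_ge_2 by linarith
  have "degree Q < q ^ n"
  proof (cases n)
    case (Suc m)
    have "degree Q \<le> q ^ n - 1"
      unfolding Q_def
    proof (intro degree_sum_le)
      fix i assume "i \<in> {..<n}"
      then have "q ^ Suc i \<le> q ^ n"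
        using q_ge_2 by (intro power_increasing) auto
      then have "q ^ Suc i - j \<le> q ^ n - 1"
        using assms by linarith
      then show "degree (monom (al n (Suc i)) (q ^ Suc i - j)) \<le> q ^ n - 1"
        using degree_monom_le order_trans by blast
    qed simp
    then show ?thesis
      using q_pos(3)[of n] by linarith
  qed (simp add: Q_def)
  moreover have "poly Q 0 = 0"
    unfolding Q_def poly_sum poly_monom
    by (intro sum.neutral ballI) (simp only: zero_power[OF pos] mult_zero_right)
  moreover have "coeff Q 1 = (if j = q - 1 then al n 1 else 0)"
  proof -
    have *: "q ^ Suc i - j = 1 \<longleftrightarrow> i = 0 \<and> j = q - 1" for i
    proof (cases i)
      case (Suc k)
      have "2 \<le> q ^ Suc k"
        using q_ge_2 ge[of k] by linarith
      then have "2 * q \<le> q ^ Suc k * q"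
        by (rule mult_le_mono1)
      also have "\<dots> = q ^ Suc i"
        by (simp add: Suc)
      finally have "2 * q \<le> q ^ Suc i" .
      then have "q ^ Suc i - j \<noteq> 1"
        using assms q_ge_2 by linarith
      then show ?thesis
        by (simp add: Suc)
    qed (use assms in auto)
    have "coeff Q 1 = (\<Sum>i<n. if i = 0 \<and> j = q - 1 then al n 1 else 0)"
      unfolding Q_def coeff_sum by (intro sum.cong refl) (use * in \<open>auto simp del: power_Suc\<close>)
    also have "\<dots> = (if j = q - 1 then al n 1 else 0)"
      by (cases n) (auto simp: sum.lessThan_Suc_shift al_eq_0)
    finally show ?thesis .
  qed
  moreover have "poly Q x = (en n x - x) / x ^ j" if "x \<noteq> 0" for x
  proof -
    have "poly Q x = (\<Sum>i<n. al n (Suc i) * x ^ (q ^ Suc i) / x ^ j)"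
      unfolding Q_def poly_sum poly_monom using pos that
      by (intro sum.cong refl) (simp add: power_diff less_imp_le del: power_Suc)
    also have "\<dots> = (en n x - x) / x ^ j"
      by (simp add: en_def tau_poly_def sum.lessThan_Suc_shift sum_divide_distrib del: sum.lessThan_Suc)
    finally show ?thesis .
  qed
  ultimately show thesis
    by (rule that)
qed

text \<open>At a nonzero lattice point x the polynomial \<open>en n\<close> vanishes, so (en n x -
  x) / x^(q-1), divided by x, is -1 / x^(q-1).\<close>

lemma al_1: "al n 1 = (\<Sum>a\<in>deg_less n - {0}. 1 / \<mu> a ^ (q - 1))"
proof -
  obtain Q where Q: "degree Q < q ^ n" "poly Q 0 = 0" "coeff Q 1 = (if q - 1 = q - 1 then al n 1 else 0)"
    "\<And>x. x \<noteq> 0 \<Longrightarrow> poly Q x = (en n x - x) / x ^ (q - 1)"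
    by (rule en_minus_id_over_power[of "q - 1" n]) (use q_ge_2 in auto)
  have "coeff Q 1 = - (\<Sum>x\<in>\<mu> ` deg_less n - {0}. poly Q x / x)"
  proof (rule lagrange_linear_coeff[where G = "tau_poly' (Suc n) (al n)"])
    show "degree Q < card (\<mu> ` deg_less n)"
      unfolding card_mu by (rule Q)
    show "degree (tau_poly' (Suc n) (al n)) \<le> card (\<mu> ` deg_less n)"
      unfolding card_mu by (rule degree_tau_poly')
    show "poly (tau_poly' (Suc n) (al n)) x = 0" if "x \<in> \<mu> ` deg_less n" for x
      using that en_mu_eq_0 by (auto simp: en_def)
    show "0 \<in> \<mu> ` deg_less n"
      by (rule image_eqI[of _ _ 0]) auto
  qed (auto simp: pderiv_tau_poly' one_pCons Q)
  moreover have "\<mu> ` deg_less n - {0} = \<mu> ` (deg_less n - {0})"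
    by auto
  ultimately have "al n 1 = - (\<Sum>a\<in>deg_less n - {0}. poly Q (\<mu> a) / \<mu> a)"
    using inj_mu Q by (simp add: sum.reindex inj_on_subset)
  also have "\<dots> = (\<Sum>a\<in>deg_less n - {0}. 1 / \<mu> a ^ (q - 1))"
    unfolding sum_negf[symmetric] by (intro sum.cong refl) (simp add: Q en_mu_eq_0)
  finally show ?thesis .
qed

text \<open>In Goss's language: the first q Goss polynomials of a lattice are the pure powers. The
  points w - \<mu> a are the roots of \<open>en n\<close> minus the constant \<open>en n w\<close>.
  The case j = 1 interpolates the constant 1; interpolating (en n x - x) / x^k at 0, where it
  vanishes, relates the power sums for k and k + 1.\<close>

lemma sum_inverse_powers:
  assumes w: "w \<notin> \<mu> ` deg_less n" and j: "1 \<le> j" "j \<le> q"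
  shows "(\<Sum>a\<in>deg_less n. 1 / (w - \<mu> a) ^ j) = 1 / en n w ^ j"
proof -
  define S where "S = (\<lambda>a. w - \<mu> a) ` deg_less n"
  have inj: "inj_on (\<lambda>a. w - \<mu> a) (deg_less n)"
    using inj_mu by (auto simp: inj_on_def)
  have S: "finite S" "card S = q ^ n" "0 \<notin> S"
    using w by (auto simp: S_def card_image[OF inj] card_deg_less card_f)
  have enS: "en n x = en n w" if "x \<in> S" for x
    using that by (auto simp: S_def en_diff en_mu_eq_0)
  define G where "G = tau_poly' (Suc n) (al n) - [:en n w:]"
  have G: "degree G \<le> card S" "pderiv G = 1" "poly G 0 = - en n w" "\<And>x. x \<in> S \<Longrightarrow> poly G x = 0"
    using degree_tau_poly'[of n "al n"]
    by (auto simp: G_def S pderiv_diff pderiv_tau_poly' one_pCons enS simp flip: en_def intro!: degree_diff_le)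
  have L: "poly Q 0 = en n w * (\<Sum>x\<in>S. poly Q x / x)" if "degree Q < q ^ n" for Q
    using lagrange_at_0[of S Q G] G S that by simp
  have 1: "en n w * (\<Sum>x\<in>S. 1 / x) = 1"
    using L[of 1] by simp
  then have nz: "en n w \<noteq> 0"
    by auto
  have "(\<Sum>x\<in>S. 1 / x ^ j) = 1 / en n w ^ j"
    using j
  proof (induction j rule: dec_induct)
    case base
    then show ?case
      using 1 nz by (simp add: field_simps)
  next
    case (step k)
    obtain Q where Q: "degree Q < q ^ n" "poly Q 0 = 0"
      "\<And>x. x \<noteq> 0 \<Longrightarrow> poly Q x = (en n x - x) / x ^ k"
      by (rule en_minus_id_over_power[of k n]) (use step in auto)
    have "0 = (\<Sum>x\<in>S. poly Q x / x)"
      using L[OF Q(1)] Q(2) nz by simp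
    also have "\<dots> = (\<Sum>x\<in>S. en n w * (1 / x ^ Suc k) - 1 / x ^ k)"
    proof (intro sum.cong refl)
      fix x assume x: "x \<in> S"
      then have "x \<noteq> 0"
        using S by auto
      then show "poly Q x / x = en n w * (1 / x ^ Suc k) - 1 / x ^ k"
        by (simp add: Q enS[OF x] diff_divide_distrib)
    qed
    also have "\<dots> = en n w * (\<Sum>x\<in>S. 1 / x ^ Suc k) - 1 / en n w ^ k"
      using step by (simp add: sum_subtractf sum_distrib_left)
    finally show ?case
      using nz by (simp add: field_simps)
  qed
  then show ?thesis
    unfolding S_def by (simp add: sum.reindex[OF inj])
qed

text \<open>In the product for \<open>en n\<close>, coefficient number j is a sum of products of q^j
  - 1 reciprocals of lattice points, each at most 1 / |bas 0|. The induction reproduces this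
  exponent as (q^i - 1) q + (q - 1) = q^(i+1) - 1.\<close>

lemma absv_al_le: "absv (al n j) \<le> (1 / absv (bas 0)) ^ (q ^ j - 1)"
proof (induction n arbitrary: j)
  case (Suc n)
  let ?B = "1 / absv (bas 0)"
  show ?case
  proof (cases j)
    case (Suc i)
    have "1 / absv (en n (bas n)) \<le> ?B"
      using absv_en_bas_ge[of n] absv_bas_mono[of 0 n] by (intro divide_left_mono mult_pos_pos) auto
    then have "(1 / absv (en n (bas n))) ^ (q - 1) \<le> ?B ^ (q - 1)"
      by (intro power_mono) (auto simp: absv_nonneg)
    moreover have "absv (al n i) ^ q \<le> (?B ^ (q ^ i - 1)) ^ q"
      using Suc.IH[of i] by (intro power_mono absv_nonneg)
    ultimately have "absv (al n i) ^ q * (1 / absv (en n (bas n))) ^ (q - 1) \<le> (?B ^ (q ^ i - 1)) ^ q * ?B ^ (q - 1)"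
      by (intro mult_mono) (auto simp: absv_nonneg)
    also have "\<dots> = ?B ^ (q ^ Suc i - 1)"
    proof -
      have "(q ^ i - 1) * q + (q - 1) = q ^ Suc i - 1"
        using q_ge_2 q_pos(3)[of i] by (cases "q ^ i") (auto simp: mult.commute simp del: q_pos)
      then show ?thesis
        by (simp only: power_mult[symmetric] power_add[symmetric])
    qed
    finally show ?thesis
      using Suc Suc.IH[of "Suc i"] unfolding Suc al_Suc_Suc
      by (intro absv_diff_le) (simp_all add: absv_mult absv_inverse absv_power power_inverse divide_inverse)
  qed simp
qed (simp add: absv_nonneg)

lemma tendsto_inverse_en_bas: "(\<lambda>n. 1 / absv (en n (bas n))) \<longlonglongrightarrow> 0"
proof -
  have "filterlim (\<lambda>n. absv (en n (bas n))) at_top sequentially"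
    using mu_unbounded[folded bas_def] by (rule filterlim_at_top_mono) (simp add: absv_en_bas_ge)
  then show ?thesis
    by (auto intro!: tendsto_divide_0[OF tendsto_const] filterlim_at_top_imp_at_infinity)
qed

lemma convergent_al: "convergent (\<lambda>n. al n j)"
proof (cases j)
  case (Suc i)
  show ?thesis
  proof (rule convergent_nonarch)
    let ?B = "(1 / absv (bas 0)) ^ (q ^ i - 1)"
    have "(\<lambda>n. absv (al (Suc n) j - al n j)) \<longlonglongrightarrow> 0"
    proof (rule tendsto_sandwich[OF _ _ tendsto_const])
      show "(\<lambda>n. ?B ^ q * (1 / absv (en n (bas n))) ^ (q - 1)) \<longlonglongrightarrow> 0"
        by (rule tendsto_eq_intros tendsto_inverse_en_bas refl)+ (use q_ge_2 in \<open>simp add: power_0_left\<close>)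
      show "\<forall>\<^sub>F n in sequentially. absv (al (Suc n) j - al n j) \<le> ?B ^ q * (1 / absv (en n (bas n))) ^ (q - 1)"
      proof (intro always_eventually allI)
        fix n
        have "absv (al (Suc n) j - al n j) = absv (al n i) ^ q * (1 / absv (en n (bas n))) ^ (q - 1)"
          by (simp add: Suc al_Suc_Suc absv_divide absv_power power_one_over)
        also have "\<dots> \<le> ?B ^ q * (1 / absv (en n (bas n))) ^ (q - 1)"
          by (intro mult_right_mono power_mono absv_al_le absv_nonneg) (simp add: absv_nonneg)
        finally show "absv (al (Suc n) j - al n j) \<le> ?B ^ q * (1 / absv (en n (bas n))) ^ (q - 1)" .
      qed
    qed (simp add: absv_nonneg)
    then show "(\<lambda>n. al (Suc n) j - al n j) \<longlonglongrightarrow> 0"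
      by (simp add: tendsto_absv_iff[of _ 0])
  qed
qed (simp add: convergent_const)

text \<open>Coefficients of the exponential of the full lattice, not to be confused with the
  polynomial ring.\<close>

definition A :: "nat \<Rightarrow> 'c" where
  "A j = lim (\<lambda>n. al n j)"

lemma tendsto_A: "(\<lambda>n. al n j) \<longlonglongrightarrow> A j"
  using convergent_al by (simp add: A_def convergent_LIMSEQ_iff)

lemma A_0 [simp]: "A 0 = 1"
  using LIMSEQ_unique[OF tendsto_A[of 0]] by simp

lemma absv_A_le: "absv (A j) \<le> (1 / absv (bas 0)) ^ (q ^ j - 1)"
  by (rule absv_lim_le[OF tendsto_A trivial_limit_sequentially always_eventually]) (rule allI, rule absv_al_le)

end

subsection \<open>Drinfeld modules of rank 2 over the Carlitz module\<close>

context additive_lattice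
begin

text \<open>Interpolating on the Frobenius twists of the lattice makes the sums with denominators
  \<mu> a^(q^k) accessible through \<open>tau_poly_linear_coeff\<close>.\<close>

lemma additive_lattice_power: "additive_lattice q \<kappa> (\<lambda>a. \<mu> a ^ (q ^ k))"
proof unfold_locales
  show "absv (\<mu> a ^ (q ^ k)) < absv (\<mu> (monom 1 n) ^ (q ^ k))" if "a \<in> deg_less n" for a n
    using mu_growth[OF that] unfolding absv_power by (intro power_strict_mono absv_nonneg) simp_all
  show "filterlim (\<lambda>n. absv (\<mu> (monom 1 n) ^ (q ^ k))) at_top sequentially"
    unfolding absv_power using mu_unbounded by (intro filterlim_pow_at_top) simp_all
qed (simp_all add: mu_add mu_smult frob_add_k power_mult_distrib kappa_power_qk)

lemma al_power: "additive_lattice.al q (\<lambda>a. \<mu> a ^ (q ^ k)) n j = al n j ^ (q ^ k)"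
proof -
  interpret P: additive_lattice q \<kappa> "\<lambda>a. \<mu> a ^ (q ^ k)"
    by (rule additive_lattice_power)
  show ?thesis
  proof (induction n arbitrary: j)
    case (Suc n)
    have "P.en n (x ^ (q ^ k)) = en n x ^ (q ^ k)" for x
      unfolding P.en_def en_def tau_poly_def frob_sum_k
      by (simp add: Suc.IH power_mult_distrib flip: power_mult) (simp add: mult.commute)
    then have "P.en n (P.bas n) = en n (bas n) ^ (q ^ k)"
      by (simp add: P.bas_def bas_def)
    then show ?case
      by (cases j) (simp_all add: P.al_Suc_Suc al_Suc_Suc Suc.IH frob_diff_k power_divide mult.commute
          flip: power_mult)
  qed simp
qed

lemma A_power: "additive_lattice.A q (\<lambda>a. \<mu> a ^ (q ^ k)) j = A j ^ (q ^ k)"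
proof -
  interpret P: additive_lattice q \<kappa> "\<lambda>a. \<mu> a ^ (q ^ k)"
    by (rule additive_lattice_power)
  have "(\<lambda>n. P.al n j) \<longlonglongrightarrow> A j ^ (q ^ k)"
    unfolding al_power by (intro tendsto_intros tendsto_A)
  then show ?thesis
    using P.tendsto_A LIMSEQ_unique by blast
qed

text \<open>Both c and b \<tau> take the values w on the sublattice, so their difference is
  divisible by \<open>en n\<close>; the degrees leave only a constant quotient, and the linear
  coefficient identifies it as \<open>c 0\<close>.\<close>

lemma interpolation_twist:
  assumes c: "\<And>j. n \<le> j \<Longrightarrow> c j = 0" "\<And>a. a \<in> deg_less n \<Longrightarrow> tau_poly n c (\<mu> a) = w a"
    and b: "\<And>j. n \<le> j \<Longrightarrow> b j = 0" "\<And>a. a \<in> deg_less n \<Longrightarrow> tau_poly n b (\<mu> a ^ q) = w a"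
  shows "c (Suc j) = c 0 * al n (Suc j) + b j"
proof -
  define s where "s j = (if 1 \<le> j then 1 * b (j - 1) ^ (q ^ 0) else 0)" for j
  have shift: "tau_poly (n + 1) s x = tau_poly n b (x ^ q)" for x
  proof -
    have "tau_poly (n + 1) s x = (\<Sum>j<n. b j * x ^ (q ^ Suc j))"
      unfolding tau_poly_def s_def by (simp add: sum.lessThan_Suc_shift del: sum.lessThan_Suc)
    then show ?thesis
      by (simp add: tau_poly_def power_mult)
  qed
  have "\<exists>f. \<forall>j. c j - s j = (\<Sum>i<1. if i \<le> j then f i * al n (j - i) ^ (q ^ i) else 0)"
  proof (rule right_division)
    show "c j - s j = 0" if "n + 1 \<le> j" for j
      using that b(1)[of "j - 1"] c(1)[of j] by (simp add: s_def)
    show "tau_poly (n + 1) (\<lambda>j. c j - s j) (\<mu> a) = 0" if "a \<in> deg_less n" for a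
      using c(2)[OF that] b(2)[OF that] c(1) tau_poly_extend[of n "n + 1" c "\<mu> a"]
      unfolding tau_poly_diff_coeff shift by simp
  qed
  then obtain f where f: "c j - s j = (\<Sum>i<1. if i \<le> j then f i * al n (j - i) ^ (q ^ i) else 0)" for j
    by blast
  show ?thesis
    using f[of 0] f[of "Suc j"] by (simp add: s_def algebra_simps)
qed

end

text \<open>
  The lattice is a module over the Carlitz action \<open>x \<mapsto> \<eta> x + x\<^sup>q\<close>, so that \<open>A\<close> lists the
  coefficients of the exponential that uniformises a Drinfeld module of rank 2 with
  coefficients \<open>\<eta>\<close>, \<open>gc\<close>, \<open>dc\<close>.
\<close>

locale carlitz_lattice = additive_lattice q \<kappa> \<mu>
  for q and \<kappa> :: "'f::{field,finite} \<Rightarrow> 'c::{nonarch_field,complete_space}" and \<mu> +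
  fixes \<eta> :: 'c
  assumes mu_pCons: "\<mu> (pCons 0 a) = \<eta> * \<mu> a + \<mu> a ^ q"
begin

text \<open>\<open>gc\<close> and \<open>dc\<close> are forced by comparing the coefficients of
  \<tau> and \<tau>^2 in e(\<eta> x + x^q) = \<eta> e(x) + \<open>gc\<close> e(x)^q +
  \<open>dc\<close> e(x)^(q^2), where e is the exponential of the lattice.\<close>

definition gc :: 'c where
  "gc = 1 + (\<eta> ^ q - \<eta>) * A 1"

definition dc :: 'c where
  "dc = (\<eta> ^ (q ^ 2) - \<eta>) * A 2 + A 1 - gc * A 1 ^ q"

text \<open>The coefficients of the right multiple c (\<eta> + \<tau>), that is, of c precomposed
  with the Carlitz action.\<close>

definition ccomp :: "(nat \<Rightarrow> 'c) \<Rightarrow> nat \<Rightarrow> 'c" where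
  "ccomp c j = c j * \<eta> ^ (q ^ j) + (case j of 0 \<Rightarrow> 0 | Suc i \<Rightarrow> c i)"

lemma tau_poly_ccomp:
  assumes "\<And>j. n \<le> j \<Longrightarrow> c j = 0" "n < m"
  shows "tau_poly m (ccomp c) x = tau_poly n c (\<eta> * x + x ^ q)"
proof -
  have "tau_poly m (ccomp c) x = tau_poly (Suc n) (ccomp c) x"
    using assms by (intro tau_poly_extend) (auto simp: ccomp_def split: nat.splits)
  also have "\<dots> = (\<Sum>j<Suc n. c j * \<eta> ^ (q ^ j) * x ^ (q ^ j)) + (\<Sum>j<n. c j * x ^ (q ^ Suc j))"
    by (simp add: tau_poly_def ccomp_def ring_distribs sum.distrib sum.lessThan_Suc_shift del: sum.lessThan_Suc)
  also have "\<dots> = (\<Sum>j<n. c j * \<eta> ^ (q ^ j) * x ^ (q ^ j)) + (\<Sum>j<n. c j * x ^ (q ^ Suc j))"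
    using assms by simp
  also have "\<dots> = tau_poly n c (\<eta> * x + x ^ q)"
    by (simp add: tau_poly_def frob_add_k ring_distribs sum.distrib power_mult_distrib mult.assoc power_mult)
  finally show ?thesis .
qed

lemma pCons_deg_less: "a \<in> deg_less n \<Longrightarrow> pCons 0 a \<in> deg_less (Suc n)"
  by (auto simp: deg_less_def coeff_pCons split: nat.splits)

text \<open>Multiplication by the variable raises degrees by one, so \<open>en (Suc n)\<close> after
  the Carlitz action kills the kernel of \<open>en n\<close>. The quotient has degree 2 in \<tau>,
  hence the three coefficients \<open>f n i\<close>; in the limit it is the rank 2 module.\<close>

lemma A_recurrence:
  "(\<eta> ^ (q ^ Suc (Suc j)) - \<eta>) * A (Suc (Suc j)) + A (Suc j) = gc * A (Suc j) ^ q + dc * A j ^ (q ^ 2)"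
proof -
  have "\<exists>f. \<forall>j. ccomp (al (Suc n)) j = (\<Sum>i<3. if i \<le> j then f i * al n (j - i) ^ (q ^ i) else 0)" for n
  proof (rule right_division)
    show "ccomp (al (Suc n)) j = 0" if "n + 3 \<le> j" for j
      using that by (auto simp: ccomp_def al_eq_0 split: nat.splits)
    show "tau_poly (n + 3) (ccomp (al (Suc n))) (\<mu> a) = 0" if "a \<in> deg_less n" for a
      using en_mu_eq_0[OF pCons_deg_less[OF that]]
      by (subst tau_poly_ccomp[of "Suc (Suc n)"]) (simp_all add: al_eq_0 en_def mu_pCons)
  qed
  then have "\<forall>n. \<exists>f. \<forall>j. ccomp (al (Suc n)) j = (\<Sum>i<3. if i \<le> j then f i * al n (j - i) ^ (q ^ i) else 0)"
    by (rule allI)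
  from choice[OF this] obtain f where
    f: "\<forall>n j. ccomp (al (Suc n)) j = (\<Sum>i<3. if i \<le> j then f n i * al n (j - i) ^ (q ^ i) else 0)"
    by (rule exE)
  have f': "ccomp (al (Suc n)) j = f n 0 * al n j + (if 1 \<le> j then f n 1 * al n (j - 1) ^ q else 0)
      + (if 2 \<le> j then f n 2 * al n (j - 2) ^ (q ^ 2) else 0)" for n j
    using f[rule_format, of n j] by (simp add: numeral_3_eq_3 numeral_2_eq_2)
  have f0: "f n 0 = \<eta>" for n
    using f'[of n 0] by (simp add: ccomp_def)
  have f1: "f n 1 = al (Suc n) 1 * \<eta> ^ q + 1 - \<eta> * al n 1" for n
    using f'[of n 1] by (simp add: ccomp_def f0)
  have f2: "f n 2 = al (Suc n) 2 * \<eta> ^ (q ^ 2) + al (Suc n) 1 - \<eta> * al n 2 - f n 1 * al n 1 ^ q" for n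
    using f'[of n 2] by (simp add: ccomp_def f0 numeral_2_eq_2)
  note lims = tendsto_A LIMSEQ_Suc[OF tendsto_A]
  have l1: "(\<lambda>n. f n 1) \<longlonglongrightarrow> gc"
    unfolding f1 by (rule tendsto_eq_intros lims refl)+ (simp add: gc_def algebra_simps)
  have l2: "(\<lambda>n. f n 2) \<longlonglongrightarrow> dc"
    unfolding f2 by (rule tendsto_eq_intros lims l1 refl)+ (simp add: dc_def algebra_simps)
  have "(\<lambda>n. ccomp (al (Suc n)) (Suc (Suc j))) \<longlonglongrightarrow> A (Suc (Suc j)) * \<eta> ^ (q ^ Suc (Suc j)) + A (Suc j)"
    unfolding ccomp_def nat.case by (rule tendsto_eq_intros lims refl)+
  moreover have "(\<lambda>n. ccomp (al (Suc n)) (Suc (Suc j))) \<longlonglongrightarrow> \<eta> * A (Suc (Suc j)) + gc * A (Suc j) ^ q + dc * A j ^ (q ^ 2)"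
  proof -
    have "ccomp (al (Suc n)) (Suc (Suc j)) = \<eta> * al n (Suc (Suc j)) + f n 1 * al n (Suc j) ^ q + f n 2 * al n j ^ (q ^ 2)" for n
      unfolding f' f0 by simp
    then show ?thesis
      by (simp only:) (intro tendsto_intros lims l1 l2)
  qed
  ultimately have "A (Suc (Suc j)) * \<eta> ^ (q ^ Suc (Suc j)) + A (Suc j)
      = \<eta> * A (Suc (Suc j)) + gc * A (Suc j) ^ q + dc * A j ^ (q ^ 2)"
    by (rule LIMSEQ_unique)
  then show ?thesis
    by (simp add: algebra_simps)
qed

text \<open>Let \<open>c i n\<close> interpolate w on the i-th twist of the sublattice. Its linear
  coefficient tends to - \<rho> i, so any relation between coefficients of these polynomials becomes
  one between the \<rho> i.\<close>

lemma three_term: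
  assumes w: "\<And>a b. w (a + b) = w a + w b" "\<And>c a. w (smult c a) = \<kappa> c * w a" "\<And>a. w (pCons 0 a) = t * w a"
    and lim: "\<And>i. (\<lambda>n. \<Sum>a\<in>deg_less n - {0}. w a / \<mu> a ^ (q ^ i)) \<longlonglongrightarrow> \<rho> i"
  shows "(\<eta> ^ (q ^ 2) - t) * \<rho> 2 + gc ^ q * \<rho> 1 + dc * \<rho> 0 = 0"
proof -
  have "\<exists>c. \<forall>n. (\<forall>j\<ge>n. c n j = 0) \<and> (\<forall>a\<in>deg_less n. tau_poly n (c n) (\<mu> a ^ (q ^ i)) = w a)" for i
    using additive_lattice.interpolation[OF additive_lattice_power[of i] w(1,2)] by metis
  then obtain c where c: "\<And>i n j. n \<le> j \<Longrightarrow> c i n j = 0"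
    "\<And>i n a. a \<in> deg_less n \<Longrightarrow> tau_poly n (c i n) (\<mu> a ^ (q ^ i)) = w a"
    by metis
  have c0: "c i n 0 = - (\<Sum>a\<in>deg_less n - {0}. w a / \<mu> a ^ (q ^ i))" if "0 < n" for i n
    using additive_lattice.tau_poly_linear_coeff[OF additive_lattice_power[of i] that, of "c i n"]
    by (simp add: c(2))
  have l0: "(\<lambda>n. c i n 0) \<longlonglongrightarrow> - \<rho> i" for i
  proof (rule Lim_transform_eventually[OF tendsto_minus[OF lim[of i]]])
    show "\<forall>\<^sub>F n in sequentially. - (\<Sum>a\<in>deg_less n - {0}. w a / \<mu> a ^ (q ^ i)) = c i n 0"
      using eventually_gt_at_top[of 0] by eventually_elim (simp add: c0)
  qed
  \<comment> \<open>Expresses every coefficient through linear coefficients of interpolations on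
    higher twists, hence through the \<rho> i in the limit.\<close>
  have twist: "c i n (Suc j) = c i n 0 * al n (Suc j) ^ (q ^ i) + c (Suc i) n j" for i n j
  proof -
    have "tau_poly n (c (Suc i) n) ((\<mu> a ^ (q ^ i)) ^ q) = w a" if "a \<in> deg_less n" for a
      using c(2)[OF that, of "Suc i"] by (simp add: mult.commute flip: power_mult)
    from additive_lattice.interpolation_twist[OF additive_lattice_power[of i] c(1) c(2) c(1) this]
    show ?thesis
      unfolding al_power by simp
  qed
  have l1: "(\<lambda>n. c i n 1) \<longlonglongrightarrow> - (\<rho> (Suc i) + \<rho> i * A 1 ^ (q ^ i))" for i
    unfolding One_nat_def twist[of i _ 0]
    by (rule tendsto_eq_intros l0 tendsto_A refl)+ simp
  have l2: "(\<lambda>n. c 0 n 2) \<longlonglongrightarrow> - (\<rho> 2 + \<rho> 1 * A 1 ^ q + \<rho> 0 * A 2)"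
    unfolding numeral_2_eq_2 twist[of 0 _ "Suc 0"]
    by (rule tendsto_eq_intros l0 l1[unfolded One_nat_def] tendsto_A refl)+ simp
  \<comment> \<open>Both polynomials take the value t w(a) at \<mu> a. The difference has degree at
    most n + 1 in \<tau>, so the quotient has two coefficients; coefficients 0 and 1 determine them,
    and coefficient 2 is the relation sought.\<close>
  have "\<exists>f. \<forall>j. ccomp (c 0 (Suc n)) j - t * c 0 n j = (\<Sum>i<2. if i \<le> j then f i * al n (j - i) ^ (q ^ i) else 0)" for n
  proof (rule right_division)
    show "ccomp (c 0 (Suc n)) j - t * c 0 n j = 0" if "n + 2 \<le> j" for j
      using that by (auto simp: ccomp_def c(1) split: nat.splits)
    fix a :: "'f poly" assume a: "a \<in> deg_less n"
    have "tau_poly (n + 2) (ccomp (c 0 (Suc n))) (\<mu> a) = t * w a"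
      using c(2)[OF pCons_deg_less[OF a], of 0]
      by (subst tau_poly_ccomp[of "Suc n"]) (simp_all add: c(1) mu_pCons w)
    moreover have "tau_poly (n + 2) (c 0 n) (\<mu> a) = w a"
      using c(2)[OF a, of 0] by (subst tau_poly_extend[of n]) (simp_all add: c(1))
    ultimately show "tau_poly (n + 2) (\<lambda>j. ccomp (c 0 (Suc n)) j - t * c 0 n j) (\<mu> a) = 0"
      by (simp add: tau_poly_diff_coeff tau_poly_cmult_coeff)
  qed
  then have "\<forall>n. \<exists>f. \<forall>j. ccomp (c 0 (Suc n)) j - t * c 0 n j
      = (\<Sum>i<2. if i \<le> j then f i * al n (j - i) ^ (q ^ i) else 0)"
    by (rule allI)
  from choice[OF this] obtain f where
    f: "\<forall>n j. ccomp (c 0 (Suc n)) j - t * c 0 n j = (\<Sum>i<2. if i \<le> j then f n i * al n (j - i) ^ (q ^ i) else 0)"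
    by (rule exE)
  define L where "L j n = ccomp (c 0 (Suc n)) j - t * c 0 n j" for j n
  have f': "L j n = f n 0 * al n j + (if 1 \<le> j then f n 1 * al n (j - 1) ^ q else 0)" for n j
    using f[rule_format, of n j] by (simp add: numeral_2_eq_2 L_def)
  have f0: "f n 0 = L 0 n" for n
    using f'[of 0 n] by simp
  have f1: "f n 1 = L 1 n - L 0 n * al n 1" for n
    using f'[of 1 n] by (simp add: f0)
  have f2: "L 2 n = L 0 n * al n 2 + (L 1 n - L 0 n * al n 1) * al n 1 ^ q" for n
    using f'[of 2 n] by (simp add: f0 f1[unfolded One_nat_def] numeral_2_eq_2)
  note lims = l0 l2 l1[of 0, simplified] LIMSEQ_Suc[OF l0] LIMSEQ_Suc[OF l2] LIMSEQ_Suc[OF l1[of 0, simplified]]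
  have L_eq: "L 0 = (\<lambda>n. c 0 (Suc n) 0 * \<eta> - t * c 0 n 0)"
    "L 1 = (\<lambda>n. c 0 (Suc n) (Suc 0) * \<eta> ^ q + c 0 (Suc n) 0 - t * c 0 n (Suc 0))"
    "L 2 = (\<lambda>n. c 0 (Suc n) 2 * \<eta> ^ (q ^ 2) + c 0 (Suc n) (Suc 0) - t * c 0 n 2)"
    by (simp_all add: L_def ccomp_def fun_eq_iff numeral_2_eq_2)
  have L0: "L 0 \<longlonglongrightarrow> - ((\<eta> - t) * \<rho> 0)"
    unfolding L_eq by (rule tendsto_eq_intros lims refl)+ (simp add: algebra_simps)
  have L1: "L 1 \<longlonglongrightarrow> - ((\<eta> ^ q - t) * (\<rho> 1 + \<rho> 0 * A 1) + \<rho> 0)"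
    unfolding L_eq by (rule tendsto_eq_intros lims refl)+ (simp add: algebra_simps)
  have L2: "L 2 \<longlonglongrightarrow> - ((\<eta> ^ (q ^ 2) - t) * (\<rho> 2 + \<rho> 1 * A 1 ^ q + \<rho> 0 * A 2) + (\<rho> 1 + \<rho> 0 * A 1))"
    unfolding L_eq by (rule tendsto_eq_intros lims refl)+ (simp add: algebra_simps)
  have "L 2 \<longlonglongrightarrow> - ((\<eta> - t) * \<rho> 0) * A 2 + (- ((\<eta> ^ q - t) * (\<rho> 1 + \<rho> 0 * A 1) + \<rho> 0) - - ((\<eta> - t) * \<rho> 0) * A 1) * A 1 ^ q"
    unfolding f2[abs_def] by (intro tendsto_intros L0 L1 tendsto_A)
  from LIMSEQ_unique[OF L2 this]
  have eq: "- ((\<eta> ^ (q ^ 2) - t) * (\<rho> 2 + \<rho> 1 * A 1 ^ q + \<rho> 0 * A 2) + (\<rho> 1 + \<rho> 0 * A 1))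
      = - ((\<eta> - t) * \<rho> 0) * A 2 + (- ((\<eta> ^ q - t) * (\<rho> 1 + \<rho> 0 * A 1) + \<rho> 0) - - ((\<eta> - t) * \<rho> 0) * A 1) * A 1 ^ q" .
  have gq: "gc ^ q = 1 + (\<eta> ^ (q ^ 2) - \<eta> ^ q) * A 1 ^ q"
    by (simp add: gc_def frob_add frob_diff power_mult_distrib power2_eq_square flip: power_mult)
  \<comment> \<open>\<open>E1\<close>, \<open>E2\<close> and \<open>a\<close> stand for \<eta>^q,
    \<eta>^(q^2) and \<open>A 1 ^ q\<close>; as variables they keep the simplifier from rearranging
    the powers.\<close>
  have alg: "(E2 - t) * r2 + (1 + (E2 - E1) * a) * r1 + ((E2 - \<eta>) * A2 + A1 - (1 + (E1 - \<eta>) * A1) * a) * r0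
    = - ((\<eta> - t) * r0) * A2 + (- ((E1 - t) * (r1 + r0 * A1) + r0) - - ((\<eta> - t) * r0) * A1) * a
      - - ((E2 - t) * (r2 + r1 * a + r0 * A2) + (r1 + r0 * A1))" for E1 E2 A1 A2 a r0 r1 r2 :: 'c
    by (simp add: algebra_simps)
  show ?thesis
    unfolding gq unfolding dc_def gc_def alg eq by simp
qed

end

subsection \<open>The Legendre relation\<close>

context frobenius_setting
begin

definition eval_at :: "'c \<Rightarrow> 'f poly \<Rightarrow> 'c" where
  "eval_at t a = poly (map_poly \<kappa> a) t"

lemma eval_at_0 [simp]: "eval_at t 0 = 0"
  by (simp add: eval_at_def)

lemma eval_at_pCons: "eval_at t (pCons c a) = \<kappa> c + t * eval_at t a"
  by (simp add: eval_at_def map_poly_pCons)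

lemma eval_at_add: "eval_at t (a + b) = eval_at t a + eval_at t b"
proof (induction a arbitrary: b)
  case (pCons c a)
  obtain d b' where b: "b = pCons d b'"
    by (cases b)
  show ?case
    by (simp add: b eval_at_pCons pCons.IH kappa_add algebra_simps)
qed simp

lemma eval_at_smult: "eval_at t (smult c a) = \<kappa> c * eval_at t a"
  by (induction a) (simp_all add: eval_at_pCons kappa_mult algebra_simps)

lemma eval_at_power_q: "eval_at (t ^ q) a = eval_at t a ^ q"
  by (induction a) (simp_all add: eval_at_pCons frob_add kappa_power_q power_mult_distrib power_0_left)

lemma absv_eval_at_le:
  assumes "absv t \<le> H" "1 \<le> H"
  shows "absv (eval_at t a) \<le> H ^ degree a"
proof (induction a)
  case (pCons c a)
  show ?case
  proof (cases "a = 0")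
    case False
    have "absv t * absv (eval_at t a) \<le> H * H ^ degree a"
      using pCons.IH assms by (intro mult_mono) (auto simp: absv_nonneg)
    moreover have "absv (\<kappa> c) \<le> H * H ^ degree a"
      using absv_kappa_le[of c] one_le_power[OF assms(2), of "Suc (degree a)"] by simp
    ultimately show ?thesis
      using False by (auto simp: eval_at_pCons absv_mult intro!: absv_add_le)
  qed (simp add: eval_at_pCons absv_kappa_le)
qed simp

lemma power_q_minus_Suc_0 [simp]: "x ^ (q - Suc 0) * x = (x :: 'a::comm_monoid_mult) ^ q"
  using power_minus_mult[of q x] by simp

lemma power_q_minus_Suc_0' [simp]: "x * x ^ (q - Suc 0) = (x :: 'a::comm_monoid_mult) ^ q"
  using power_q_minus_Suc_0[of x] by (simp add: mult.commute)

text \<open>For |t| \<le> H^q a polynomial of degree d has |a(t)| \<le> H^(q d), and this has to be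
  absorbed by (H^2)^(q^d - 1). Equality holds for q = 2 and d = 1.\<close>

lemma q_mult_le: "q * d \<le> 2 * (q ^ d - 1)"
proof (induction d)
  case (Suc d)
  obtain s where s: "q ^ d = Suc s"
    using q_pos(3)[of d] by (cases "q ^ d") (auto simp del: q_pos)
  have "q * Suc d \<le> 2 * s + q"
    using Suc s by simp
  also have "\<dots> \<le> 2 * (q * Suc s - 1)"
    using q_ge_2 mult_le_mono1[of 2 q s] unfolding mult_Suc_right by arith
  finally show ?case
    using s by simp
qed simp

lemma le_q_power_minus_1: "d \<le> q ^ d - 1"
proof -
  have "d < q ^ d"
    using q_ge_2 by (intro power_gt_expt) simp
  then show ?thesis by linarith
qed

end

section \<open>Weighted sums of reciprocal lattice points\<close>

lemma has_sum_split_deg_less: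
  fixes f :: "'f::{field,finite} poly \<Rightarrow> 'c::nonarch_field"
  assumes "(f has_sum s) (UNIV - {0})" "\<And>a. a \<notin> deg_less m \<Longrightarrow> absv (f a) \<le> B" "0 \<le> B"
  shows "absv (s - sum f (deg_less m - {0})) \<le> B"
proof -
  have "(\<lambda>n. sum f (deg_less n - {0}) - sum f (deg_less m - {0})) \<longlonglongrightarrow> s - sum f (deg_less m - {0})"
    by (intro tendsto_intros has_sum_deg_less_nz assms)
  then show ?thesis
  proof (rule absv_lim_le)
    have "absv (sum f (deg_less n - {0}) - sum f (deg_less m - {0})) \<le> B" if "m \<le> n" for n
    proof -
      have "sum f (deg_less n - {0}) - sum f (deg_less m - {0}) = sum f (deg_less n - {0} - (deg_less m - {0}))"
        using deg_less_mono[OF that] by (intro sum_diff[symmetric]) auto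
      also have "absv \<dots> \<le> B"
        using assms by (intro absv_sum_le) auto
      finally show ?thesis .
    qed
    then show "\<forall>\<^sub>F n in sequentially. absv (sum f (deg_less n - {0}) - sum f (deg_less m - {0})) \<le> B"
      by (auto simp: eventually_sequentially)
  qed simp
qed

lemma summable_on_poly:
  fixes f :: "'f::{field,finite} poly \<Rightarrow> 'c::{nonarch_field,complete_space}"
  assumes "\<And>a. a \<noteq> 0 \<Longrightarrow> absv (f a) \<le> B (degree a)" "B \<longlonglongrightarrow> 0"
  shows "f summable_on S"
proof (rule summable_on_nonarch)
  fix \<epsilon> :: real assume "\<epsilon> > 0"
  then obtain N where N: "\<And>n. n \<ge> N \<Longrightarrow> B n < \<epsilon>"
    using order_tendstoD(2)[OF assms(2), of \<epsilon>] unfolding eventually_sequentially by auto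
  have "{a\<in>S. absv (f a) \<ge> \<epsilon>} \<subseteq> deg_less N"
  proof
    fix a assume "a \<in> {a\<in>S. absv (f a) \<ge> \<epsilon>}"
    then have "a = 0 \<or> \<not> B (degree a) < \<epsilon>"
      using assms(1)[of a] by force
    then show "a \<in> deg_less N"
      using N[of "degree a"] by (auto simp: deg_less_iff not_less)
  qed
  then show "finite {a\<in>S. absv (f a) \<ge> \<epsilon>}"
    by (rule finite_subset) simp
qed

text \<open>In the application \<eta> is \<theta> and \<open>bas 0\<close> is 1 / u. By
  \<open>bas_large\<close> the q-th power dominates in the Carlitz action on every
  \<open>bas n\<close>, and all series below converge.\<close>

locale large_lattice = carlitz_lattice q \<kappa> \<mu> \<eta>
  for q and \<kappa> :: "'f::{field,finite} \<Rightarrow> 'c::{nonarch_field,complete_space}" and \<mu> \<eta> +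
  assumes eta_gt_1: "1 < absv \<eta>" and bas_large: "absv \<eta> ^ 2 < absv (bas 0)"
begin

text \<open>In the application \<open>H\<close> is |\<theta>| and \<open>U\<close> is |u z|. In the
  estimates each power of \<open>U\<close> pays for two powers of \<open>H\<close>;
  \<open>\<rho>\<close> is what is left.\<close>

definition H :: real where "H = absv \<eta>"
definition U :: real where "U = 1 / absv (bas 0)"

definition \<rho> :: real where "\<rho> = U * H ^ 2"

lemma H_gt_1: "1 < H"
  using eta_gt_1 by (simp add: H_def)

lemma H_pos: "0 < H" "1 \<le> H"
  using H_gt_1 by simp_all

lemma U_pos: "0 < U"
  by (simp add: U_def)

lemma rho_pos: "0 < \<rho>" and rho_less_1: "\<rho> < 1"
  using bas_large U_pos H_pos by (simp_all add: \<rho>_def U_def H_def)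

lemma U_less_1: "U < 1"
proof -
  have "U * 1 < U * H ^ 2"
    using U_pos H_gt_1 by (intro mult_strict_left_mono) auto
  then show ?thesis
    using rho_less_1 by (simp add: \<rho>_def)
qed

lemma absv_bas: "absv (bas n) = (1 / U) ^ (q ^ n)"
proof (induction n)
  case (Suc n)
  have "H < H ^ 2"
    using H_gt_1 by (simp add: power2_eq_square)
  also have "\<dots> < 1 / U"
    using bas_large by (simp add: U_def H_def)
  also have "\<dots> \<le> absv (bas n)"
    using absv_bas_mono[of 0 n] by (simp add: U_def)
  finally have *: "H < absv (bas n)" .
  then have "absv (bas n) ^ 1 \<le> absv (bas n) ^ (q - 1)"
    using q_ge_2 H_gt_1 by (intro power_increasing) auto
  then have "absv (bas n) * H < absv (bas n) * absv (bas n) ^ (q - 1)"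
    using * by (intro mult_strict_left_mono) auto
  also have "\<dots> = absv (bas n) ^ q"
    by (subst mult.commute) simp
  finally have "absv (\<eta> * bas n) < absv (bas n ^ q)"
    by (simp add: absv_mult absv_power H_def mult.commute)
  moreover have "bas (Suc n) = \<eta> * bas n + bas n ^ q"
    using mu_pCons[of "monom 1 n"] by (simp add: bas_def monom_Suc)
  ultimately show ?case
    using Suc by (simp add: absv_add_eq_right absv_power mult.commute flip: power_mult)
qed (simp add: U_def)

lemma absv_inverse_mu: "a \<noteq> 0 \<Longrightarrow> absv (1 / \<mu> a) = U ^ (q ^ degree a)"
  using U_pos by (simp add: absv_divide absv_mu absv_bas power_divide)

text \<open>With d the degree and m = q^k (q^d - 1), the denominator gives U^(q^k) U^m, and U^m
  absorbs the factor H^(q d) from a(t) because q d \<le> 2 m.\<close>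

lemma absv_weighted_le:
  assumes t: "absv t \<le> H ^ q" and a: "a \<noteq> 0"
  shows "absv (eval_at t a / \<mu> a ^ (q ^ k)) \<le> U ^ (q ^ k) * \<rho> ^ (q ^ k * degree a)"
proof -
  define d where "d = degree a"
  define m where "m = q ^ k * (q ^ d - 1)"
  have exp: "q ^ d * q ^ k = q ^ k + m"
    using q_pos(3)[of d] by (cases "q ^ d") (simp_all add: m_def mult.commute del: q_pos)
  have "q * d \<le> 2 * m"
    using q_mult_le[of d] q_pos(3)[of k] unfolding m_def
    by (cases "q ^ k") (auto simp del: q_pos intro: trans_le_add1)
  then have "H ^ (q * d) \<le> H ^ (2 * m)"
    using H_gt_1 by (intro power_increasing) auto
  have "absv (eval_at t a / \<mu> a ^ (q ^ k)) = absv (eval_at t a) * absv (1 / \<mu> a) ^ (q ^ k)"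
    by (simp add: absv_divide absv_power power_one_over)
  also have "\<dots> \<le> (H ^ q) ^ d * (U ^ (q ^ d)) ^ (q ^ k)"
    unfolding absv_inverse_mu[OF a] d_def using t H_pos U_pos
    by (intro mult_right_mono absv_eval_at_le) (auto intro: one_le_power)
  also have "\<dots> = H ^ (q * d) * U ^ (q ^ k + m)"
    by (simp only: power_mult[symmetric] exp)
  also have "\<dots> \<le> H ^ (2 * m) * U ^ (q ^ k + m)"
    using \<open>H ^ (q * d) \<le> H ^ (2 * m)\<close> U_pos by (intro mult_right_mono) auto
  also have "\<dots> = U ^ (q ^ k) * \<rho> ^ m"
    by (simp add: \<rho>_def power_add power_mult power_mult_distrib)
  also have "\<dots> \<le> U ^ (q ^ k) * \<rho> ^ (q ^ k * d)"
    using le_q_power_minus_1[of d] rho_pos rho_less_1 U_pos unfolding m_def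
    by (intro mult_left_mono power_decreasing) auto
  finally show ?thesis
    by (simp add: d_def)
qed

text \<open>At \<open>t = \<eta>\<close> the next sum is, up to sign, the one over monic polynomials that occurs in \<open>x\<^sub>k\<close>.\<close>

definition r :: "nat \<Rightarrow> 'c \<Rightarrow> 'c" where
  "r k t = infsum (\<lambda>a. eval_at t a / \<mu> a ^ (q ^ k)) (UNIV - {0})"

lemma has_sum_r:
  assumes t: "absv t \<le> H ^ q"
  shows "((\<lambda>a. eval_at t a / \<mu> a ^ (q ^ k)) has_sum r k t) (UNIV - {0})"
proof -
  have "(\<lambda>a. eval_at t a / \<mu> a ^ (q ^ k)) summable_on (UNIV - {0})"
  proof (rule summable_on_poly[where B = "\<lambda>n. U ^ (q ^ k) * \<rho> ^ (q ^ k * n)"])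
    show "absv (eval_at t a / \<mu> a ^ (q ^ k)) \<le> U ^ (q ^ k) * \<rho> ^ (q ^ k * degree a)" if "a \<noteq> 0" for a
      using absv_weighted_le[OF t that] .
    have "(\<lambda>n. U ^ (q ^ k) * (\<rho> ^ (q ^ k)) ^ n) \<longlonglongrightarrow> U ^ (q ^ k) * 0"
      using rho_pos rho_less_1 q_pos(3)[of k]
      by (intro tendsto_intros LIMSEQ_power_zero) (simp add: power_less_one_iff)
    then show "(\<lambda>n. U ^ (q ^ k) * \<rho> ^ (q ^ k * n)) \<longlonglongrightarrow> 0"
      by (simp add: power_mult)
  qed
  then show ?thesis
    unfolding r_def by (rule has_sum_infsum)
qed

lemma of_nat_q_minus_1: "of_nat (q - Suc 0) = (- 1 :: 'c)"
  using of_nat_q q_ge_2 by (simp add: of_nat_diff)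

text \<open>The q - 1 nonzero constants contribute equal terms, and q - 1 = -1 in characteristic p;
  all other terms carry at least the factor \<rho>^(q^k).\<close>

lemma r_leading:
  assumes t: "absv t \<le> H ^ q"
  shows "absv (r k t + (1 / bas 0) ^ (q ^ k)) \<le> U ^ (q ^ k) * \<rho> ^ (q ^ k)"
proof -
  have deg1: "deg_less 1 - {0} = (\<lambda>c. [:c:]) ` (UNIV - {0::'f})"
  proof -
    have "deg_less 1 = (\<lambda>(c, a). a + monom c 0) ` (UNIV \<times> {0::'f poly})"
      using deg_less_Suc[of 0] by simp
    then show ?thesis
      by (auto simp: monom_0 image_iff)
  qed
  have mu_c: "\<mu> [:c:] = \<kappa> c * bas 0" for c
    using mu_monom[of c 0] by (simp add: monom_0)
  have "eval_at t [:c:] / \<mu> [:c:] ^ (q ^ k) = (1 / bas 0) ^ (q ^ k)" if "c \<noteq> 0" for c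
    using kappa_nonzero[OF that] by (simp add: eval_at_pCons mu_c power_mult_distrib kappa_power_qk power_one_over)
  then have "(\<Sum>a\<in>deg_less 1 - {0}. eval_at t a / \<mu> a ^ (q ^ k)) = (\<Sum>c\<in>UNIV - {0::'f}. (1 / bas 0) ^ (q ^ k))"
    unfolding deg1 by (subst sum.reindex) (auto simp: inj_on_def)
  also have "\<dots> = - ((1 / bas 0) ^ (q ^ k))"
    by (simp add: card_f of_nat_q_minus_1)
  finally have s: "(\<Sum>a\<in>deg_less 1 - {0}. eval_at t a / \<mu> a ^ (q ^ k)) = - ((1 / bas 0) ^ (q ^ k))" .
  have "absv (r k t - (\<Sum>a\<in>deg_less 1 - {0}. eval_at t a / \<mu> a ^ (q ^ k))) \<le> U ^ (q ^ k) * \<rho> ^ (q ^ k)"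
  proof (rule has_sum_split_deg_less[OF has_sum_r[OF t]])
    fix a :: "'f poly" assume "a \<notin> deg_less 1"
    then have a: "a \<noteq> 0" "1 \<le> degree a"
      by (auto simp: deg_less_iff)
    have "q ^ k * 1 \<le> q ^ k * degree a"
      using a by (intro mult_left_mono) auto
    then have "U ^ (q ^ k) * \<rho> ^ (q ^ k * degree a) \<le> U ^ (q ^ k) * \<rho> ^ (q ^ k)"
      using rho_pos rho_less_1 U_pos by (intro mult_left_mono power_decreasing) auto
    then show "absv (eval_at t a / \<mu> a ^ (q ^ k)) \<le> U ^ (q ^ k) * \<rho> ^ (q ^ k)"
      using absv_weighted_le[OF t a(1)] by (rule order_trans[rotated])
  qed (use U_pos rho_pos in auto)
  then show ?thesis
    unfolding s by simp
qed

lemma absv_r: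
  assumes t: "absv t \<le> H ^ q"
  shows "absv (r k t) = U ^ (q ^ k)"
proof -
  have v: "absv (- ((1 / bas 0) ^ (q ^ k))) = U ^ (q ^ k)"
    by (simp add: absv_power absv_divide U_def)
  have "\<rho> ^ (q ^ k) < 1"
    using rho_pos rho_less_1 q_pos(3)[of k] by (simp add: power_less_one_iff)
  then have "U ^ (q ^ k) * \<rho> ^ (q ^ k) < U ^ (q ^ k)"
    using U_pos by (simp add: mult_less_cancel_left1)
  then have "absv (r k t + (1 / bas 0) ^ (q ^ k)) < absv (- ((1 / bas 0) ^ (q ^ k)))"
    using r_leading[OF t, of k] v by linarith
  then have "absv (- ((1 / bas 0) ^ (q ^ k)) + (r k t + (1 / bas 0) ^ (q ^ k))) = U ^ (q ^ k)"
    using v absv_add_eq_left by metis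
  then show ?thesis by simp
qed

lemma r_frob: "absv t \<le> H \<Longrightarrow> r (Suc k) (t ^ q) = r k t ^ q"
proof -
  assume "absv t \<le> H"
  then have t: "absv t \<le> H ^ q" "absv (t ^ q) \<le> H ^ q"
    using H_gt_1 self_le_power[of H q] by (auto simp: absv_power intro: power_mono absv_nonneg)
  have "((\<lambda>a. (eval_at t a / \<mu> a ^ (q ^ k)) ^ (q ^ 1)) has_sum r k t ^ (q ^ 1)) (UNIV - {0})"
    by (rule has_sum_frob has_sum_r t)+
  then have "((\<lambda>a. eval_at (t ^ q) a / \<mu> a ^ (q ^ Suc k)) has_sum r k t ^ q) (UNIV - {0})"
    by (simp add: eval_at_power_q power_divide mult.commute flip: power_mult)
  then show ?thesis
    using has_sum_r[OF t(2), of "Suc k"] has_sum_unique by blast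
qed

section \<open>The recurrence of the weighted sums and its adjoint\<close>

lemma carlitz_lattice_power: "carlitz_lattice q \<kappa> (\<lambda>a. \<mu> a ^ (q ^ k)) (\<eta> ^ (q ^ k))"
proof -
  interpret P: additive_lattice q \<kappa> "\<lambda>a. \<mu> a ^ (q ^ k)"
    by (rule additive_lattice_power)
  show ?thesis
    by unfold_locales
      (simp add: mu_pCons frob_add_k power_mult_distrib mult.commute flip: power_mult)
qed

text \<open>For k = 0 and t = \<eta> this is the value of h. In general it turns the three term
  recurrence of \<open>r\<close> into a first order system for the pair of \<open>r\<close> and
  \<open>hk\<close>.\<close>

definition hk :: "nat \<Rightarrow> 'c \<Rightarrow> 'c" where
  "hk k t = r k t * gc ^ (q ^ k) - (t - \<eta> ^ (q ^ Suc k)) * r (Suc k) t"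

lemma hk_Suc:
  assumes t: "absv t \<le> H ^ q"
  shows "hk (Suc k) t = - (dc ^ (q ^ k)) * r k t"
proof -
  interpret P: carlitz_lattice q \<kappa> "\<lambda>a. \<mu> a ^ (q ^ k)" "\<eta> ^ (q ^ k)"
    by (rule carlitz_lattice_power)
  have gc: "P.gc = gc ^ (q ^ k)"
    by (simp add: P.gc_def gc_def A_power frob_add_k frob_diff_k power_mult_distrib mult.commute
        flip: power_mult)
  have dc: "P.dc = dc ^ (q ^ k)"
    unfolding P.dc_def dc_def gc A_power
    by (simp add: frob_add_k frob_diff_k power_mult_distrib mult.commute flip: power_mult)
  have "((\<eta> ^ (q ^ k)) ^ (q ^ 2) - t) * r (k + 2) t + P.gc ^ q * r (k + 1) t + P.dc * r (k + 0) t = 0"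
  proof (rule P.three_term[of "eval_at t" t "\<lambda>i. r (k + i) t"])
    show "(\<lambda>n. \<Sum>a\<in>deg_less n - {0}. eval_at t a / (\<mu> a ^ (q ^ k)) ^ (q ^ i)) \<longlonglongrightarrow> r (k + i) t" for i
      using has_sum_deg_less_nz[OF has_sum_r[OF t, of "k + i"]] by (simp add: power_add flip: power_mult)
  qed (simp_all add: eval_at_add eval_at_smult eval_at_pCons)
  then show ?thesis
    unfolding gc dc
    by (simp add: hk_def algebra_simps eq_neg_iff_add_eq_0 numeral_2_eq_2 flip: power_mult)
qed

text \<open>For \<eta> = \<theta>, the Carlitz generating function \<omega> has Frobenius twist (t -
  \<theta>) \<omega>; thus \<open>bk t 0 j\<close> is the ratio of its j-th twist to \<omega>, and
  \<open>bk t k j\<close> is the k-fold twist of that ratio.\<close>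

definition bk :: "'c \<Rightarrow> nat \<Rightarrow> nat \<Rightarrow> 'c" where
  "bk t k j = (\<Prod>i<j. t - \<eta> ^ (q ^ (i + k)))"

lemma bk_0 [simp]: "bk t k 0 = 1"
  by (simp add: bk_def)

lemma bk_Suc: "bk t k (Suc j) = bk t k j * (t - \<eta> ^ (q ^ (j + k)))"
  by (simp add: bk_def)

lemma bk_Suc_left: "bk t k (Suc j) = (t - \<eta> ^ (q ^ k)) * bk t (Suc k) j"
  by (simp add: bk_def prod.lessThan_Suc_shift del: prod.lessThan_Suc)

lemma absv_factor_le:
  assumes t: "absv t \<le> H ^ q" and n: "q ^ n \<le> m" "q \<le> m"
  shows "absv (t - \<eta> ^ (q ^ n)) \<le> H ^ m"
proof (rule absv_diff_le)
  have "H ^ q \<le> H ^ m"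
    using n H_gt_1 by (intro power_increasing) auto
  then show "absv t \<le> H ^ m"
    using t by linarith
  show "absv (\<eta> ^ (q ^ n)) \<le> H ^ m"
    unfolding absv_power H_def[symmetric] using n H_gt_1 by (intro power_increasing) auto
qed

text \<open>The last factor is at most H^(q^(j+k+1)), and q \<le> 2 (q - 1) bounds its exponent by 2
  q^k q^j (q - 1); these add up to 2 q^k (q^j - 1). The index \<open>Suc k\<close> is covered too,
  because the boundary terms of \<open>sigma_recurrence\<close> and the iteration in
  \<open>Bk_eq_0\<close> combine it with q^k.\<close>

lemma absv_bk_le:
  assumes t: "absv t \<le> H ^ q" and k': "k' = k \<or> k' = Suc k"
  shows "absv (bk t k' j) \<le> (H ^ 2) ^ (q ^ k * (q ^ j - 1))"
proof (induction j)
  case (Suc j)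
  obtain s where s: "q ^ j = Suc s"
    using q_pos(3)[of j] by (cases "q ^ j") (auto simp del: q_pos)
  have "q ^ (j + k') \<le> q ^ Suc (j + k)" "q ^ 1 \<le> q ^ Suc (j + k)"
    using k' q_ge_2 by (intro power_increasing; auto)+
  then have "absv (t - \<eta> ^ (q ^ (j + k'))) \<le> H ^ (q ^ Suc (j + k))"
    using t by (intro absv_factor_le) auto
  also have "\<dots> \<le> H ^ (2 * (q ^ k * (q ^ j * (q - 1))))"
  proof (intro power_increasing)
    have "q ^ j * q ^ k * q \<le> q ^ j * q ^ k * (2 * (q - 1))"
      using q_ge_2 by (intro mult_left_mono) auto
    then show "q ^ Suc (j + k) \<le> 2 * (q ^ k * (q ^ j * (q - 1)))"
      by (simp add: power_add mult_ac)
  qed (use H_gt_1 in simp)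
  finally have "absv (bk t k' (Suc j)) \<le> (H ^ 2) ^ (q ^ k * (q ^ j - 1)) * (H ^ 2) ^ (q ^ k * (q ^ j * (q - 1)))"
    unfolding bk_Suc absv_mult power_mult[of H 2, symmetric] using Suc H_pos
    by (intro mult_mono) (auto simp: absv_nonneg power_mult)
  also have "\<dots> = (H ^ 2) ^ (q ^ k * (q ^ Suc j - 1))"
  proof -
    have "(q ^ j - 1) + q ^ j * (q - 1) = q ^ Suc j - 1"
      using s q_ge_2 by (cases q) auto
    then show ?thesis
      by (simp only: power_add[symmetric] distrib_left[symmetric])
  qed
  finally show ?case .
qed simp

lemma absv_A_bk_le:
  assumes t: "absv t \<le> H ^ q" and k': "k' = k \<or> k' = Suc k"
  shows "absv (A j ^ (q ^ k) * bk t k' j) \<le> \<rho> ^ (q ^ k * (q ^ j - 1))"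
proof -
  have "absv (A j) ^ (q ^ k) \<le> (U ^ (q ^ j - 1)) ^ (q ^ k)"
    using absv_A_le[of j] by (intro power_mono absv_nonneg) (simp add: U_def)
  then have "absv (A j ^ (q ^ k) * bk t k' j) \<le> (U ^ (q ^ j - 1)) ^ (q ^ k) * (H ^ 2) ^ (q ^ k * (q ^ j - 1))"
    unfolding absv_mult absv_power using absv_bk_le[OF assms] U_pos
    by (intro mult_mono) (auto simp: absv_nonneg)
  also have "\<dots> = \<rho> ^ (q ^ k * (q ^ j - 1))"
    by (simp only: \<rho>_def power_mult_distrib power_mult[symmetric] mult.commute)
  finally show ?thesis .
qed

lemma tendsto_A_bk:
  assumes t: "absv t \<le> H ^ q" and k': "k' = k \<or> k' = Suc k"
  shows "(\<lambda>j. A j ^ (q ^ k) * bk t k' j) \<longlonglongrightarrow> 0"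
proof -
  have "(\<lambda>j. absv (A j ^ (q ^ k) * bk t k' j)) \<longlonglongrightarrow> 0"
  proof (rule tendsto_sandwich[OF _ _ tendsto_const])
    have "\<rho> ^ (q ^ k * (q ^ j - 1)) \<le> \<rho> ^ j" for j
    proof (intro power_decreasing)
      have "1 * (q ^ j - 1) \<le> q ^ k * (q ^ j - 1)"
        using q_pos(4)[of k] by (intro mult_right_mono) auto
      then show "j \<le> q ^ k * (q ^ j - 1)"
        using le_q_power_minus_1[of j] by linarith
    qed (use rho_pos rho_less_1 in auto)
    then show "\<forall>\<^sub>F j in sequentially. absv (A j ^ (q ^ k) * bk t k' j) \<le> \<rho> ^ j"
      using absv_A_bk_le[OF assms] order_trans by (intro always_eventually allI) blast
    show "(\<lambda>j. \<rho> ^ j) \<longlonglongrightarrow> 0"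
      using rho_pos rho_less_1 by (intro LIMSEQ_power_zero) simp
  qed (simp add: absv_nonneg)
  then show ?thesis
    by (simp add: tendsto_absv_iff[of _ 0])
qed

text \<open>
  \<open>\<sigma> t 0\<close> is the quotient of the Anderson generating functions that the Drinfeld module of rank 2
  and the Carlitz module attach to a Carlitz period. Its recurrence is adjoint to that of \<open>r\<close>.
\<close>

definition \<sigma> :: "'c \<Rightarrow> nat \<Rightarrow> 'c" where
  "\<sigma> t k = (\<Sum>j. A j ^ (q ^ k) * bk t k j)"

lemma sums_sigma: "absv t \<le> H ^ q \<Longrightarrow> (\<lambda>j. A j ^ (q ^ k) * bk t k j) sums \<sigma> t k"
  unfolding \<sigma>_def by (intro summable_sums summable_nonarch tendsto_A_bk) auto

lemma sigma_near_1:
  assumes t: "absv t \<le> H ^ q"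
  shows "absv (\<sigma> t k - 1) \<le> \<rho> ^ (q ^ k)"
proof -
  have "(\<lambda>j. A (Suc j) ^ (q ^ k) * bk t k (Suc j)) sums (\<sigma> t k - 1)"
    using sums_shift_nonarch[OF sums_sigma[OF t, of k]] by simp
  then show ?thesis
  proof (rule absv_sums_le)
    fix j
    have "q ^ k * 1 \<le> q ^ k * (q ^ Suc j - 1)"
      using le_q_power_minus_1[of "Suc j"] by (intro mult_left_mono) auto
    then have "\<rho> ^ (q ^ k * (q ^ Suc j - 1)) \<le> \<rho> ^ (q ^ k)"
      using rho_pos rho_less_1 by (intro power_decreasing) auto
    moreover have "absv (A (Suc j) ^ (q ^ k) * bk t k (Suc j)) \<le> \<rho> ^ (q ^ k * (q ^ Suc j - 1))"
      by (rule absv_A_bk_le) (use t in auto)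
    ultimately show "absv (A (Suc j) ^ (q ^ k) * bk t k (Suc j)) \<le> \<rho> ^ (q ^ k)"
      by linarith
  qed
qed

lemma absv_sigma: "absv t \<le> H ^ q \<Longrightarrow> absv (\<sigma> t k) = 1"
proof -
  assume t: "absv t \<le> H ^ q"
  have "\<rho> ^ (q ^ k) < 1"
    using rho_pos rho_less_1 q_pos(3)[of k] by (simp add: power_less_one_iff)
  then have "absv (1 + (\<sigma> t k - 1)) = absv (1::'c)"
    using sigma_near_1[OF t, of k] by (intro absv_add_eq_left) simp
  then show ?thesis by simp
qed

text \<open>Multiply the q^k-th power of \<open>A_recurrence\<close> by
  \<open>bk t (Suc k) (Suc j)\<close> and write the difference of powers of \<eta> as a difference
  of two factors t - \<eta>^(q^i). One extends the product on the left and gives a term of \<sigma>,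
  the other extends it on the right and gives \<open>e (Suc j)\<close>. So the relation holds
  termwise up to a telescoping null sequence.\<close>

lemma sigma_recurrence:
  assumes t: "absv t \<le> H ^ q"
  shows "\<sigma> t k = gc ^ (q ^ k) * \<sigma> t (Suc k) + (t - \<eta> ^ (q ^ Suc k)) * dc ^ (q ^ k) * \<sigma> t (Suc (Suc k))"
proof -
  define T where "T k j = A j ^ (q ^ k) * bk t k j" for k j
  define e where "e j = A (Suc j) ^ (q ^ k) * bk t (Suc k) (Suc j)" for j
  have T: "T k sums \<sigma> t k" for k
    unfolding T_def by (rule sums_sigma[OF t])
  have e0: "e \<longlonglongrightarrow> 0"
    unfolding e_def using LIMSEQ_Suc[OF tendsto_A_bk[OF t, of "Suc k" k]] by simp
  have rel: "T k (Suc (Suc j)) + (e j - e (Suc j))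
      = gc ^ (q ^ k) * T (Suc k) (Suc j) + (t - \<eta> ^ (q ^ Suc k)) * dc ^ (q ^ k) * T (Suc (Suc k)) j" for j
  proof -
    let ?a = "\<lambda>i. A i ^ (q ^ k)" and ?b = "bk t (Suc k) (Suc j)"
    have "((\<eta> ^ (q ^ Suc (Suc j)) - \<eta>) * A (Suc (Suc j)) + A (Suc j)) ^ (q ^ k)
        = (gc * A (Suc j) ^ q + dc * A j ^ (q ^ 2)) ^ (q ^ k)"
      by (simp only: A_recurrence)
    then have "(\<eta> ^ (q ^ (Suc j + Suc k)) - \<eta> ^ (q ^ k)) * ?a (Suc (Suc j)) + ?a (Suc j)
        = gc ^ (q ^ k) * A (Suc j) ^ (q ^ Suc k) + dc ^ (q ^ k) * A j ^ (q ^ Suc (Suc k))"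
      by (simp add: frob_add_k frob_diff_k power_mult_distrib power_add mult_ac numeral_2_eq_2 flip: power_mult)
    then have "((\<eta> ^ (q ^ (Suc j + Suc k)) - \<eta> ^ (q ^ k)) * ?a (Suc (Suc j)) + ?a (Suc j)) * ?b
        = (gc ^ (q ^ k) * A (Suc j) ^ (q ^ Suc k) + dc ^ (q ^ k) * A j ^ (q ^ Suc (Suc k))) * ?b"
      by simp
    moreover have "T k (Suc (Suc j)) = ?a (Suc (Suc j)) * ((t - \<eta> ^ (q ^ k)) * ?b)"
      unfolding T_def bk_Suc_left[of t k "Suc j"] ..
    moreover have "e (Suc j) = ?a (Suc (Suc j)) * (?b * (t - \<eta> ^ (q ^ (Suc j + Suc k))))"
      unfolding e_def bk_Suc[of t "Suc k" "Suc j"] ..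
    moreover have "e j = ?a (Suc j) * ?b" "T (Suc k) (Suc j) = A (Suc j) ^ (q ^ Suc k) * ?b"
      by (simp_all only: e_def T_def)
    moreover have "(t - \<eta> ^ (q ^ Suc k)) * T (Suc (Suc k)) j = A j ^ (q ^ Suc (Suc k)) * ?b"
      unfolding T_def bk_Suc_left[of t "Suc k" j] by (simp only: mult_ac)
    moreover have "a2 * ((t - E1) * b) + (a1 * b - a2 * (b * (t - E2))) = ((E2 - E1) * a2 + a1) * b"
      "(x1 * x2 + y1 * y2) * b = x1 * (x2 * b) + y1 * (y2 * b)" "z1 * z2 * z3 = z2 * (z1 * z3)"
      for a1 a2 b E1 E2 x1 x2 y1 y2 z1 z2 z3 :: 'c
      by (simp_all add: algebra_simps)
    ultimately show ?thesis
      by simp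
  qed
  have "(\<lambda>j. e j - e (Suc j)) sums (e 0 - 0)"
  proof -
    have "(\<lambda>n. e 0 - e n) \<longlonglongrightarrow> e 0 - 0"
      by (intro tendsto_intros e0)
    moreover have "(\<Sum>j<n. e j - e (Suc j)) = e 0 - e n" for n
      by (rule sum_lessThan_telescope')
    ultimately show ?thesis
      by (simp add: sums_def)
  qed
  then have "(\<lambda>j. T k (Suc (Suc j)) + (e j - e (Suc j))) sums ((\<sigma> t k - T k 0) - T k (Suc 0) + (e 0 - 0))"
    by (intro sums_add sums_shift_nonarch[OF sums_shift_nonarch[OF T]])
  moreover have "(\<lambda>j. gc ^ (q ^ k) * T (Suc k) (Suc j) + (t - \<eta> ^ (q ^ Suc k)) * dc ^ (q ^ k) * T (Suc (Suc k)) j)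
      sums (gc ^ (q ^ k) * (\<sigma> t (Suc k) - T (Suc k) 0) + (t - \<eta> ^ (q ^ Suc k)) * dc ^ (q ^ k) * \<sigma> t (Suc (Suc k)))"
    by (intro sums_add sums_cmult_nonarch sums_shift_nonarch T)
  ultimately have "(\<sigma> t k - T k 0) - T k (Suc 0) + (e 0 - 0)
      = gc ^ (q ^ k) * (\<sigma> t (Suc k) - T (Suc k) 0) + (t - \<eta> ^ (q ^ Suc k)) * dc ^ (q ^ k) * \<sigma> t (Suc (Suc k))"
    unfolding rel by (rule sums_unique2)
  moreover have "T k 0 = 1" "T (Suc k) 0 = 1"
    by (simp_all add: T_def)
  \<comment> \<open>The initial terms lost by shifting the series balance precisely because of the
    definition of \<open>gc\<close>.\<close>
  moreover have "T k (Suc 0) = gc ^ (q ^ k) - 1 + e 0"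
    by (simp add: T_def e_def bk_def gc_def frob_add_k frob_diff_k power_mult_distrib algebra_simps
        flip: power_mult)
  ultimately show ?thesis
    by (simp add: algebra_simps)
qed

lemma absv_gc: "absv gc \<le> 1"
proof -
  have "absv ((\<eta> ^ q - \<eta>) * A 1) \<le> H ^ q * U ^ (q - 1)"
    unfolding absv_mult using absv_A_le[of 1] H_pos
    by (intro mult_mono absv_diff_le)
      (auto simp: absv_power absv_nonneg U_def simp flip: H_def intro: self_le_power)
  also have "\<dots> \<le> H ^ (2 * (q - 1)) * U ^ (q - 1)"
    using q_ge_2 H_pos U_pos by (intro mult_right_mono power_increasing) auto
  also have "\<dots> = \<rho> ^ (q - 1)"
    by (simp add: \<rho>_def power_mult power_mult_distrib)
  also have "\<dots> \<le> 1"
    using rho_pos rho_less_1 by (intro power_le_one) auto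
  finally show ?thesis
    unfolding gc_def by (intro absv_add_le) simp_all
qed

text \<open>
  The pairing of the two adjoint recurrences: up to the factor in \<open>Bk_Suc\<close> it does not depend on
  \<open>k\<close>, but it is of order \<open>q\<^sup>k\<close> in \<open>u\<close>, hence it vanishes.
\<close>

definition Bk :: "'c \<Rightarrow> nat \<Rightarrow> 'c" where
  "Bk t k = hk k t * \<sigma> t (Suc k) - r k t * \<sigma> t k"

text \<open>After inserting both recurrences the terms with \<open>gc\<close> cancel; this is the
  sense in which they are adjoint.\<close>

lemma Bk_Suc:
  assumes t: "absv t \<le> H ^ q"
  shows "Bk t k = (t - \<eta> ^ (q ^ Suc k)) * Bk t (Suc k)"
  unfolding Bk_def hk_Suc[OF t] sigma_recurrence[OF t, of k] hk_def[of k]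
  by (simp add: algebra_simps)

lemma absv_Bk_le:
  assumes t: "absv t \<le> H ^ q"
  shows "absv (Bk t k) \<le> U ^ (q ^ k)"
proof -
  have "absv ((t - \<eta> ^ (q ^ Suc k)) * r (Suc k) t) \<le> H ^ (q ^ Suc k) * U ^ (q ^ Suc k)"
    unfolding absv_mult absv_r[OF t] using U_pos t q_pos(4)[of k]
    by (intro mult_right_mono absv_factor_le) auto
  also have "\<dots> \<le> H ^ (2 * (q ^ k * (q - 1))) * U ^ (q ^ Suc k)"
  proof (intro mult_right_mono power_increasing)
    have "q ^ k * q \<le> q ^ k * (2 * (q - 1))"
      using q_ge_2 by (intro mult_left_mono) auto
    then show "q ^ Suc k \<le> 2 * (q ^ k * (q - 1))"
      by (simp add: mult_ac)
  qed (use H_pos U_pos in auto)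
  also have "\<dots> = \<rho> ^ (q ^ k * (q - 1)) * U ^ (q ^ k)"
  proof -
    have "q ^ Suc k = q ^ k * (q - 1) + q ^ k"
      using q_ge_2 by (cases q) auto
    then show ?thesis
      by (simp add: \<rho>_def power_add power_mult_distrib flip: power_mult)
  qed
  also have "\<dots> \<le> 1 * U ^ (q ^ k)"
    using rho_pos rho_less_1 U_pos by (intro mult_right_mono power_le_one) auto
  finally have 1: "absv ((t - \<eta> ^ (q ^ Suc k)) * r (Suc k) t) \<le> U ^ (q ^ k)"
    by simp
  have "absv (r k t * gc ^ (q ^ k)) \<le> U ^ (q ^ k) * 1"
    unfolding absv_mult absv_r[OF t] absv_power
    using absv_gc U_pos by (intro mult_left_mono power_le_one absv_nonneg) auto
  then have "absv (hk k t) \<le> U ^ (q ^ k)"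
    unfolding hk_def using 1 by (intro absv_diff_le) auto
  then show ?thesis
    unfolding Bk_def by (intro absv_diff_le) (simp_all add: absv_mult absv_sigma[OF t] absv_r[OF t])
qed

text \<open>After m steps the accumulated factor is at most (H^2)^s with s = q^k (q^m - 1), while
  the remaining pairing is at most U^s U^(q^k). Their product is bounded by \<rho>^s.\<close>

lemma Bk_eq_0:
  assumes t: "absv t \<le> H ^ q"
  shows "Bk t k = 0"
proof -
  have iter: "Bk t k = bk t (Suc k) m * Bk t (k + m)" for m
  proof (induction m)
    case (Suc m)
    then show ?case
      using Bk_Suc[OF t, of "k + m"] by (simp add: bk_Suc add.commute)
  qed simp
  have "absv (Bk t k) \<le> \<rho> ^ m" for m
  proof -
    define s where "s = q ^ k * (q ^ m - 1)"
    have s: "q ^ (k + m) = s + q ^ k"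
      using q_pos(3)[of m] by (cases "q ^ m") (simp_all add: s_def power_add del: q_pos)
    have "absv (Bk t k) \<le> (H ^ 2) ^ s * U ^ (q ^ (k + m))"
      unfolding iter[of m] absv_mult s_def using absv_bk_le[OF t, of "Suc k" k m] absv_Bk_le[OF t, of "k + m"] H_pos
      by (intro mult_mono) (auto simp: absv_nonneg)
    also have "\<dots> = \<rho> ^ s * U ^ (q ^ k)"
      unfolding s by (simp add: \<rho>_def power_add power_mult_distrib)
    also have "\<dots> \<le> \<rho> ^ s * 1"
      using U_pos U_less_1 rho_pos by (intro mult_left_mono power_le_one) auto
    also have "\<dots> \<le> \<rho> ^ m * 1"
    proof (intro mult_right_mono power_decreasing)
      have "1 * (q ^ m - 1) \<le> s"
        unfolding s_def using q_pos(4)[of k] by (intro mult_right_mono) auto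
      then show "m \<le> s"
        using le_q_power_minus_1[of m] by linarith
    qed (use rho_pos rho_less_1 in auto)
    finally show ?thesis by simp
  qed
  moreover have "(\<lambda>m. \<rho> ^ m) \<longlonglongrightarrow> 0"
    using rho_pos rho_less_1 by (intro LIMSEQ_power_zero) simp
  ultimately have "absv (Bk t k) \<le> 0"
    by (intro tendsto_lowerbound[of _ 0 sequentially]) auto
  then show ?thesis by simp
qed

text \<open>
  \<open>Gk t\<close> solves a first order recurrence that does not involve \<open>t\<close>, and its leading term does
  not depend on \<open>t\<close> either. Comparing \<open>t = \<eta>\<close> with \<open>t = \<eta>\<^sup>q\<close> links \<open>h\<close> to its own \<open>q\<close>-th power.
\<close>

definition Gk :: "'c \<Rightarrow> nat \<Rightarrow> 'c" where
  "Gk t k = r k t / \<sigma> t (Suc k)"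

lemma sigma_nonzero: "absv t \<le> H ^ q \<Longrightarrow> \<sigma> t k \<noteq> 0"
  using absv_sigma[of t k] by auto

lemma hk_eq: "absv t \<le> H ^ q \<Longrightarrow> hk k t = Gk t k * \<sigma> t k"
  using Bk_eq_0[of t k] sigma_nonzero[of t "Suc k"] unfolding Bk_def Gk_def by (simp add: field_simps)

lemma Gk_Suc: "absv t \<le> H ^ q \<Longrightarrow> Gk t (Suc k) = - (dc ^ (q ^ k)) * Gk t k"
  using hk_eq[of t "Suc k"] hk_Suc[of t k] sigma_nonzero[of t "Suc k"] by (simp add: Gk_def field_simps)

lemma absv_Gk: "absv t \<le> H ^ q \<Longrightarrow> absv (Gk t k) = U ^ (q ^ k)"
  by (simp add: Gk_def absv_divide absv_r absv_sigma)

lemma Gk_leading: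
  assumes t: "absv t \<le> H ^ q"
  shows "absv (Gk t k + (1 / bas 0) ^ (q ^ k)) \<le> U ^ (q ^ k) * \<rho> ^ (q ^ k)"
proof -
  let ?v = "(1 / bas 0) ^ (q ^ k)"
  have "\<sigma> t (Suc k) \<noteq> 0"
    using absv_sigma[OF t, of "Suc k"] by auto
  then have "Gk t k + ?v = (r k t + ?v + ?v * (\<sigma> t (Suc k) - 1)) / \<sigma> t (Suc k)"
    by (simp add: Gk_def field_simps)
  also have "absv \<dots> = absv (r k t + ?v + ?v * (\<sigma> t (Suc k) - 1))"
    by (simp add: absv_divide absv_sigma[OF t])
  also have "\<dots> \<le> U ^ (q ^ k) * \<rho> ^ (q ^ k)"
  proof (rule absv_add_le[OF r_leading[OF t]])
    have "absv (\<sigma> t (Suc k) - 1) \<le> \<rho> ^ (q ^ k)"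
      using rho_pos rho_less_1 q_ge_2
      by (intro order_trans[OF sigma_near_1[OF t]] power_decreasing power_increasing) auto
    then show "absv (?v * (\<sigma> t (Suc k) - 1)) \<le> U ^ (q ^ k) * \<rho> ^ (q ^ k)"
      using U_pos by (simp add: absv_mult absv_power absv_divide U_def mult_left_mono)
  qed
  finally show ?thesis .
qed

text \<open>The ratio of \<open>Gk t k\<close> to \<open>Gk t' k\<close> is the same for all k,
  since both obey the same recurrence. It tends to 1, because both differ from -(1 / bas 0)^(q^k) by
  a relative error of at most \<rho>^(q^k).\<close>

lemma Gk_independent:
  assumes t: "absv t \<le> H ^ q" and t': "absv t' \<le> H ^ q"
  shows "Gk t 0 = Gk t' 0"
proof -
  have cross: "Gk t k * Gk t' 0 = Gk t' k * Gk t 0" for k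
    by (induction k) (simp_all add: Gk_Suc[OF t] Gk_Suc[OF t'])
  have le: "absv (Gk t 0 - Gk t' 0) \<le> U * \<rho> ^ k" for k
  proof -
    have "absv (Gk t 0 - Gk t' 0) * U ^ (q ^ k) = absv (Gk t' k * Gk t 0 - Gk t' k * Gk t' 0)"
      by (simp add: absv_Gk[OF t'] absv_mult flip: right_diff_distrib)
    also have "\<dots> = absv ((Gk t k + (1 / bas 0) ^ (q ^ k)) - (Gk t' k + (1 / bas 0) ^ (q ^ k))) * U"
      unfolding cross[symmetric] by (simp add: absv_Gk[OF t'] absv_mult flip: left_diff_distrib)
    also have "\<dots> \<le> (U ^ (q ^ k) * \<rho> ^ (q ^ k)) * U"
      using U_pos by (intro mult_right_mono absv_diff_le Gk_leading t t') simp
    also have "\<dots> = (U * \<rho> ^ (q ^ k)) * U ^ (q ^ k)"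
      by simp
    finally have "absv (Gk t 0 - Gk t' 0) \<le> U * \<rho> ^ (q ^ k)"
      using U_pos by simp
    also have "\<dots> \<le> U * \<rho> ^ k"
      using U_pos rho_pos rho_less_1 le_q_power_minus_1[of k]
      by (intro mult_left_mono power_decreasing) auto
    finally show ?thesis .
  qed
  have "(\<lambda>k. U * \<rho> ^ k) \<longlonglongrightarrow> U * 0"
    using rho_pos rho_less_1 by (intro tendsto_intros LIMSEQ_power_zero) simp
  then have "absv (Gk t 0 - Gk t' 0) \<le> U * 0"
    using le by (intro tendsto_lowerbound[of _ "U * 0" sequentially]) auto
  then show ?thesis by simp
qed

lemma eta_bounds: "absv \<eta> \<le> H ^ q" "absv (\<eta> ^ q) \<le> H ^ q"
  using H_pos self_le_power[of H q] by (simp_all add: absv_power flip: H_def)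

text \<open>At this t the first factor of \<open>bk\<close> is 0, so only the term j = 0
  survives.\<close>

lemma sigma_eq_1: "\<sigma> (\<eta> ^ (q ^ k)) k = 1"
proof -
  have "(\<lambda>j. A j ^ (q ^ k) * bk (\<eta> ^ (q ^ k)) k j) = (\<lambda>j. if j = 0 then 1 else 0)"
  proof
    fix j
    show "A j ^ (q ^ k) * bk (\<eta> ^ (q ^ k)) k j = (if j = 0 then 1 else 0)"
      by (cases j) (simp_all add: bk_Suc_left)
  qed
  then show ?thesis
    unfolding \<sigma>_def using sums_single[of 0 "\<lambda>_. 1::'c"] by (simp add: sums_iff)
qed

text \<open>With \<open>hk 0 \<eta>\<close> in the role of \<open>h\<close> and \<open>dc\<close> in that of \<open>\<Delta>\<close>, this is \<open>\<Delta> = - h\<^sup>q\<^sup>-\<^sup>1\<close>.\<close>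

theorem hk_power: "hk 0 \<eta> ^ (q - 1) = - dc"
proof -
  \<comment> \<open>The two denominators that would spoil the comparison are 1: \<sigma> at t =
    \<eta> with index 0, and \<sigma> at t = \<eta>^q with index 1.\<close>
  have h: "hk 0 \<eta> = r 0 (\<eta> ^ q)"
    using hk_eq[OF eta_bounds(1), of 0] Gk_independent[OF eta_bounds] sigma_eq_1[of 0] sigma_eq_1[of 1]
    by (simp add: Gk_def)
  \<comment> \<open>Frobenius raises both the index and the parameter; \<open>hk_Suc\<close> then
    leads back to \<open>r 0 (\<eta> ^ q)\<close>, which is \<open>hk 0 \<eta>\<close>
    itself.\<close>
  have "hk 0 \<eta> ^ q = hk 1 (\<eta> ^ q)"
    using r_frob[of \<eta> 0] r_frob[of \<eta> 1] H_def
    by (simp add: hk_def frob_diff power_mult_distrib mult.commute flip: power_mult)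
  also have "\<dots> = - dc * hk 0 \<eta>"
    using hk_Suc[OF eta_bounds(2), of 0] h by simp
  finally have "hk 0 \<eta> ^ (q - 1) * hk 0 \<eta> = - dc * hk 0 \<eta>"
    by simp
  moreover have "hk 0 \<eta> \<noteq> 0"
    using absv_r[OF eta_bounds(2), of 0] U_pos unfolding h by auto
  ultimately show ?thesis
    by (metis mult_right_cancel)
qed

end

subsection \<open>Convergence of the lattice exponential\<close>

context additive_lattice
begin

lemma absv_en_le:
  assumes "absv w < absv (bas 0)"
  shows "absv (en n w) \<le> absv w \<and> absv (en n w - w) \<le> absv w * (absv w / absv (bas 0)) ^ (q - 1)"
proof (induction n)
  case (Suc n)
  let ?B = "absv w * (absv w / absv (bas 0)) ^ (q - 1)"
  have b: "absv (bas 0) \<le> absv (en n (bas n))"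
    using absv_bas_mono[of 0 n] absv_en_bas_ge[of n] by simp
  have B: "?B \<le> absv w"
    using assms by (intro mult_right_le_one_le power_le_one) (auto simp: absv_nonneg)
  have "absv (en n w) / absv (en n (bas n)) \<le> absv w / absv (bas 0)"
    using Suc b by (intro frac_le) (auto simp: absv_nonneg)
  then have "absv (en n w) * (absv (en n w) / absv (en n (bas n))) ^ (q - 1) \<le> ?B"
    using Suc by (intro mult_mono power_mono) (auto simp: absv_nonneg)
  moreover have "en (Suc n) w - en n w = - (en n w * (en n w / en n (bas n)) ^ (q - 1))"
    by (simp add: en_Suc power_divide mult.commute)
  ultimately have diff: "absv (en (Suc n) w - en n w) \<le> ?B"
    by (simp add: absv_mult absv_power absv_divide)
  have "absv ((en (Suc n) w - en n w) + (en n w - w)) \<le> ?B"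
    using diff Suc by (intro absv_add_le) auto
  moreover have "absv ((en (Suc n) w - en n w) + en n w) \<le> absv w"
    using diff Suc B by (intro absv_add_le) auto
  ultimately show ?case
    by simp
qed (simp add: absv_nonneg)

text \<open>When |w| avoids the sizes of the basis there is no cancellation: as long as |w| < |bas
  n|, the factor by which \<open>en n w\<close> changes has absolute value 1, and otherwise
  \<open>en_growth\<close> applies.\<close>

lemma absv_en_ge:
  assumes "\<And>m. absv w \<noteq> absv (bas m)"
  shows "absv w \<le> absv (en n w)"
proof (induction n)
  case (Suc n)
  show ?case
  proof (cases "absv w < absv (bas n)")
    case True
    then have "absv (en n w) < absv (en n (bas n))"
      by (intro en_growth(2)[of n "bas n" w] absv_bas_strict_mono) auto
    then have "absv (en n w / en n (bas n)) < 1"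
      by (simp add: absv_divide)
    then have "absv ((en n w / en n (bas n)) ^ (q - 1)) < 1"
      unfolding absv_power using q_ge_2 by (subst power_less_one_iff) (auto simp: absv_nonneg)
    then have "absv (1 - (en n w / en n (bas n)) ^ (q - 1)) = absv (1::'c)"
      by (intro absv_diff_eq_left) simp
    moreover have "en (Suc n) w = en n w * (1 - (en n w / en n (bas n)) ^ (q - 1))"
      by (simp add: en_Suc power_divide right_diff_distrib mult.commute)
    ultimately show ?thesis
      using Suc by (simp add: absv_mult)
  next
    case False
    then have "absv (bas m) < absv w" if "m < Suc n" for m
      using that absv_bas_mono[of m n] assms[of n] by (force simp: less_Suc_eq_le)
    then show ?thesis
      by (rule en_growth(1))
  qed
qed simp

lemma bas_eventually_large: "\<forall>\<^sub>F n in sequentially. K < absv (bas n)"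
  using mu_unbounded[folded bas_def] unfolding filterlim_at_top_dense by blast

text \<open>Once |bas n| exceeds |w|, the values stay bounded by C = |en N w|, and the increments
  are at most C^q / |en n (bas n)|^(q-1).\<close>

lemma convergent_en: "convergent (\<lambda>n. en n w)"
proof (rule convergent_nonarch)
  obtain N where N: "\<And>n. n \<ge> N \<Longrightarrow> absv w < absv (bas n)"
    using bas_eventually_large[of "absv w"] unfolding eventually_sequentially by blast
  define C where "C = absv (en N w)"
  have C: "0 \<le> C"
    by (simp add: C_def absv_nonneg)
  have eq: "en (Suc n) w - en n w = - (en n w * (en n w / en n (bas n)) ^ (q - 1))" for n
    by (simp add: en_Suc power_divide mult.commute)
  have le: "absv (en n w) \<le> C" if "n \<ge> N" for n
    using that
  proof (induction n rule: dec_induct)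
    case (step n)
    have "absv (en n w) < absv (en n (bas n))"
      using N[of n] step by (intro en_growth(2)[of n "bas n" w] absv_bas_strict_mono) auto
    then have "absv (en (Suc n) w - en n w) \<le> absv (en n w)"
      unfolding eq absv_minus absv_mult absv_power absv_divide
      by (intro mult_right_le_one_le power_le_one) (auto simp: absv_nonneg)
    then have "absv ((en (Suc n) w - en n w) + en n w) \<le> C"
      using step by (intro absv_add_le) auto
    then show ?case by simp
  qed (simp add: C_def)
  have "(\<lambda>n. absv (en (Suc n) w - en n w)) \<longlonglongrightarrow> 0"
  proof (rule tendsto_sandwich[OF _ _ tendsto_const])
    have "(\<lambda>n. C * (C * (1 / absv (en n (bas n)))) ^ (q - 1)) \<longlonglongrightarrow> C * (C * 0) ^ (q - 1)"
      by (intro tendsto_intros tendsto_inverse_en_bas)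
    then show "(\<lambda>n. C * (C * (1 / absv (en n (bas n)))) ^ (q - 1)) \<longlonglongrightarrow> 0"
      using q_ge_2 by (simp add: zero_power)
    show "\<forall>\<^sub>F n in sequentially. absv (en (Suc n) w - en n w) \<le> C * (C * (1 / absv (en n (bas n)))) ^ (q - 1)"
      using eventually_ge_at_top[of N]
    proof eventually_elim
      case (elim n)
      have "absv (en (Suc n) w - en n w) = absv (en n w) * (absv (en n w) * (1 / absv (en n (bas n)))) ^ (q - 1)"
        unfolding eq by (simp add: absv_mult absv_power absv_divide)
      also have "\<dots> \<le> C * (C * (1 / absv (en n (bas n)))) ^ (q - 1)"
        using le[OF elim] C by (intro mult_mono power_mono) (auto simp: absv_nonneg)
      finally show ?case .
    qed
  qed (simp add: absv_nonneg)
  then show "(\<lambda>n. en (Suc n) w - en n w) \<longlonglongrightarrow> 0"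
    by (simp add: tendsto_absv_iff[of _ 0])
qed

text \<open>The pointwise limit, not the series with coefficients \<open>A\<close>: in this form the
  sums of inverse powers pass to the limit directly.\<close>

definition en_inf :: "'c \<Rightarrow> 'c" where
  "en_inf w = lim (\<lambda>n. en n w)"

lemma tendsto_en_inf: "(\<lambda>n. en n w) \<longlonglongrightarrow> en_inf w"
  using convergent_en by (simp add: en_inf_def convergent_LIMSEQ_iff)

lemma en_inf_mu [simp]: "en_inf (\<mu> a) = 0"
proof -
  have "\<forall>\<^sub>F n in sequentially. en n (\<mu> a) = 0"
    using eventually_gt_at_top[of "degree a"]
    by eventually_elim (simp add: en_mu_eq_0 deg_less_iff)
  then have "(\<lambda>n. en n (\<mu> a)) \<longlonglongrightarrow> 0"
    by (rule tendsto_eventually)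
  with tendsto_en_inf show ?thesis
    by (rule LIMSEQ_unique)
qed

lemma absv_en_inf_diff_le:
  assumes "absv w < absv (bas 0)"
  shows "absv (en_inf w - w) \<le> absv w * (absv w / absv (bas 0)) ^ (q - 1)"
proof (rule absv_lim_le[OF tendsto_diff[OF tendsto_en_inf tendsto_const]])
  show "\<forall>\<^sub>F n in sequentially. absv (en n w - w) \<le> absv w * (absv w / absv (bas 0)) ^ (q - 1)"
    using absv_en_le[OF assms] by (intro always_eventually allI) blast
qed simp

lemma absv_en_inf_ge:
  assumes "\<And>m. absv w \<noteq> absv (bas m)"
  shows "absv w \<le> absv (en_inf w)"
  by (rule tendsto_lowerbound[OF tendsto_absv[OF tendsto_en_inf]])
    (use absv_en_ge[OF assms] in auto)

lemma en_nonzero: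
  assumes "w \<notin> range \<mu>"
  shows "en n w \<noteq> 0"
proof
  assume w: "en n w = 0"
  let ?P = "tau_poly' (Suc n) (al n)" and ?S = "insert w (\<mu> ` deg_less n)"
  have card: "card ?S = Suc (q ^ n)"
    using assms by (subst card_insert_disjoint) (auto simp: card_mu)
  have "?P = 0"
  proof (rule poly_eqI_degree[of ?S])
    show "poly ?P y = poly 0 y" if "y \<in> ?S" for y
      using that w en_mu_eq_0 by (auto simp flip: en_def)
    show "degree ?P < card ?S" "degree (0 :: 'c poly) < card ?S"
      using degree_tau_poly'[of n "al n"] by (simp_all add: card)
  qed
  then show False
    using coeff_tau_poly'[of "Suc n" "al n" 0] by simp
qed

lemma summable_inverse_powers:
  assumes "1 \<le> j"
  shows "(\<lambda>a. 1 / (w - \<mu> a) ^ j) summable_on S"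
proof (rule summable_on_nonarch)
  fix \<epsilon> :: real assume \<epsilon>: "\<epsilon> > 0"
  obtain N where N: "\<And>n. n \<ge> N \<Longrightarrow> max (absv w) (max 1 (1 / \<epsilon>)) < absv (bas n)"
    using bas_eventually_large unfolding eventually_sequentially by blast
  have "{a\<in>S. \<epsilon> \<le> absv (1 / (w - \<mu> a) ^ j)} \<subseteq> deg_less N"
  proof (rule subsetI, rule ccontr)
    fix a assume a: "a \<in> {a\<in>S. \<epsilon> \<le> absv (1 / (w - \<mu> a) ^ j)}" "a \<notin> deg_less N"
    then have "max (absv w) (max 1 (1 / \<epsilon>)) < absv (\<mu> a)"
      using N[of "degree a"] by (auto simp: deg_less_iff absv_mu)
    then have w: "absv w < absv (\<mu> a)" "1 < absv (\<mu> a)" "1 / \<epsilon> < absv (\<mu> a)"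
      by auto
    have "absv (w - \<mu> a) = absv (\<mu> a)"
      using absv_diff_eq_left[OF w(1)] by (simp add: absv_minus_commute)
    moreover have "absv (\<mu> a) ^ 1 \<le> absv (\<mu> a) ^ j"
      using assms w by (intro power_increasing) auto
    ultimately have T: "1 / \<epsilon> < absv (w - \<mu> a) ^ j"
      using w by simp
    moreover have "0 < 1 / \<epsilon>"
      using \<epsilon> by simp
    ultimately have "0 < absv (w - \<mu> a) ^ j"
      by (rule less_trans[rotated])
    then have "1 / absv (w - \<mu> a) ^ j < \<epsilon>"
      using T \<epsilon> by (simp only: pos_divide_less_eq mult.commute)
    then show False
      using a by (simp add: absv_divide absv_power)
  qed
  then show "finite {a\<in>S. \<epsilon> \<le> absv (1 / (w - \<mu> a) ^ j)}"
    by (rule finite_subset) simp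
qed

text \<open>The value is nonzero because its product with the sum of the 1 / (w - \<mu> a) is a
  limit of products equal to 1.\<close>

lemma en_inf_inverse_sum:
  assumes w: "w \<notin> range \<mu>" and j: "1 \<le> j" "j \<le> q"
  shows "en_inf w \<noteq> 0" "((\<lambda>a. 1 / (w - \<mu> a) ^ j) has_sum (1 / en_inf w) ^ j) UNIV"
proof -
  have lim: "(\<lambda>n. 1 / en n w ^ i) \<longlonglongrightarrow> infsum (\<lambda>a. 1 / (w - \<mu> a) ^ i) UNIV" if "1 \<le> i" "i \<le> q" for i
  proof -
    have "(\<Sum>a\<in>deg_less n. 1 / (w - \<mu> a) ^ i) = 1 / en n w ^ i" for n
      using w that by (intro sum_inverse_powers) auto
    then show ?thesis
      using has_sum_deg_less[OF has_sum_infsum[OF summable_inverse_powers[OF that(1), of w UNIV]]] by simp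
  qed
  have "(\<lambda>n. en n w * (1 / en n w ^ 1)) \<longlonglongrightarrow> en_inf w * infsum (\<lambda>a. 1 / (w - \<mu> a) ^ 1) UNIV"
    using q_ge_2 by (intro tendsto_mult tendsto_en_inf lim) auto
  then have "en_inf w * infsum (\<lambda>a. 1 / (w - \<mu> a) ^ 1) UNIV = 1"
    using en_nonzero[OF w] by (simp add: LIMSEQ_const_iff)
  then show nz: "en_inf w \<noteq> 0"
    by auto
  have "(\<lambda>n. 1 / en n w ^ j) \<longlonglongrightarrow> 1 / en_inf w ^ j"
    by (intro tendsto_divide_nonarch tendsto_intros tendsto_en_inf) (use nz in simp)
  then have "infsum (\<lambda>a. 1 / (w - \<mu> a) ^ j) UNIV = (1 / en_inf w) ^ j"
    using LIMSEQ_unique[OF lim[OF j]] by (simp add: power_one_over)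
  then show "((\<lambda>a. 1 / (w - \<mu> a) ^ j) has_sum (1 / en_inf w) ^ j) UNIV"
    using has_sum_infsum[OF summable_inverse_powers[OF j(1), of w UNIV]] by simp
qed

lemma has_sum_A_1: "((\<lambda>a. 1 / \<mu> a ^ (q - 1)) has_sum A 1) (UNIV - {0})"
proof -
  \<comment> \<open>Summability is known for the powers of 0 - \<mu> a; the resulting sign is
    removed by multiplying with it once more, whatever the parity of q.\<close>
  have "(- 1 :: 'c) ^ (q - 1) * (- 1) ^ (q - 1) = 1"
    by (simp flip: power_mult_distrib)
  then have eq: "(- 1) ^ (q - 1) * (1 / (0 - \<mu> a) ^ (q - 1)) = 1 / \<mu> a ^ (q - 1)" for a
    using power_minus[of "\<mu> a" "q - 1"] by (auto simp: divide_simps)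
  have "((\<lambda>a. 1 / (0 - \<mu> a) ^ (q - 1)) summable_on (UNIV - {0}))"
    using q_ge_2 by (intro summable_inverse_powers) auto
  from has_sum_cmult_nonarch[OF has_sum_infsum[OF this], of "(- 1) ^ (q - 1)"]
  have sm: "(\<lambda>a. 1 / \<mu> a ^ (q - 1)) summable_on (UNIV - {0})"
    unfolding eq summable_on_def by blast
  have "(\<lambda>n. al n 1) \<longlonglongrightarrow> infsum (\<lambda>a. 1 / \<mu> a ^ (q - 1)) (UNIV - {0})"
    using has_sum_deg_less_nz[OF has_sum_infsum[OF sm]] unfolding al_1 .
  then show ?thesis
    using has_sum_infsum[OF sm] LIMSEQ_unique[OF tendsto_A[of 1]] by simp
qed

text \<open>The rank one counterpart of \<open>A_recurrence\<close>: since t maps each sublattice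
  into the next, \<open>en (Suc n)\<close> after scaling by t is divisible by \<open>en n\<close>,
  and a quotient of degree 1 in \<tau> remains.\<close>

lemma en_inf_functional:
  assumes "\<And>a. \<mu> (pCons 0 a) = t * \<mu> a"
  shows "en_inf (t * w) = t * en_inf w + (t ^ q - t) * A 1 * en_inf w ^ q"
proof -
  have fin: "en (Suc n) (t * w) = t * en n w + (t ^ q * al (Suc n) 1 - t * al n 1) * en n w ^ q" for n
  proof -
    have scale: "tau_poly m (\<lambda>j. al (Suc n) j * t ^ (q ^ j)) y = tau_poly m (al (Suc n)) (t * y)" for m y
      by (simp add: tau_poly_def power_mult_distrib mult.assoc)
    have "\<exists>f. \<forall>j. al (Suc n) j * t ^ (q ^ j) = (\<Sum>i<2. if i \<le> j then f i * al n (j - i) ^ (q ^ i) else 0)"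
    proof (rule right_division)
      show "tau_poly (n + 2) (\<lambda>j. al (Suc n) j * t ^ (q ^ j)) (\<mu> a) = 0" if "a \<in> deg_less n" for a
      proof -
        have "pCons 0 a \<in> deg_less (Suc n)"
          using that by (auto simp: deg_less_def coeff_pCons split: nat.splits)
        from en_mu_eq_0[OF this] show ?thesis
          unfolding scale by (simp add: assms en_def)
      qed
    qed (simp add: al_eq_0)
    then obtain f where f: "\<And>j. al (Suc n) j * t ^ (q ^ j) = (\<Sum>i<2. if i \<le> j then f i * al n (j - i) ^ (q ^ i) else 0)"
      by blast
    have f': "al (Suc n) j * t ^ (q ^ j) = f 0 * al n j + (if 1 \<le> j then f 1 * al n (j - 1) ^ (q ^ 1) else 0)" for j
      using f[of j] by (simp add: numeral_2_eq_2)
    have f0: "f 0 = t"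
      using f'[of 0] by simp
    have f1: "f 1 = t ^ q * al (Suc n) 1 - t * al n 1"
      using f'[of 1] by (simp add: f0 mult.commute)
    have "en (Suc n) (t * w) = tau_poly (Suc n + 1) (\<lambda>j. f 0 * al n j + (if 1 \<le> j then f 1 * al n (j - 1) ^ (q ^ 1) else 0)) w"
      unfolding f'[symmetric] scale by (simp add: en_def)
    also have "\<dots> = f 0 * en n w + f 1 * en n w ^ q"
      unfolding tau_poly_add_coeff tau_poly_cmult_coeff tau_poly_shift
      by (simp add: en_conv_tau_poly)
    finally show ?thesis
      unfolding f0 f1 .
  qed
  have "(\<lambda>n. en (Suc n) (t * w)) \<longlonglongrightarrow> t * en_inf w + (t ^ q * A 1 - t * A 1) * en_inf w ^ q"
    unfolding fin by (intro tendsto_intros tendsto_en_inf tendsto_A LIMSEQ_Suc[OF tendsto_A])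
  then show ?thesis
    using LIMSEQ_unique[OF LIMSEQ_Suc[OF tendsto_en_inf]] by (simp add: left_diff_distrib)
qed

end

subsection \<open>The Carlitz exponential\<close>

lemma finite_field_fermat:
  fixes a :: "'f::{field,finite}"
  shows "a ^ CARD('f) = a"
proof (cases "a = 0")
  case True
  then show ?thesis
    using finite_UNIV_card_ge_0[where ?'a = 'f] by (simp add: power_0_left)
next
  case False
  have "bij_betw ((*) a) (UNIV - {0}) (UNIV - {0})"
    using False by (intro bij_betwI[of _ _ _ "\<lambda>b. b / a"]) auto
  then have "(\<Prod>b\<in>UNIV - {0}. a * b) = \<Prod>(UNIV - {0})"
    by (rule prod.reindex_bij_betw)
  then have "a ^ (CARD('f) - 1) * \<Prod>(UNIV - {0}) = \<Prod>(UNIV - {0::'f})"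
    by (simp add: prod.distrib)
  moreover have "\<Prod>(UNIV - {0::'f}) \<noteq> 0"
    by simp
  ultimately have "a ^ (CARD('f) - 1) = 1"
    by simp
  then show ?thesis
    using finite_UNIV_card_ge_0[where ?'a = 'f] power_minus_mult[of "CARD('f)" a] by simp
qed

context carlitz_setting
begin

lemma of_Kinf_add: "of_Kinf (a + b) = of_Kinf a + of_Kinf b"
  by (simp add: of_Kinf_def iota_add)

lemma of_Kinf_mult: "of_Kinf (a * b) = of_Kinf a * of_Kinf b"
  by (simp add: of_Kinf_def iota_mult)

lemma of_Kinf_1: "of_Kinf 1 = 1"
  by (simp add: of_Kinf_def iota_1)

lemma of_Kinf_0 [simp]: "of_Kinf 0 = 0"
  using of_Kinf_add[of 0 0] by (metis add_0 add_cancel_right_right)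

lemma absv_of_Kinf: "absv (of_Kinf f) = abs_infty f"
  by (simp add: of_Kinf_def absv_iota)

lemma q_ge_2': "2 \<le> q"
proof -
  have "p ^ 1 \<le> q"
    unfolding q_eq using e_ge_1 prime_gt_0_nat[OF prime_p] by (intro power_increasing) auto
  then show ?thesis
    using prime_ge_2_nat[OF prime_p] by simp
qed

lemma char_f: "CHAR('f) = p"
proof -
  have "CHAR('f) dvd p ^ e"
    using CHAR_dvd_CARD[where 'a = 'f] by (simp add: card_f q_eq)
  moreover have "Factorial_Ring.prime CHAR('f)"
    by (rule prime_CHAR_semidom) (simp add: finite_imp_CHAR_pos)
  ultimately show ?thesis
    using prime_p prime_dvd_power primes_dvd_imp_eq by blast
qed

lemma char_c: "CHAR('c) = p"
proof -
  have "of_Kinf (of_nat n) = of_nat n" for n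
    by (induction n) (simp_all add: of_Kinf_add of_Kinf_1)
  moreover have "(of_nat p :: 'f fls) = 0"
    using of_nat_CHAR[where 'a = 'f] by (simp add: char_f fls_of_nat)
  ultimately have "(of_nat p :: 'c) = 0"
    by (metis of_Kinf_0)
  then have "CHAR('c) dvd p"
    by (simp add: of_nat_eq_0_iff_char_dvd)
  then show ?thesis
    using prime_p by (metis CHAR_not_1' One_nat_def prime_nat_iff)
qed

sublocale frobenius_setting q "\<lambda>c. of_Kinf (fls_const c)"
proof
  show "2 \<le> q"
    by (rule q_ge_2')
  show "CARD('f) = q"
    by (rule card_f)
  show "(of_nat q :: 'c) = 0"
    unfolding of_nat_eq_0_iff_char_dvd char_c q_eq using e_ge_1 by simp
  show "(a + b) ^ q = a ^ q + (b :: 'c) ^ q" for a b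
    by (rule freshmans_dream') (simp_all add: char_c prime_p q_eq)
  show "of_Kinf (fls_const 1) = 1"
    by (simp add: of_Kinf_1)
  show "of_Kinf (fls_const (a + b)) = of_Kinf (fls_const a) + of_Kinf (fls_const b)" for a b
    by (metis of_Kinf_add fls_plus_const)
  show "of_Kinf (fls_const (a * b)) = of_Kinf (fls_const a) * of_Kinf (fls_const b)" for a b
    by (simp add: of_Kinf_mult flip: fls_const_mult_const)
  have "of_Kinf (a ^ n) = of_Kinf a ^ n" for a n
    by (induction n) (simp_all add: of_Kinf_1 of_Kinf_mult)
  then show "of_Kinf (fls_const a) ^ q = of_Kinf (fls_const a)" for a
    using finite_field_fermat[of a] by (metis card_f fls_const_power)
qed

abbreviation "\<kappa> c \<equiv> of_Kinf (fls_const c)"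

lemma absv_theta: "absv \<theta> = real q"
  by (simp add: \<theta>_def absv_of_Kinf abs_infty_def card_f)

lemma theta_nonzero [simp]: "\<theta> \<noteq> 0"
  using absv_theta q_ge_2 by auto

lemma of_A_conv: "of_A a = eval_at \<theta> a"
  by (simp add: of_A_def eval_at_def)

lemma of_A_pCons: "of_A (pCons c a) = \<kappa> c + \<theta> * of_A a"
  by (simp add: of_A_conv eval_at_pCons)

lemma of_A_0 [simp]: "of_A 0 = 0" and of_A_1 [simp]: "of_A 1 = 1"
  by (simp_all add: of_A_conv one_pCons eval_at_pCons of_Kinf_1)

lemma of_A_add: "of_A (a + b) = of_A a + of_A b"
  by (simp add: of_A_conv eval_at_add)

lemma of_A_smult: "of_A (smult c a) = \<kappa> c * of_A a"
  by (simp add: of_A_conv eval_at_smult)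

lemma of_A_mult: "of_A (a * b) = of_A a * of_A b"
  by (induction a) (simp_all add: of_A_pCons of_A_add of_A_smult algebra_simps)

lemma absv_of_A: "a \<noteq> 0 \<Longrightarrow> absv (of_A a) = real q ^ degree a"
proof (induction a)
  case (pCons c a)
  show ?case
  proof (cases "a = 0")
    case True
    then show ?thesis
      using pCons by (auto simp: of_A_pCons absv_kappa)
  next
    case False
    have "1 < real q ^ Suc (degree a)"
      using q_ge_2 by (intro one_less_power) auto
    then have "absv (\<kappa> c) < absv (\<theta> * of_A a)"
      using pCons.IH False absv_kappa_le[of c] by (simp add: absv_mult absv_theta)
    then show ?thesis
      using pCons.IH False by (simp add: of_A_pCons absv_add_eq_right absv_mult absv_theta)
  qed
qed simp

lemma absv_of_A_ge_1: "a \<noteq> 0 \<Longrightarrow> 1 \<le> absv (of_A a)"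
  using q_ge_2 by (simp add: absv_of_A one_le_power)

lemma of_A_eq_0_iff [simp]: "of_A a = 0 \<longleftrightarrow> a = 0"
  using absv_of_A_ge_1[of a] by (cases "a = 0") auto

lemma of_A_in_Kinf: "of_A a \<in> range of_Kinf"
proof (induction a)
  case (pCons c a)
  then obtain f where "of_A a = of_Kinf f"
    by blast
  then have "of_A (pCons c a) = of_Kinf (fls_const c + fls_X_inv * f)"
    by (simp add: of_A_pCons of_Kinf_add of_Kinf_mult \<theta>_def)
  then show ?case
    by blast
qed (metis of_A_0 of_Kinf_0 rangeI)

lemma absv_theta_power: "absv (\<theta> ^ n) = real q ^ n"
  by (simp add: absv_power absv_theta)

lemma absv_theta_diff: "j < i \<Longrightarrow> absv (\<theta> ^ (q ^ i) - \<theta> ^ (q ^ j)) = real q ^ (q ^ i)"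
proof -
  assume "j < i"
  then have "q ^ j < q ^ i"
    using q_ge_2 by (intro power_strict_increasing) auto
  then have "real q ^ (q ^ j) < real q ^ (q ^ i)"
    using q_ge_2 by (intro power_strict_increasing) auto
  then show ?thesis
    using absv_diff_eq_left[of "\<theta> ^ (q ^ j)" "\<theta> ^ (q ^ i)"] by (simp add: absv_theta_power)
qed

lemma absv_d: "absv (d i) = (real q ^ i) ^ (q ^ i)"
proof -
  have "absv (d i) = (\<Prod>j<i. real q ^ (q ^ i))"
    unfolding d_def absv_prod by (intro prod.cong refl) (simp add: absv_theta_diff)
  then show ?thesis
    by (simp add: mult.commute flip: power_mult)
qed

lemma d_nonzero [simp]: "d i \<noteq> 0"
  using absv_d[of i] q_ge_2 by auto

lemma d_0 [simp]: "d 0 = 1"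
  by (simp add: d_def)

lemma d_Suc: "d (Suc i) = (\<theta> ^ (q ^ Suc i) - \<theta>) * d i ^ q"
proof -
  have "d i ^ q = (\<Prod>j<i. \<theta> ^ (q ^ Suc i) - \<theta> ^ (q ^ Suc j))"
    by (simp add: d_def prod_power_distrib frob_diff mult.commute flip: power_mult)
  then show ?thesis
    by (simp add: d_def prod.lessThan_Suc_shift del: prod.lessThan_Suc)
qed

lemma absv_exp_term: "absv (z ^ (q ^ i) / d i) = (absv z / real q ^ i) ^ (q ^ i)"
  by (simp add: absv_divide absv_power absv_d power_divide)

lemma exp_term_tendsto_0: "(\<lambda>i. (B / real q ^ i) ^ (q ^ i)) \<longlonglongrightarrow> 0" if "0 \<le> B"
proof (rule tendsto_sandwich[OF _ _ tendsto_const])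
  have "(\<lambda>i. B * (1 / real q) ^ i) \<longlonglongrightarrow> B * 0"
    using q_ge_2 by (intro tendsto_intros LIMSEQ_power_zero) auto
  then have "\<forall>\<^sub>F i in sequentially. B * (1 / real q) ^ i < 1 / 2"
    by (intro order_tendstoD(2)[where y = "B * 0"]) auto
  then show "\<forall>\<^sub>F i in sequentially. (B / real q ^ i) ^ (q ^ i) \<le> (1 / 2) ^ i"
  proof eventually_elim
    case (elim i)
    then have "(B / real q ^ i) ^ (q ^ i) \<le> (1 / 2) ^ (q ^ i)"
      using that by (intro power_mono) (auto simp: power_one_over)
    also have "\<dots> \<le> (1 / 2) ^ i"
      using le_q_power_minus_1[of i] by (intro power_decreasing) auto
    finally show ?case .
  qed
  show "(\<lambda>i. (1 / 2 :: real) ^ i) \<longlonglongrightarrow> 0"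
    by (intro LIMSEQ_power_zero) simp
qed (use that in auto)

lemma sums_carlitz_exp: "(\<lambda>i. z ^ (q ^ i) / d i) sums carlitz_exp z"
  unfolding carlitz_exp_def
proof (intro summable_sums summable_nonarch)
  have "(\<lambda>i. absv (z ^ (q ^ i) / d i)) \<longlonglongrightarrow> 0"
    unfolding absv_exp_term by (rule exp_term_tendsto_0[OF absv_nonneg])
  then show "(\<lambda>i. z ^ (q ^ i) / d i) \<longlonglongrightarrow> 0"
    by (simp add: tendsto_absv_iff[of _ 0])
qed

lemma carlitz_exp_add: "carlitz_exp (w + z) = carlitz_exp w + carlitz_exp z"
proof (rule sums_unique2[OF sums_carlitz_exp])
  show "(\<lambda>i. (w + z) ^ (q ^ i) / d i) sums (carlitz_exp w + carlitz_exp z)"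
    using sums_add[OF sums_carlitz_exp[of w] sums_carlitz_exp[of z]]
    by (simp add: frob_add_k add_divide_distrib)
qed

lemma carlitz_exp_kappa: "carlitz_exp (\<kappa> c * z) = \<kappa> c * carlitz_exp z"
proof (rule sums_unique2[OF sums_carlitz_exp])
  show "(\<lambda>i. (\<kappa> c * z) ^ (q ^ i) / d i) sums (\<kappa> c * carlitz_exp z)"
    using sums_cmult_nonarch[OF sums_carlitz_exp[of z], of "\<kappa> c"]
    by (simp add: power_mult_distrib kappa_power_qk)
qed

lemma carlitz_exp_0 [simp]: "carlitz_exp 0 = 0"
  using carlitz_exp_add[of 0 0] by (metis add_0 add_cancel_right_right)

text \<open>Termwise this is \<open>d_Suc\<close>: the factor \<theta>^(q^(i+1)) - \<theta> cancels
  and leaves the q-th power of the preceding term.\<close>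

lemma carlitz_exp_theta: "carlitz_exp (\<theta> * z) = \<theta> * carlitz_exp z + carlitz_exp z ^ q"
proof -
  have frob: "(\<lambda>i. (z ^ (q ^ i) / d i) ^ q) sums carlitz_exp z ^ q"
  proof -
    have "(\<lambda>n. (\<Sum>i<n. z ^ (q ^ i) / d i) ^ (q ^ 1)) \<longlonglongrightarrow> carlitz_exp z ^ (q ^ 1)"
      using sums_carlitz_exp[of z] unfolding sums_def by (intro tendsto_intros)
    then show ?thesis
      unfolding frob_sum_k sums_def by simp
  qed
  have "(\<lambda>i. (\<theta> * z) ^ (q ^ i) / d i - \<theta> * (z ^ (q ^ i) / d i)) sums (carlitz_exp (\<theta> * z) - \<theta> * carlitz_exp z)"
    by (intro sums_diff_nonarch sums_cmult_nonarch sums_carlitz_exp)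
  from sums_shift_nonarch[OF this]
  have "(\<lambda>i. (\<theta> * z) ^ (q ^ Suc i) / d (Suc i) - \<theta> * (z ^ (q ^ Suc i) / d (Suc i)))
      sums (carlitz_exp (\<theta> * z) - \<theta> * carlitz_exp z)"
    by simp
  moreover have "(\<theta> * z) ^ (q ^ Suc i) / d (Suc i) - \<theta> * (z ^ (q ^ Suc i) / d (Suc i)) = (z ^ (q ^ i) / d i) ^ q" for i
  proof -
    have nz: "\<theta> ^ (q ^ Suc i) - \<theta> \<noteq> 0"
      using d_nonzero[of "Suc i"] unfolding d_Suc by (metis mult_eq_0_iff)
    have "(\<theta> * z) ^ (q ^ Suc i) / d (Suc i) - \<theta> * (z ^ (q ^ Suc i) / d (Suc i))
        = (\<theta> ^ (q ^ Suc i) - \<theta>) * z ^ (q ^ Suc i) / ((\<theta> ^ (q ^ Suc i) - \<theta>) * d i ^ q)"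
      by (simp only: d_Suc power_mult_distrib left_diff_distrib diff_divide_distrib times_divide_eq_right)
    also have "\<dots> = z ^ (q ^ Suc i) / d i ^ q"
      using nz by (rule mult_divide_mult_cancel_left)
    finally show ?thesis
      by (simp add: power_divide mult.commute flip: power_mult)
  qed
  ultimately have "carlitz_exp (\<theta> * z) - \<theta> * carlitz_exp z = carlitz_exp z ^ q"
    using frob sums_unique2 by simp
  then show ?thesis
    by (simp add: algebra_simps)
qed

lemma absv_div_q_power: "absv z / real q ^ m \<le> absv z"
proof -
  have "1 \<le> real q ^ m"
    using q_ge_2 by (intro one_le_power) auto
  then show ?thesis
    using absv_nonneg[of z] by (simp add: divide_le_eq mult_le_cancel_left1)
qed

lemma absv_carlitz_exp_diff_le:
  assumes "absv z \<le> 1"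
  shows "absv (carlitz_exp z - z) \<le> absv z ^ q"
proof -
  have "(\<lambda>i. z ^ (q ^ Suc i) / d (Suc i)) sums (carlitz_exp z - z)"
    using sums_shift_nonarch[OF sums_carlitz_exp[of z]] by simp
  then show ?thesis
  proof (rule absv_sums_le)
    fix i
    have "absv z / real q ^ Suc i \<le> absv z"
      by (rule absv_div_q_power)
    then have "absv (z ^ (q ^ Suc i) / d (Suc i)) \<le> absv z ^ (q ^ Suc i)"
      unfolding absv_exp_term by (intro power_mono) (auto simp: absv_nonneg)
    also have "\<dots> \<le> absv z ^ q"
      using assms by (intro power_decreasing) (auto simp: absv_nonneg)
    finally show "absv (z ^ (q ^ Suc i) / d (Suc i)) \<le> absv z ^ q" .
  qed
qed

text \<open>Guarantees that points with small u satisfy the second condition of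
  \<open>good_point\<close>.\<close>

lemma carlitz_exp_bounded:
  assumes "0 \<le> B"
  shows "\<exists>C>0. \<forall>z. absv z \<le> B \<longrightarrow> absv (carlitz_exp z) \<le> C"
proof -
  obtain C where C: "C > 0" "\<And>i. norm ((B / real q ^ i) ^ (q ^ i)) \<le> C"
    using convergent_imp_Bseq[OF convergentI[OF exp_term_tendsto_0[OF assms]]] unfolding Bseq_def by blast
  have "absv (carlitz_exp z) \<le> C" if "absv z \<le> B" for z
  proof (rule absv_sums_le[OF sums_carlitz_exp])
    fix i
    have "(absv z / real q ^ i) ^ (q ^ i) \<le> (B / real q ^ i) ^ (q ^ i)"
      using that by (intro power_mono divide_right_mono) (auto simp: absv_nonneg)
    also have "\<dots> \<le> C"
      using C(2)[of i] by (metis abs_le_D1 real_norm_def)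
    finally show "absv (z ^ (q ^ i) / d i) \<le> C"
      unfolding absv_exp_term .
  qed
  then show ?thesis
    using C by blast
qed

end

section \<open>The period lattice and its exponential\<close>

context drinfeld_setting
begin

definition \<Lambda> :: "'f poly \<Rightarrow> 'c" where
  "\<Lambda> a = \<pi> * of_A a"

lemma carlitz_exp_eq_0_iff: "carlitz_exp z = 0 \<longleftrightarrow> z \<in> range \<Lambda>"
  using kernel_carlitz_exp unfolding \<Lambda>_def by blast

lemma of_A_in_deg_less: "a \<in> deg_less n \<Longrightarrow> absv (of_A a) < real q ^ n"
  using q_ge_2 by (cases "a = 0") (auto simp: deg_less_iff absv_of_A intro: power_strict_increasing)

sublocale pl: additive_lattice q "\<lambda>c. of_Kinf (fls_const c)" \<Lambda>
proof
  show "\<Lambda> (a + b) = \<Lambda> a + \<Lambda> b" for a b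
    by (simp add: \<Lambda>_def of_A_add algebra_simps)
  show "\<Lambda> (smult c a) = \<kappa> c * \<Lambda> a" for c a
    by (simp add: \<Lambda>_def of_A_smult)
  have m: "absv (of_A (monom 1 n)) = real q ^ n" for n
    using absv_of_A[of "monom 1 n"] by (simp add: degree_monom_eq)
  show "absv (\<Lambda> a) < absv (\<Lambda> (monom 1 n))" if "a \<in> deg_less n" for a n
    using of_A_in_deg_less[OF that] pi_nonzero by (simp add: \<Lambda>_def absv_mult m)
  have "filterlim (\<lambda>n. absv \<pi> * real q ^ n) at_top sequentially"
  proof (rule filterlim_tendsto_pos_mult_at_top[OF tendsto_const])
    have "n \<le> q ^ n" for n
      using le_q_power_minus_1[of n] by linarith
    then have "real n \<le> real q ^ n" for n
      by (metis of_nat_le_iff of_nat_power)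
    then show "filterlim (\<lambda>n. real q ^ n) at_top sequentially"
      by (intro filterlim_at_top_mono[OF filterlim_real_sequentially]) auto
  qed (simp add: pi_nonzero)
  then show "filterlim (\<lambda>n. absv (\<Lambda> (monom 1 n))) at_top sequentially"
    by (simp add: \<Lambda>_def absv_mult m)
qed

lemma pl_bas_0: "pl.bas 0 = \<pi>"
  by (simp add: pl.bas_def \<Lambda>_def monom_0 flip: one_pCons)

lemma Lambda_pCons: "\<Lambda> (pCons 0 a) = \<theta> * \<Lambda> a"
  by (simp add: \<Lambda>_def of_A_pCons)

end

context drinfeld_setting
begin

lemma pi_over_theta_notin: "\<pi> / \<theta> \<notin> range \<Lambda>"
proof
  assume "\<pi> / \<theta> \<in> range \<Lambda>"
  then obtain a where "\<pi> / \<theta> = \<pi> * of_A a"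
    by (auto simp: \<Lambda>_def)
  then have a: "of_A a = 1 / \<theta>"
    using pi_nonzero by (simp add: field_simps)
  then have "a \<noteq> 0"
    by auto
  then have "1 \<le> absv (1 / \<theta>)"
    using absv_of_A_ge_1[of a] a by simp
  then show False
    using q_ge_2 by (simp add: absv_divide absv_theta)
qed

lemma carlitz_exp_pi: "carlitz_exp (\<pi> * of_A a) = 0"
  unfolding carlitz_exp_eq_0_iff \<Lambda>_def by blast

text \<open>
  Both \<open>pl.en_inf\<close> and the Carlitz exponential satisfy a rank one functional equation, with
  constants \<open>c\<close> and 1. Comparing them at the torsion point \<open>\<pi> / \<theta>\<close> yields a \<open>(q - 1)\<close>-th root
  \<open>\<gamma>\<close> of \<open>c\<close>, so the two functions agree up to scaling by \<open>\<gamma>\<close>; since both have kernel \<open>\<pi> A\<close>,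
  \<open>\<gamma>\<close> is a unit of \<open>A\<close>.
\<close>

lemma en_inf_scaled:
  obtains \<gamma> where "\<gamma> \<noteq> 0" "(\<theta> ^ q - \<theta>) * pl.A 1 = \<gamma> ^ (q - 1)"
    "\<And>w. pl.en_inf w = carlitz_exp (\<gamma> * w) / \<gamma>"
proof -
  define c where "c = (\<theta> ^ q - \<theta>) * pl.A 1"
  have feq: "pl.en_inf (\<theta> * w) = \<theta> * pl.en_inf w + c * pl.en_inf w ^ q" for w
    unfolding c_def by (rule pl.en_inf_functional) (rule Lambda_pCons)
  define y where "y = pl.en_inf (\<pi> / \<theta>)"
  define y' where "y' = carlitz_exp (\<pi> / \<theta>)"
  have y: "y \<noteq> 0"
    unfolding y_def using q_ge_2 by (intro pl.en_inf_inverse_sum(1)[OF pi_over_theta_notin, of 1]) auto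
  have y': "y' \<noteq> 0"
    unfolding y'_def carlitz_exp_eq_0_iff by (rule pi_over_theta_notin)
  have "\<pi> = \<Lambda> 1"
    by (simp add: \<Lambda>_def)
  then have "\<theta> * y + c * y ^ q = 0" "\<theta> * y' + y' ^ q = 0"
    using feq[of "\<pi> / \<theta>"] carlitz_exp_theta[of "\<pi> / \<theta>"] carlitz_exp_pi[of 1] pl.en_inf_mu[of 1]
    by (simp_all add: y_def y'_def)
  then have "y * (\<theta> + c * y ^ (q - 1)) = 0" "y' * (\<theta> + y' ^ (q - 1)) = 0"
    by (simp_all add: distrib_left mult.left_commute mult.commute[of _ \<theta>])
  then have cy: "c * y ^ (q - 1) = - \<theta>" "y' ^ (q - 1) = - \<theta>"
    using y y' by (simp_all add: eq_neg_iff_add_eq_0 add.commute)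
  define \<gamma> where "\<gamma> = y' / y"
  have \<gamma>: "\<gamma> \<noteq> 0" "c = \<gamma> ^ (q - 1)"
    using y y' cy by (simp_all add: \<gamma>_def power_divide field_simps)
  define D where "D w = pl.en_inf w - carlitz_exp (\<gamma> * w) / \<gamma>" for w
  have D_theta: "D (\<theta> * w) = \<theta> * D w + c * D w ^ q" for w
  proof -
    let ?e = "carlitz_exp (\<gamma> * w)"
    have "carlitz_exp (\<gamma> * (\<theta> * w)) / \<gamma> = \<theta> * (?e / \<gamma>) + ?e ^ q / \<gamma>"
      using carlitz_exp_theta[of "\<gamma> * w"] by (simp add: mult.left_commute add_divide_distrib)
    moreover have "c * (?e / \<gamma>) ^ q = ?e ^ q / \<gamma>"
    proof -
      have "\<gamma> ^ q = \<gamma> ^ (q - 1) * \<gamma>"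
        by simp
      then show ?thesis
        using \<gamma> by (simp add: power_divide del: power_q_minus_Suc_0)
    qed
    ultimately show ?thesis
      unfolding D_def frob_diff feq right_diff_distrib by simp
  qed
  define B where "B = max (1 / absv \<pi> ^ (q - 1)) (absv \<gamma> ^ (q - 1))"
  have B: "0 < B"
    using \<gamma> by (simp add: B_def less_max_iff_disj)
  \<comment> \<open>The entries ensure, in this order: |w|^q \<le> |w|, the estimate for
    \<open>pl.en_inf\<close>, the estimate for the Carlitz exponential at \<gamma> w, and |D w|
    \<le> 1 / (|c| + 1), by which the linear term of the functional equation prevails.\<close>
  define s where "s = min (min 1 (absv \<pi>)) (min (1 / absv \<gamma>) (1 / (B * (absv c + 1))))"
  have s: "0 < s" "s \<le> 1" "s \<le> absv \<pi>" "s \<le> 1 / absv \<gamma>" "s \<le> 1 / (B * (absv c + 1))"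
    using B \<gamma> pi_nonzero absv_nonneg[of c] by (auto simp: s_def intro!: mult_pos_pos divide_pos_pos add_nonneg_pos)
  have D_small: "absv (D w) \<le> B * absv w ^ q" if w: "absv w < s" for w
  proof -
    have "absv (pl.en_inf w - w) \<le> absv w * (absv w / absv \<pi>) ^ (q - 1)"
      using pl.absv_en_inf_diff_le[of w] w s unfolding pl_bas_0 by simp
    also have "\<dots> = (1 / absv \<pi> ^ (q - 1)) * absv w ^ q"
      by (simp add: power_divide)
    also have "\<dots> \<le> B * absv w ^ q"
      by (intro mult_right_mono) (auto simp: B_def absv_nonneg)
    finally have 1: "absv (pl.en_inf w - w) \<le> B * absv w ^ q" .
    have "absv \<gamma> * absv w \<le> absv \<gamma> * (1 / absv \<gamma>)"
      using w s(4) by (intro mult_left_mono absv_nonneg) linarith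
    then have "absv (\<gamma> * w) \<le> 1"
      using \<gamma>(1) by (simp add: absv_mult)
    then have "absv (carlitz_exp (\<gamma> * w) - \<gamma> * w) / absv \<gamma> \<le> absv (\<gamma> * w) ^ q / absv \<gamma>"
      using absv_carlitz_exp_diff_le by (intro divide_right_mono) (auto simp: absv_nonneg)
    moreover have "carlitz_exp (\<gamma> * w) / \<gamma> - w = (carlitz_exp (\<gamma> * w) - \<gamma> * w) / \<gamma>"
      using \<gamma> by (simp add: field_simps)
    ultimately have "absv (carlitz_exp (\<gamma> * w) / \<gamma> - w) \<le> absv (\<gamma> * w) ^ q / absv \<gamma>"
      by (simp add: absv_divide)
    also have "\<dots> = absv \<gamma> ^ (q - 1) * absv w ^ q"
    proof -
      have "absv \<gamma> ^ q = absv \<gamma> ^ (q - 1) * absv \<gamma>"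
        by simp
      then show ?thesis
        using \<gamma> by (simp add: absv_mult power_mult_distrib del: power_q_minus_Suc_0)
    qed
    also have "\<dots> \<le> B * absv w ^ q"
      by (intro mult_right_mono) (auto simp: B_def absv_nonneg)
    finally have 2: "absv (carlitz_exp (\<gamma> * w) / \<gamma> - w) \<le> B * absv w ^ q" .
    have "D w = (pl.en_inf w - w) - (carlitz_exp (\<gamma> * w) / \<gamma> - w)"
      by (simp add: D_def)
    then show ?thesis
      using absv_diff_le[OF 1 2] by simp
  qed
  have step: "absv (D (\<theta> * w)) \<le> absv \<theta> * absv (D w)" if w: "absv w < s" for w
  proof -
    have "absv (D w) \<le> B * absv w ^ 1"
      using D_small[OF w] w s B q_ge_2
      by (intro order_trans[OF D_small[OF w]] mult_left_mono power_decreasing) (auto simp: absv_nonneg)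
    also have "\<dots> \<le> B * (1 / (B * (absv c + 1)))"
      using w s B by (intro mult_left_mono) auto
    also have "\<dots> = 1 / (absv c + 1)"
      using B by simp
    finally have Dw: "absv (D w) \<le> 1 / (absv c + 1)" .
    also have "\<dots> \<le> 1"
      using absv_nonneg[of c] by simp
    finally have "absv (D w) ^ (q - 1) \<le> absv (D w) ^ 1"
      using q_ge_2 by (intro power_decreasing) (auto simp: absv_nonneg)
    then have "absv (D w) ^ (q - 1) \<le> 1 / (absv c + 1)"
      using Dw unfolding power_one_right by (rule order_trans)
    then have "absv c * absv (D w) ^ (q - 1) \<le> absv c * (1 / (absv c + 1))"
      by (rule mult_left_mono) (rule absv_nonneg)
    also have "\<dots> \<le> 1"
      using absv_nonneg[of c] by (simp add: divide_le_eq_1)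
    also have "\<dots> \<le> absv \<theta>"
      using q_ge_2 by (simp add: absv_theta)
    finally have "absv c * absv (D w) ^ (q - 1) * absv (D w) \<le> absv \<theta> * absv (D w)"
      by (intro mult_right_mono absv_nonneg)
    then show ?thesis
      unfolding D_theta by (intro absv_add_le) (simp_all add: absv_mult absv_power mult.assoc)
  qed
  \<comment> \<open>D vanishes to order q at 0 but grows by at most |\<theta>| under scaling by
    \<theta>. Going down to w / \<theta>^m bounds |D w| by a constant times q^m q^(-q m), which
    tends to 0.\<close>
  have D0: "D w = 0" if w: "absv w < s" for w
  proof -
    have iter: "absv (D w) \<le> absv \<theta> ^ m * absv (D (w / \<theta> ^ m))" for m
    proof (induction m)
      case (Suc m)
      have "absv (w / \<theta> ^ Suc m) \<le> absv w"
        unfolding absv_divide absv_theta_power by (rule absv_div_q_power)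
      then have "absv (D (\<theta> * (w / \<theta> ^ Suc m))) \<le> absv \<theta> * absv (D (w / \<theta> ^ Suc m))"
        using w by (intro step) linarith
      then have "absv \<theta> ^ m * absv (D (w / \<theta> ^ m)) \<le> absv \<theta> ^ m * (absv \<theta> * absv (D (w / \<theta> ^ Suc m)))"
        by (intro mult_left_mono) (simp_all add: absv_nonneg)
      from order_trans[OF Suc this] show ?case
        by (simp only: power_Suc mult_ac)
    qed simp
    have bound: "absv (D w) \<le> B * absv w ^ q * (1 / real q) ^ m" for m
    proof -
      have 1: "1 \<le> real q ^ m"
        using q_ge_2 by (intro one_le_power) auto
      have "absv (w / \<theta> ^ m) < s"
        using w absv_div_q_power[of w m] by (simp add: absv_divide absv_theta_power)
      then have "absv (D w) \<le> real q ^ m * (B * (absv w / real q ^ m) ^ q)"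
        using iter[of m] D_small[of "w / \<theta> ^ m"] 1
        by (intro order_trans[OF iter[of m]]) (simp add: absv_theta absv_divide absv_theta_power absv_power)
      also have "\<dots> = B * absv w ^ q * (real q ^ m * (1 / real q ^ m) ^ q)"
        by (simp add: power_divide)
      also have "\<dots> \<le> B * absv w ^ q * (real q ^ m * (1 / real q ^ m) ^ 2)"
        using 1 B q_ge_2 by (intro mult_left_mono power_decreasing) (auto simp: absv_nonneg)
      also have "\<dots> = B * absv w ^ q * (1 / real q) ^ m"
        using q_ge_2 by (simp add: power2_eq_square power_one_over)
      finally show ?thesis .
    qed
    have "(\<lambda>m. B * absv w ^ q * (1 / real q) ^ m) \<longlonglongrightarrow> B * absv w ^ q * 0"
      using q_ge_2 by (intro tendsto_intros LIMSEQ_power_zero) auto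
    then have "absv (D w) \<le> B * absv w ^ q * 0"
      using bound by (intro tendsto_lowerbound[of _ "B * absv w ^ q * 0" sequentially]) auto
    then show ?thesis by simp
  qed
  \<comment> \<open>The functional equation carries zeros from w / \<theta> to w, hence from the
    small disc to everything.\<close>
  have D0': "absv w < s * real q ^ m \<Longrightarrow> D w = 0" for w m
  proof (induction m arbitrary: w)
    case (Suc m)
    have "absv (w / \<theta>) < s * real q ^ m"
      using Suc.prems q_ge_2 by (simp add: absv_divide absv_theta divide_less_eq mult_ac)
    then have "D (w / \<theta>) = 0"
      by (rule Suc.IH)
    then show ?case
      using D_theta[of "w / \<theta>"] by (simp add: power_0_left)
  qed (simp add: D0)
  have "D w = 0" for w
  proof -
    obtain m where "absv w / s < real q ^ m"
      using real_arch_pow[of "real q" "absv w / s"] q_ge_2 by auto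
    then show ?thesis
      using s by (intro D0'[of w m]) (simp add: divide_less_eq mult.commute)
  qed
  then have "pl.en_inf w = carlitz_exp (\<gamma> * w) / \<gamma>" for w
    by (simp add: D_def)
  then show thesis
    using \<gamma> that unfolding c_def by blast
qed

text \<open>A unit of the polynomial ring is a constant; constants pass through the Carlitz
  exponential, and their (q-1)-st powers are 1.\<close>

lemma en_inf_eq_carlitz_exp: "pl.en_inf w = carlitz_exp w"
  and A_1_eq: "(\<theta> ^ q - \<theta>) * pl.A 1 = 1"
proof -
  obtain \<gamma> where \<gamma>: "\<gamma> \<noteq> 0" "(\<theta> ^ q - \<theta>) * pl.A 1 = \<gamma> ^ (q - 1)"
    "\<And>w. pl.en_inf w = carlitz_exp (\<gamma> * w) / \<gamma>"
    by (rule en_inf_scaled) blast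
  have "carlitz_exp (\<gamma> * \<pi>) = 0"
    using \<gamma>(3)[of \<pi>] \<gamma>(1) pl.en_inf_mu[of 1] by (simp add: \<Lambda>_def)
  then obtain a where "\<gamma> * \<pi> = \<pi> * of_A a"
    by (auto simp: carlitz_exp_eq_0_iff \<Lambda>_def)
  then have a: "\<gamma> = of_A a"
    using pi_nonzero by simp
  have "pl.en_inf (\<pi> / \<gamma>) = 0"
    using \<gamma>(1) carlitz_exp_pi[of 1] by (simp add: \<gamma>(3))
  then have "\<pi> / \<gamma> \<in> range \<Lambda>"
    using pl.en_inf_inverse_sum(1)[of "\<pi> / \<gamma>" 1] q_ge_2 by auto
  then obtain b where "\<pi> / \<gamma> = \<pi> * of_A b"
    by (auto simp: \<Lambda>_def)
  then have "\<pi> * (1 / \<gamma>) = \<pi> * of_A b"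
    by simp
  then have b: "1 / \<gamma> = of_A b"
    using pi_nonzero by (metis mult_left_cancel)
  have "a \<noteq> 0" "b \<noteq> 0"
    using a b \<gamma>(1) by auto
  then have "1 \<le> absv \<gamma>" "1 \<le> 1 / absv \<gamma>"
    using absv_of_A_ge_1[of a] absv_of_A_ge_1[of b] unfolding a[symmetric] b[symmetric]
    by (simp_all add: absv_divide)
  then have "absv \<gamma> = 1"
    using \<gamma>(1) le_divide_eq_1_pos[of "absv \<gamma>" 1] by simp
  then have "real q ^ degree a = 1"
    using absv_of_A[OF \<open>a \<noteq> 0\<close>] a by simp
  moreover have "1 < real q ^ degree a" if "0 < degree a"
    using q_ge_2 that by (intro one_less_power) auto
  ultimately have "degree a = 0"
    by fastforce
  then obtain c where "a = [:c:]"
    by (rule degree_eq_zeroE)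
  then have c: "\<gamma> = \<kappa> c"
    by (simp add: a of_A_pCons)
  show "pl.en_inf w = carlitz_exp w"
    using \<gamma>(1) by (simp add: \<gamma>(3) c carlitz_exp_kappa)
  have "\<gamma> ^ (q - 1) * \<gamma> = 1 * \<gamma>"
    using kappa_power_q[of c] by (simp add: c)
  then have "\<gamma> ^ (q - 1) = 1"
    using \<gamma>(1) by (metis mult_right_cancel)
  then show "(\<theta> ^ q - \<theta>) * pl.A 1 = 1"
    unfolding \<gamma>(2) .
qed

lemma carlitz_inverse_sum:
  assumes "carlitz_exp w \<noteq> 0" "1 \<le> j" "j \<le> q"
  shows "((\<lambda>b. 1 / (w + \<pi> * of_A b) ^ j) has_sum (1 / carlitz_exp w) ^ j) UNIV"
proof -
  have "((\<lambda>b. 1 / (w - \<Lambda> b) ^ j) has_sum (1 / carlitz_exp w) ^ j) UNIV"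
    using pl.en_inf_inverse_sum(2)[of w j] assms
    by (simp add: carlitz_exp_eq_0_iff en_inf_eq_carlitz_exp)
  moreover have "bij_betw uminus (UNIV :: 'f poly set) UNIV"
    by (rule bij_betwI[of _ _ _ uminus]) auto
  ultimately have "((\<lambda>b. 1 / (w - \<Lambda> (- b)) ^ j) has_sum (1 / carlitz_exp w) ^ j) UNIV"
    by (subst has_sum_reindex_bij_betw[where g = uminus])
  then show ?thesis
    by (simp add: pl.mu_minus) (simp add: \<Lambda>_def)
qed

text \<open>Carlitz's analogue of Euler's evaluation of zeta values, obtained from the first
  nontrivial coefficient of the exponential.\<close>

lemma has_sum_A_power: "((\<lambda>b. 1 / of_A b ^ (q - 1)) has_sum (\<pi> ^ (q - 1) / bracket 1)) (UNIV - {0})"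
proof -
  have "\<theta> ^ q - \<theta> \<noteq> 0"
    using A_1_eq by auto
  then have "pl.A 1 = 1 / bracket 1"
    using A_1_eq by (simp add: bracket_def eq_divide_eq mult.commute)
  then show ?thesis
    using has_sum_cmult_nonarch[OF pl.has_sum_A_1, of "\<pi> ^ (q - 1)"] pi_nonzero
    by (simp add: \<Lambda>_def power_mult_distrib)
qed

end

subsection \<open>Values near infinity\<close>

lemma power_int_1_minus: "1 \<le> q \<Longrightarrow> (y :: 'a::field) powi (1 - int q) = 1 / y ^ (q - 1)"
  by (cases "q = 1") (auto simp: power_int_def nat_diff_distrib power_inverse divide_inverse)

context frobenius_setting
begin

definition monic :: "'f poly set" where
  "monic = {a. lead_coeff a = 1}"

lemma zero_notin_monic: "0 \<notin> monic"
  by (simp add: monic_def)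

lemma bij_betw_monic: "bij_betw (\<lambda>(a, c). smult c a) (monic \<times> (UNIV - {0})) (UNIV - {0 :: 'f poly})"
proof (rule bij_betwI[where g = "\<lambda>a. (smult (1 / lead_coeff a) a, lead_coeff a)"])
  show "(\<lambda>(a, c). smult c a) \<in> monic \<times> (UNIV - {0}) \<rightarrow> UNIV - {0 :: 'f poly}"
    using zero_notin_monic by auto
qed (auto simp: monic_def)

text \<open>Every nonzero polynomial is a unique constant multiple of a monic one, and the q - 1
  equal terms of such a class add up to minus one of them.\<close>

lemma has_sum_monic:
  assumes f: "((f :: 'f poly \<Rightarrow> 'c) has_sum s) (UNIV - {0})"
    and inv: "\<And>c a. c \<noteq> 0 \<Longrightarrow> f (smult c a) = f a"
  shows "(f has_sum (- s)) monic"
proof -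
  have "((\<lambda>y. f (case y of (a, c) \<Rightarrow> smult c a)) has_sum s) (monic \<times> (UNIV - {0}))"
    using f by (subst has_sum_reindex_bij_betw[OF bij_betw_monic])
  moreover have "((\<lambda>c. f (smult c a)) has_sum (- f a)) (UNIV - {0})" for a
  proof (rule has_sum_finiteI)
    have "(\<Sum>c\<in>UNIV - {0}. f (smult c a)) = (\<Sum>c\<in>UNIV - {0::'f}. f a)"
      using inv by (intro sum.cong) auto
    also have "\<dots> = of_nat (q - 1) * f a"
      by (simp add: card_f)
    also have "of_nat (q - 1) = (- 1 :: 'c)"
      using of_nat_q q_ge_2 by (simp add: of_nat_diff)
    finally show "- f a = (\<Sum>c\<in>UNIV - {0}. f (smult c a))"
      by simp
  qed simp
  ultimately have "((\<lambda>a. - f a) has_sum s) monic"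
    by (intro has_sum_Sigma_nonarch[where f = "\<lambda>y. f (case y of (a, c) \<Rightarrow> smult c a)"]) auto
  then have "((\<lambda>a. (- 1) * - f a) has_sum (- 1) * s) monic"
    by (rule has_sum_cmult_nonarch)
  then show ?thesis
    by simp
qed

end

text \<open>\<open>large\<close> becomes \<open>bas_large\<close> for the lattice of the 1 / u_a.
  \<open>larger\<close> keeps z away from the fraction field of the polynomial ring, as needed to
  sum and differentiate the series for \<open>g\<close>.\<close>

locale good_point = drinfeld_setting p e q \<iota> \<pi>
  for p e q :: nat
    and \<iota> :: "'f::{field,finite} fls alg_closure \<Rightarrow> 'c::{nonarch_field,complete_space}"
    and \<pi> :: 'c +
  fixes z :: 'c
  assumes large: "real q ^ 2 < absv (carlitz_exp (\<pi> * z))"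
    and larger: "absv w \<le> absv \<pi> \<Longrightarrow> absv (carlitz_exp w) < absv (carlitz_exp (\<pi> * z))"
begin

definition lam :: "'f poly \<Rightarrow> 'c" where
  "lam a = carlitz_exp (\<pi> * (of_A a * z))"

lemma lam_add: "lam (a + b) = lam a + lam b"
  by (simp add: lam_def of_A_add ring_distribs carlitz_exp_add)

lemma lam_smult: "lam (smult c a) = \<kappa> c * lam a"
proof -
  have "\<pi> * (\<kappa> c * of_A a * z) = \<kappa> c * (\<pi> * (of_A a * z))"
    by (simp add: mult_ac)
  then show ?thesis
    unfolding lam_def of_A_smult by (simp only: carlitz_exp_kappa)
qed

lemma lam_0 [simp]: "lam 0 = 0"
  by (simp add: lam_def)

lemma lam_pCons_0: "lam (pCons 0 a) = \<theta> * lam a + lam a ^ q"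
  using carlitz_exp_theta[of "\<pi> * (of_A a * z)"] by (simp add: lam_def of_A_pCons mult.left_commute mult.assoc)

lemma lam_1: "lam 1 = carlitz_exp (\<pi> * z)"
  by (simp add: lam_def)

text \<open>The leading coefficient decides, because at every stage the q-th power dominates in the
  Carlitz action. This has to precede the lattice interpretation, whose growth conditions rest on
  it.\<close>

lemma absv_lam: "a \<noteq> 0 \<Longrightarrow> absv (lam a) = absv (lam 1) ^ (q ^ degree a)"
proof (induction a)
  case (pCons c a)
  have const: "lam [:c:] = \<kappa> c * lam 1"
    using lam_smult[of c 1] by simp
  have split: "lam (pCons c a) = lam [:c:] + (\<theta> * lam a + lam a ^ q)"
    using lam_add[of "[:c:]" "pCons 0 a"] by (simp add: lam_pCons_0)
  have q: "real q < absv (lam 1)"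
    using large q_ge_2 unfolding lam_1 by (intro le_less_trans[of "real q" "real q ^ 2"]) (auto simp: power2_eq_square)
  then have gt_1: "1 < absv (lam 1)"
    using q_ge_2 by linarith
  show ?case
  proof (cases "a = 0")
    case True
    then show ?thesis
      using pCons by (simp add: const absv_mult absv_kappa)
  next
    case False
    define R where "R = absv (lam a)"
    have IH: "R = absv (lam 1) ^ (q ^ degree a)"
      using pCons.IH False by (simp add: R_def)
    have R: "absv (lam 1) \<le> R"
      unfolding IH using gt_1 q_pos(3)[of "degree a"] by (intro self_le_power) auto
    have "R ^ 1 \<le> R ^ (q - 1)"
      using q_ge_2 R gt_1 by (intro power_increasing) auto
    then have "real q * R < R ^ (q - 1) * R"
      using q R gt_1 by (intro mult_strict_right_mono) auto
    then have "absv (\<theta> * lam a) < absv (lam a ^ q)"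
      by (simp add: absv_mult absv_power absv_theta flip: R_def)
    then have 1: "absv (\<theta> * lam a + lam a ^ q) = R ^ q"
      by (simp add: absv_add_eq_right absv_power R_def)
    have "absv (lam [:c:]) \<le> absv (lam 1) * 1"
      using absv_kappa_le[of c] unfolding const absv_mult by (subst mult.commute) (intro mult_left_mono absv_nonneg)
    also have "\<dots> \<le> R"
      using R by simp
    also have "R < R ^ q"
      using R gt_1 q_ge_2 power_strict_increasing[of 1 q R] by simp
    finally have "absv (lam (pCons c a)) = R ^ q"
      unfolding split using 1 by (subst absv_add_eq_right) auto
    then show ?thesis
      using False by (simp add: IH mult.commute flip: power_mult)
  qed
qed simp

lemma lam_gt_1: "1 < absv (lam 1)"
proof -
  have "1 < real q ^ 2"
    using q_ge_2 by (intro one_less_power) auto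
  then show ?thesis
    using large unfolding lam_1 by linarith
qed

sublocale ll: large_lattice q "\<lambda>c. of_Kinf (fls_const c)" lam \<theta>
proof -
  have m: "absv (lam (monom 1 n)) = absv (lam 1) ^ (q ^ n)" for n
    using absv_lam[of "monom 1 n"] by (simp add: degree_monom_eq)
  interpret additive_lattice q "\<lambda>c. of_Kinf (fls_const c)" lam
  proof
    show "absv (lam a) < absv (lam (monom 1 n))" if "a \<in> deg_less n" for a n
    proof (cases "a = 0")
      case False
      then have "q ^ degree a < q ^ n"
        using that q_ge_2 by (intro power_strict_increasing) (auto simp: deg_less_iff)
      then show ?thesis
        unfolding m absv_lam[OF False] using lam_gt_1 by (rule power_strict_increasing)
    next
      case True
      have "0 < absv (lam 1) ^ (q ^ n)"
        using lam_gt_1 by (intro zero_less_power) linarith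
      then show ?thesis
        unfolding m by (simp only: True lam_0 absv_0)
    qed
    have le: "absv (lam 1) ^ n \<le> absv (lam 1) ^ (q ^ n)" for n
      using lam_gt_1 le_q_power_minus_1[of n] by (intro power_increasing) linarith+
    have lim: "filterlim (\<lambda>n. absv (lam 1) ^ n) at_top sequentially"
    proof (rule filterlim_at_infinity_imp_filterlim_at_top)
      show "filterlim (\<lambda>n. absv (lam 1) ^ n) at_infinity sequentially"
        using lam_gt_1 by (intro filterlim_realpow_sequentially_gt1) simp
      have "0 < absv (lam 1) ^ n" for n
        using lam_gt_1 by (intro zero_less_power) linarith
      then show "\<forall>\<^sub>F n in sequentially. 0 < absv (lam 1) ^ n"
        by (intro always_eventually allI)
    qed
    show "filterlim (\<lambda>n. absv (lam (monom 1 n))) at_top sequentially"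
      unfolding m by (rule filterlim_at_top_mono[OF lim always_eventually[OF allI[OF le]]])
  qed (simp_all add: lam_add lam_smult)
  show "large_lattice q (\<lambda>c. of_Kinf (fls_const c)) lam \<theta>"
  proof
    show "1 < absv \<theta>"
      using q_ge_2 by (simp add: absv_theta)
    show "absv \<theta> ^ 2 < absv (bas 0)"
      using large by (simp add: absv_theta bas_def monom_0 lam_1 flip: one_pCons)
  qed (rule lam_pCons_0)
qed

lemma lam_nonzero: "a \<noteq> 0 \<Longrightarrow> lam a \<noteq> 0"
  by simp

lemma theta_le: "absv \<theta> \<le> ll.H ^ q"
  by (rule ll.eta_bounds(1))

text \<open>Division with remainder shows that \<open>z\<close> is at distance at least 1 from all of \<open>K\<close>.\<close>

lemma absv_lin_ge: "a \<noteq> 0 \<Longrightarrow> absv (of_A a) \<le> absv (of_A a * z + of_A b)"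
proof (rule ccontr)
  assume a: "a \<noteq> 0" and *: "\<not> ?thesis"
  define w where "w = z + of_A b / of_A a"
  have "of_A a * z + of_A b = of_A a * w"
    using a by (simp add: w_def field_simps)
  then have w: "absv w < 1"
    using * a by (simp add: absv_mult not_le mult_less_cancel_left1)
  define y where "y = of_A (b mod a) / of_A a"
  have "absv (of_A (b mod a)) \<le> absv (of_A a)"
  proof (cases "b mod a = 0")
    case False
    then have "degree (b mod a) < degree a"
      using degree_mod_less[OF a, of b] by auto
    then have "real q ^ degree (b mod a) \<le> real q ^ degree a"
      using q_ge_2 by (intro power_increasing) auto
    then show ?thesis
      using False a by (simp add: absv_of_A)
  qed (simp add: absv_nonneg)
  then have y: "absv y \<le> 1"
    using a by (simp add: y_def absv_divide divide_le_eq_1)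
  have "of_A b = of_A (b div a) * of_A a + of_A (b mod a)"
    by (metis div_mult_mod_eq of_A_add of_A_mult)
  then have "of_A b / of_A a = of_A (b div a) + y"
    using a by (simp add: y_def add_divide_distrib)
  then have "z + of_A (b div a) = w - y"
    by (simp add: w_def)
  \<comment> \<open>Adding a period does not change the Carlitz exponential, but the shifted
    argument lies in the disc where \<open>larger\<close> bounds it strictly below its own
    value.\<close>
  then have "\<pi> * z + \<pi> * of_A (b div a) = \<pi> * (w - y)"
    by (metis distrib_left)
  then have "carlitz_exp (\<pi> * z) = carlitz_exp (\<pi> * (w - y))"
    using carlitz_exp_add[of "\<pi> * z" "\<pi> * of_A (b div a)"] carlitz_exp_pi[of "b div a"] by simp
  moreover have "absv (\<pi> * (w - y)) \<le> absv \<pi>"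
    using absv_diff_le[of w 1 y] w y unfolding absv_mult by (intro mult_left_le absv_nonneg) auto
  ultimately show False
    using larger by (metis less_irrefl)
qed

lemma inner_sum:
  assumes "a \<noteq> 0" "1 \<le> j" "j \<le> q"
  shows "((\<lambda>b. 1 / (of_A a * z + of_A b) ^ j) has_sum (\<pi> / lam a) ^ j) UNIV"
proof -
  have "((\<lambda>b. 1 / (\<pi> * (of_A a * z) + \<pi> * of_A b) ^ j) has_sum (1 / lam a) ^ j) UNIV"
    using lam_nonzero[OF assms(1)] assms unfolding lam_def by (intro carlitz_inverse_sum) auto
  from has_sum_cmult_nonarch[OF this, of "\<pi> ^ j"]
  show ?thesis
    using pi_nonzero by (simp add: power_mult_distrib power_divide flip: distrib_left)
qed

lemma weighted_smult:
  "c \<noteq> 0 \<Longrightarrow> eval_at \<theta> (smult c a) / lam (smult c a) ^ (q ^ k) = eval_at \<theta> a / lam a ^ (q ^ k)"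
  using kappa_nonzero[of c] by (simp add: eval_at_smult lam_smult power_mult_distrib kappa_power_qk)

lemma has_sum_monic_r: "((\<lambda>a. of_A a / lam a ^ (q ^ k)) has_sum - ll.r k \<theta>) monic"
  using has_sum_monic[OF ll.has_sum_r[OF theta_le, of k]] weighted_smult unfolding of_A_conv by blast

lemma E_eq: "E z = - ll.r 0 \<theta>"
proof -
  have "infsum (\<lambda>b. of_A a / (of_A a * z + of_A b)) UNIV = \<pi> * (of_A a / lam a)" if "a \<in> monic" for a
  proof -
    have "a \<noteq> 0"
      using that zero_notin_monic by auto
    from has_sum_cmult_nonarch[OF inner_sum[OF this, of 1], of "of_A a"] q_ge_2
    have "((\<lambda>b. of_A a / (of_A a * z + of_A b)) has_sum \<pi> * (of_A a / lam a)) UNIV"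
      by (simp add: mult_ac)
    then show ?thesis
      by (rule infsumI)
  qed
  then have "E z = 1 / \<pi> * infsum (\<lambda>a. \<pi> * (of_A a / lam a)) monic"
    unfolding E_def monic_def by (metis (no_types, lifting) infsum_cong mem_Collect_eq)
  also have "infsum (\<lambda>a. \<pi> * (of_A a / lam a)) monic = \<pi> * - ll.r 0 \<theta>"
    using has_sum_cmult_nonarch[OF has_sum_monic_r[of 0], of \<pi>] by (intro infsumI) simp
  finally show ?thesis
    using pi_nonzero by simp
qed

section \<open>The lattice sum for g and its derivative\<close>

lemma finite_small_lin:
  "\<exists>N. \<forall>a b. absv (of_A a * z + of_A b) \<le> K \<longrightarrow> a \<in> deg_less N \<and> b \<in> deg_less N"
proof -
  define B where "B = max 1 (max K (max K 0 * absv z))"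
  obtain N where N: "B < real q ^ N"
    using real_arch_pow[of "real q" B] q_ge_2 by auto
  have small: "a \<in> deg_less N" if "absv (of_A a) \<le> B" for a
  proof (rule ccontr)
    assume "a \<notin> deg_less N"
    then have "a \<noteq> 0" "N \<le> degree a"
      by (auto simp: deg_less_iff)
    then have "real q ^ N \<le> absv (of_A a)"
      using q_ge_2 by (simp add: absv_of_A power_increasing)
    then show False
      using that N by linarith
  qed
  have "a \<in> deg_less N \<and> b \<in> deg_less N" if *: "absv (of_A a * z + of_A b) \<le> K" for a b
  proof -
    have a: "absv (of_A a) \<le> max K 0"
      using absv_lin_ge[of a b] * by (cases "a = 0") auto
    then have "absv (of_A a * z) \<le> max K 0 * absv z"
      unfolding absv_mult by (intro mult_right_mono absv_nonneg)
    then have "absv ((of_A a * z + of_A b) - of_A a * z) \<le> B"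
      using * by (intro absv_diff_le) (auto simp: B_def)
    moreover have "absv (of_A a) \<le> B"
      using a by (auto simp: B_def)
    ultimately show ?thesis
      using small by auto
  qed
  then show ?thesis by blast
qed

text \<open>The perturbation a (w - z) is smaller than |a|, hence smaller than |a z + b| by
  \<open>absv_lin_ge\<close>. So all estimates are uniform for w near z.\<close>

lemma absv_lin_near:
  assumes "absv (w - z) < 1"
  shows "absv (of_A a * w + of_A b) = absv (of_A a * z + of_A b)"
proof (cases "a = 0")
  case False
  have "absv (of_A a * (w - z)) < absv (of_A a * z + of_A b)"
    using absv_lin_ge[OF False, of b] assms False
    unfolding absv_mult by (intro less_le_trans[OF _ absv_lin_ge[OF False]]) (simp add: mult_less_cancel_left1)
  then have "absv ((of_A a * z + of_A b) + of_A a * (w - z)) = absv (of_A a * z + of_A b)"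
    by (rule absv_add_eq_left)
  then show ?thesis
    by (simp add: algebra_simps)
qed simp

lemma absv_lin_ge_1: "(a, b) \<noteq> (0, 0) \<Longrightarrow> 1 \<le> absv (of_A a * z + of_A b)"
  using absv_lin_ge[of a b] absv_of_A_ge_1[of a] absv_of_A_ge_1[of b] by (cases "a = 0") auto

text \<open>Covers both the series for \<open>g\<close> (numerator 1, j = q - 1, which is 1 when q =
  2) and its termwise derivative (numerator a, j = q). In each case a term with T = |a z + b| > 1 is
  at most 1 / T.\<close>

lemma summable_lattice:
  assumes "absv (w - z) < 1" "1 \<le> j" "\<And>a. absv (c a) \<le> max 1 (absv (of_A a))" "j = 1 \<longrightarrow> (\<forall>a. absv (c a) \<le> 1)"
  shows "(\<lambda>(a, b). c a / (of_A a * w + of_A b) ^ j) summable_on S"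
proof (rule summable_on_nonarch)
  fix \<epsilon> :: real assume \<epsilon>: "0 < \<epsilon>"
  obtain N where N: "\<And>a b. absv (of_A a * z + of_A b) \<le> max 1 (1 / \<epsilon>) \<Longrightarrow> a \<in> deg_less N \<and> b \<in> deg_less N"
    using finite_small_lin[of "max 1 (1 / \<epsilon>)"] by blast
  have "(a, b) \<in> deg_less N \<times> deg_less N" if *: "\<epsilon> \<le> absv (c a / (of_A a * w + of_A b) ^ j)" for a b
  proof (rule ccontr)
    define T where "T = absv (of_A a * z + of_A b)"
    assume "(a, b) \<notin> deg_less N \<times> deg_less N"
    then have "\<not> T \<le> max 1 (1 / \<epsilon>)"
      using N[of a b] unfolding T_def by blast
    then have T: "1 < T" "1 / \<epsilon> < T"
      by auto
    have ca: "absv (c a) \<le> T ^ (j - 1)"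
    proof (cases "j = 1")
      case False
      have "absv (of_A a) \<le> T"
        using absv_lin_ge[of a b] T(1) by (cases "a = 0") (auto simp: T_def)
      then have "absv (c a) \<le> T ^ 1"
        using assms(3)[of a] T(1) by auto
      also have "\<dots> \<le> T ^ (j - 1)"
        using False assms(2) T(1) by (intro power_increasing) auto
      finally show ?thesis .
    qed (use assms(4) in auto)
    have "absv (c a / (of_A a * w + of_A b) ^ j) = absv (c a) / T ^ j"
      unfolding absv_divide absv_power absv_lin_near[OF assms(1)] T_def ..
    also have "\<dots> \<le> T ^ (j - 1) / T ^ j"
      using T(1) by (intro divide_right_mono ca) simp
    also have "T ^ j = T ^ (j - 1) * T"
      using assms(2) power_minus_mult[of j T] by simp
    also have "T ^ (j - 1) / (T ^ (j - 1) * T) = 1 / T"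
      using T(1) by simp
    also have "\<dots> < \<epsilon>"
      using T \<epsilon> by (simp add: pos_divide_less_eq mult.commute)
    finally show False
      using * by simp
  qed
  then have "{y\<in>S. \<epsilon> \<le> absv (case y of (a, b) \<Rightarrow> c a / (of_A a * w + of_A b) ^ j)} \<subseteq> deg_less N \<times> deg_less N"
    by auto
  then show "finite {y\<in>S. \<epsilon> \<le> absv (case y of (a, b) \<Rightarrow> c a / (of_A a * w + of_A b) ^ j)}"
    by (rule finite_subset) simp
qed

definition gsum :: "'c \<Rightarrow> 'c" where
  "gsum w = infsum (\<lambda>(a, b). 1 / (of_A a * w + of_A b) ^ (q - 1)) (UNIV - {(0, 0)})"

lemma has_sum_gsum:
  assumes "absv (w - z) < 1"
  shows "((\<lambda>(a, b). 1 / (of_A a * w + of_A b) ^ (q - 1)) has_sum gsum w) (UNIV - {(0, 0)})"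
  unfolding gsum_def using summable_lattice[OF assms, of "q - 1" "\<lambda>_. 1"] q_ge_2
  by (intro has_sum_infsum) auto

lemma g_eq_gsum: "g w = bracket 1 / \<pi> ^ (q - 1) * gsum w"
proof -
  have "(\<lambda>(a, b). (of_A a * w + of_A b) powi (1 - int q)) = (\<lambda>(a, b). 1 / (of_A a * w + of_A b) ^ (q - 1))"
    using power_int_1_minus[of q, where ?'a = 'c] q_ge_2 by (simp add: fun_eq_iff)
  then show ?thesis
    using power_int_1_minus[of q \<pi>] q_ge_2 unfolding g_def gsum_def by simp
qed

lemma bracket_1_nonzero: "bracket 1 \<noteq> 0"
  using A_1_eq by (auto simp: bracket_def)

text \<open>Sum over b first. The row a = 0 is the Carlitz zeta value and yields the summand 1 of
  \<open>gc\<close>; every other row collapses to a power of u_a, and together they give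
  \<open>ll.A 1\<close>.\<close>

lemma g_eq: "g z = ll.gc"
proof -
  define B where "B a = (if a = 0 then UNIV - {0} else UNIV :: 'f poly set)" for a :: "'f poly"
  define s where "s a = \<pi> ^ (q - 1) * (if a = 0 then 1 / bracket 1 else 1 / lam a ^ (q - 1))" for a
  have "(\<lambda>(a, b). 1 / (of_A a * z + of_A b) ^ (q - 1)) = (\<lambda>y. 1 / (of_A (fst y) * z + of_A (snd y)) ^ (q - 1))"
    by (simp add: case_prod_unfold)
  moreover have "UNIV - {(0, 0)} = Sigma UNIV B"
    by (auto simp: B_def split: if_splits)
  ultimately have tot: "((\<lambda>y. 1 / (of_A (fst y) * z + of_A (snd y)) ^ (q - 1)) has_sum gsum z) (Sigma UNIV B)"
    using has_sum_gsum[of z] by simp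
  have inner: "((\<lambda>b. 1 / (of_A (fst (a, b)) * z + of_A (snd (a, b))) ^ (q - 1)) has_sum s a) (B a)" for a
    using has_sum_A_power inner_sum[of a "q - 1"] q_ge_2 by (simp add: B_def s_def power_divide)
  have 1: "(s has_sum gsum z) UNIV"
    using tot inner by (rule has_sum_Sigma_nonarch)
  have "((\<lambda>a. \<pi> ^ (q - 1) * (1 / lam a ^ (q - 1))) has_sum \<pi> ^ (q - 1) * ll.A 1) (UNIV - {0})"
    by (rule has_sum_cmult_nonarch[OF ll.has_sum_A_1])
  then have "(s has_sum \<pi> ^ (q - 1) * ll.A 1) (UNIV - {0})"
    by (subst has_sum_cong[where g = "\<lambda>a. \<pi> ^ (q - 1) * (1 / lam a ^ (q - 1))"]) (auto simp: s_def)
  moreover have "(s has_sum s 0) {0}"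
    by (rule has_sum_finiteI) auto
  ultimately have "(s has_sum (s 0 + \<pi> ^ (q - 1) * ll.A 1)) ({0} \<union> (UNIV - {0}))"
    by (intro has_sum_Un_disjoint) auto
  then have "gsum z = \<pi> ^ (q - 1) * (1 / bracket 1 + ll.A 1)"
    using has_sum_unique[OF 1] by (simp add: s_def algebra_simps)
  then show ?thesis
    using pi_nonzero bracket_1_nonzero
    by (simp add: g_eq_gsum ll.gc_def distrib_left) (simp add: bracket_def)
qed

text \<open>The derivative of l^(1-q) is (1 - q) a l^(-q) = a l^(-q) in characteristic p, and the
  sum over b is again a pure power because q is the last exponent that \<open>inner_sum\<close>
  allows.\<close>

lemma has_sum_derivative: "((\<lambda>(a, b). of_A a / (of_A a * z + of_A b) ^ q) has_sum \<pi> ^ q * ll.r 1 \<theta>) (UNIV - {(0, 0)})"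
proof -
  let ?f = "\<lambda>y. of_A (fst y) / (of_A (fst y) * z + of_A (snd y)) ^ q"
  define B where "B a = (if a = 0 then UNIV - {0} else UNIV :: 'f poly set)" for a :: "'f poly"
  define s where "s a = (if a = 0 then 0 else \<pi> ^ q * (of_A a / lam a ^ q))" for a
  have "(\<lambda>(a, b). of_A a / (of_A a * z + of_A b) ^ q) summable_on (UNIV - {(0, 0)})"
    using q_ge_2 by (intro summable_lattice) auto
  then have "?f summable_on (UNIV - {(0, 0)})"
    by (simp add: case_prod_unfold)
  then obtain t where t: "(?f has_sum t) (UNIV - {(0, 0)})"
    unfolding summable_on_def by blast
  have eq: "UNIV - {(0, 0)} = Sigma UNIV B"
    by (auto simp: B_def split: if_splits)
  have inner: "((\<lambda>b. ?f (a, b)) has_sum s a) (B a)" for a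
  proof (cases "a = 0")
    case False
    show ?thesis
      using has_sum_cmult_nonarch[OF inner_sum[OF False, of q], of "of_A a"] False q_ge_2
      by (simp add: B_def s_def power_divide mult_ac)
  qed (simp add: B_def s_def)
  have "(s has_sum t) UNIV"
    using t[unfolded eq] inner by (rule has_sum_Sigma_nonarch)
  moreover have "(s has_sum \<pi> ^ q * ll.r 1 \<theta>) UNIV"
  proof -
    have "((\<lambda>a. \<pi> ^ q * (of_A a / lam a ^ q)) has_sum \<pi> ^ q * ll.r 1 \<theta>) (UNIV - {0})"
      using has_sum_cmult_nonarch[OF ll.has_sum_r[OF theta_le, of 1], of "\<pi> ^ q"] by (simp add: of_A_conv)
    then show ?thesis
      by (subst has_sum_cong_neutral[of "UNIV - {0}" UNIV "\<lambda>a. \<pi> ^ q * (of_A a / lam a ^ q)"]) (auto simp: s_def)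
  qed
  ultimately have "t = \<pi> ^ q * ll.r 1 \<theta>"
    by (rule has_sum_unique)
  then show ?thesis
    using t by (simp add: case_prod_unfold)
qed

text \<open>Termwise differentiation with an error that is uniform in the lattice point: each term
  contributes at most |w - z|^(q-1), and the strong triangle inequality passes this bound to the
  sum.\<close>

lemma difference_quotient:
  assumes w: "absv (w - z) < 1" "w \<noteq> z"
  shows "absv ((gsum w - gsum z) / (w - z) - \<pi> ^ q * ll.r 1 \<theta>) \<le> absv (w - z) ^ (q - 1)"
proof -
  define \<epsilon> where "\<epsilon> = w - z"
  have \<epsilon>: "\<epsilon> \<noteq> 0"
    using w by (simp add: \<epsilon>_def)
  let ?f = "\<lambda>w y. case y of (a, b) \<Rightarrow> 1 / (of_A a * w + of_A b) ^ (q - 1)"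
  let ?f' = "\<lambda>y. case y of (a, b) \<Rightarrow> of_A a / (of_A a * z + of_A b) ^ q"
  have "((\<lambda>y. (1 / \<epsilon>) * (?f w y - ?f z y) - ?f' y) has_sum ((1 / \<epsilon>) * (gsum w - gsum z) - \<pi> ^ q * ll.r 1 \<theta>)) (UNIV - {(0, 0)})"
    using w by (intro has_sum_diff_nonarch has_sum_cmult_nonarch has_sum_gsum has_sum_derivative) auto
  then have "absv ((1 / \<epsilon>) * (gsum w - gsum z) - \<pi> ^ q * ll.r 1 \<theta>) \<le> absv \<epsilon> ^ (q - 1)"
  proof (rule absv_has_sum_le)
    fix y :: "'f poly \<times> 'f poly" assume "y \<in> UNIV - {(0, 0)}"
    moreover obtain a b where y: "y = (a, b)"
      by (cases y)
    ultimately have ab: "(a, b) \<noteq> (0, 0)"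
      by simp
    define l where "l = of_A a * z + of_A b"
    define \<delta> where "\<delta> = of_A a * \<epsilon>"
    have lw: "of_A a * w + of_A b = l + \<delta>"
      by (simp add: l_def \<delta>_def \<epsilon>_def algebra_simps)
    have al: "absv (l + \<delta>) = absv l" "1 \<le> absv l"
      using absv_lin_near[OF w(1), of a b] absv_lin_ge_1[OF ab] unfolding lw by (simp_all add: l_def)
    then have nz: "l \<noteq> 0" "l + \<delta> \<noteq> 0"
      by (auto simp flip: absv_eq_0)
    have aT: "absv (of_A a) \<le> absv l"
      using absv_lin_ge[of a b] al(2) by (cases "a = 0") (auto simp: l_def)
    have pw: "s ^ q = s ^ (q - 1) * s" for s :: 'c
      by simp
    \<comment> \<open>Writing 1 / x^(q-1) as x / x^q leaves only q-th powers in the denominators, so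
      that (l + \<delta>)^q can be expanded additively.\<close>
    have "(1 / \<epsilon>) * (?f w y - ?f z y) - ?f' y = - (of_A a * \<delta> ^ (q - 1) / (l ^ q * (l + \<delta>) ^ (q - 1)))"
    proof -
      have "1 / (l + \<delta>) ^ (q - 1) - 1 / l ^ (q - 1) = (l + \<delta>) / (l + \<delta>) ^ q - l / l ^ q"
        using nz by (simp add: pw del: power_q_minus_Suc_0)
      also have "\<dots> = ((l + \<delta>) * l ^ q - l * (l + \<delta>) ^ q) / (l ^ q * (l + \<delta>) ^ q)"
        using nz by (simp add: diff_frac_eq mult_ac)
      also have "(l + \<delta>) * l ^ q - l * (l + \<delta>) ^ q = \<delta> * (l ^ q - l * \<delta> ^ (q - 1))"
        unfolding frob_add pw[of \<delta>] by (simp add: algebra_simps del: power_q_minus_Suc_0 power_q_minus_Suc_0')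
      finally have "1 / (l + \<delta>) ^ (q - 1) - 1 / l ^ (q - 1) = \<delta> * (l ^ q - l * \<delta> ^ (q - 1)) / (l ^ q * (l + \<delta>) ^ q)" .
      then have "(1 / \<epsilon>) * (?f w y - ?f z y) = of_A a * (l ^ q - l * \<delta> ^ (q - 1)) / (l ^ q * (l + \<delta>) ^ q)"
        using \<epsilon> by (simp add: y lw l_def[symmetric] \<delta>_def)
      moreover have "?f' y = of_A a * (l + \<delta>) ^ q / (l ^ q * (l + \<delta>) ^ q)"
        using nz by (simp add: y l_def[symmetric])
      ultimately have "(1 / \<epsilon>) * (?f w y - ?f z y) - ?f' y
          = (of_A a * (l ^ q - l * \<delta> ^ (q - 1)) - of_A a * (l + \<delta>) ^ q) / (l ^ q * (l + \<delta>) ^ q)"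
        by (simp only: diff_divide_distrib)
      also have "of_A a * (l ^ q - l * \<delta> ^ (q - 1)) - of_A a * (l + \<delta>) ^ q = - (of_A a * \<delta> ^ (q - 1) * (l + \<delta>))"
        unfolding frob_add pw[of \<delta>] by (simp add: algebra_simps del: power_q_minus_Suc_0 power_q_minus_Suc_0')
      also have "\<dots> / (l ^ q * (l + \<delta>) ^ q) = - (of_A a * \<delta> ^ (q - 1) * (l + \<delta>)) / (l ^ q * (l + \<delta>) ^ (q - 1) * (l + \<delta>))"
        unfolding pw[of "l + \<delta>"] by (simp only: mult.assoc)
      finally show ?thesis
        using nz(2) by (simp add: mult_divide_mult_cancel_right del: power_q_minus_Suc_0 power_q_minus_Suc_0')
    qed
    then have "absv ((1 / \<epsilon>) * (?f w y - ?f z y) - ?f' y) = absv (of_A a * \<delta> ^ (q - 1) / (l ^ q * (l + \<delta>) ^ (q - 1)))"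
      by (simp only: absv_minus)
    also have "\<dots> = absv (of_A a) * (absv (of_A a) * absv \<epsilon>) ^ (q - 1) / (absv l ^ q * absv l ^ (q - 1))"
      unfolding absv_divide absv_mult absv_power al(1) by (simp add: \<delta>_def absv_mult)
    also have "\<dots> \<le> absv l * (absv l * absv \<epsilon>) ^ (q - 1) / (absv l ^ q * absv l ^ (q - 1))"
      using aT by (intro divide_right_mono mult_mono power_mono) (auto simp: absv_nonneg)
    also have "\<dots> = absv \<epsilon> ^ (q - 1) * (1 / absv l ^ (q - 1))"
    proof -
      have "absv l ^ q = absv l * absv l ^ (q - 1)"
        by simp
      then show ?thesis
        using nz(1) by (simp add: power_mult_distrib del: power_q_minus_Suc_0 power_q_minus_Suc_0')
    qed
    also have "\<dots> \<le> absv \<epsilon> ^ (q - 1) * 1"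
      using al(2) by (intro mult_left_mono) (auto simp: absv_nonneg divide_le_eq_1 one_le_power)
    finally show "absv ((1 / \<epsilon>) * (?f w y - ?f z y) - ?f' y) \<le> absv \<epsilon> ^ (q - 1)"
      by simp
  qed (simp add: absv_nonneg)
  then show ?thesis
    by (simp add: \<epsilon>_def)
qed

text \<open>The value of \<open>Lim\<close> in \<open>D1\<close> is determined only if z is not
  isolated; the points z + 1 / \<theta>^n show that it is not.\<close>

lemma at_neq_bot: "at z \<noteq> bot"
proof
  assume "at z = bot"
  then have "open {z}"
    by (simp add: at_eq_bot_iff)
  then obtain s where s: "s > 0" "ball z s \<subseteq> {z}"
    unfolding open_contains_ball by blast
  have "(\<lambda>n. (1 / real q) ^ n) \<longlonglongrightarrow> 0"
    using q_ge_2 by (intro LIMSEQ_power_zero) auto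
  then obtain n where "(1 / real q) ^ n < s"
    using s order_tendstoD(2) by (metis eventually_happens sequentially_bot)
  then have "z + 1 / \<theta> ^ n \<in> ball z s"
    by (simp add: dist_absv absv_divide absv_theta_power power_one_over)
  then show False
    using s(2) by auto
qed

lemma D1_g_eq: "D1 g z = - bracket 1 * ll.r 1 \<theta>"
proof -
  define C where "C = bracket 1 / \<pi> ^ (q - 1)"
  have "((\<lambda>w. (gsum w - gsum z) / (w - z)) \<longlongrightarrow> \<pi> ^ q * ll.r 1 \<theta>) (at z)"
    unfolding tendsto_absv_iff
  proof (rule tendsto_sandwich[OF _ _ tendsto_const])
    have "((\<lambda>w. absv (w - z)) \<longlongrightarrow> 0) (at z)"
      using tendsto_ident_at[of z UNIV] by (simp add: tendsto_absv_iff)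
    moreover from this have "\<forall>\<^sub>F w in at z. absv (w - z) < 1"
      by (rule order_tendstoD(2)) simp
    ultimately show "\<forall>\<^sub>F w in at z. absv ((gsum w - gsum z) / (w - z) - \<pi> ^ q * ll.r 1 \<theta>) \<le> absv (w - z) ^ (q - 1)"
      using difference_quotient by (auto simp: eventually_at_filter elim: eventually_mono)
    have "((\<lambda>w. absv (w - z) ^ (q - 1)) \<longlongrightarrow> 0 ^ (q - 1)) (at z)"
      by (intro tendsto_intros \<open>((\<lambda>w. absv (w - z)) \<longlongrightarrow> 0) (at z)\<close>)
    then show "((\<lambda>w. absv (w - z) ^ (q - 1)) \<longlongrightarrow> 0) (at z)"
      using q_ge_2 by (simp add: zero_power)
  qed (simp add: absv_nonneg)
  then have "((\<lambda>w. C * ((gsum w - gsum z) / (w - z))) \<longlongrightarrow> C * (\<pi> ^ q * ll.r 1 \<theta>)) (at z)"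
    by (intro tendsto_intros)
  then have "Lim (at z) (\<lambda>w. (g w - g z) / (w - z)) = C * (\<pi> ^ q * ll.r 1 \<theta>)"
    by (intro tendsto_Lim at_neq_bot) (simp add: g_eq_gsum C_def right_diff_distrib)
  moreover have "\<pi> ^ q = \<pi> ^ (q - 1) * \<pi>"
    by simp
  ultimately show ?thesis
    using pi_nonzero by (simp add: D1_def C_def del: power_q_minus_Suc_0 power_q_minus_Suc_0')
qed

lemma h_eq: "h z = ll.hk 0 \<theta>"
  unfolding h_def D1_g_eq E_eq g_eq by (simp add: ll.hk_def bracket_def algebra_simps)

lemma Delta_eq: "\<Delta> z = ll.dc"
  unfolding \<Delta>_def h_eq ll.hk_power by simp

lemma L_Suc: "L (Suc k) = bracket (Suc k) * L k"
  by (simp add: L_def mult.commute)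

text \<open>\<open>hk_Suc\<close> at t = \<theta>, multiplied by (-1)^k L(k+1), is the recursion of
  \<open>x\<close>; its factor [k+1] is what turns L(k) into L(k+1). The start k = 1 holds since the
  definition of h makes \<open>x 1\<close> equal to \<open>D1 g\<close>.\<close>

theorem x_eq: "x k z = (- 1) ^ k * L k * ll.r k \<theta>"
proof -
  have "x k z = (- 1) ^ k * L k * ll.r k \<theta> \<and> x (Suc k) z = (- 1) ^ Suc k * L (Suc k) * ll.r (Suc k) \<theta>"
  proof (induction k)
    case 0
    have "x (Suc 0) z = D1 g z"
      by (simp add: h_def)
    then show ?case
      by (simp add: E_eq D1_g_eq L_def)
  next
    case (Suc k)
    have "ll.r (Suc k) \<theta> * ll.gc ^ (q ^ Suc k) + bracket (Suc (Suc k)) * ll.r (Suc (Suc k)) \<theta> = - (ll.dc ^ (q ^ k)) * ll.r k \<theta>"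
      using ll.hk_Suc[OF theta_le, of k] by (simp add: ll.hk_def bracket_def algebra_simps)
    then have r: "bracket (Suc (Suc k)) * ll.r (Suc (Suc k)) \<theta> = - (ll.dc ^ (q ^ k)) * ll.r k \<theta> - ll.r (Suc k) \<theta> * ll.gc ^ (q ^ Suc k)"
      by (simp add: algebra_simps)
    have "x (Suc (Suc k)) z = (- 1) ^ Suc k * L (Suc k) * ll.r (Suc k) \<theta> * ll.gc ^ (q ^ Suc k)
        - bracket (Suc k) * ((- 1) ^ k * L k * ll.r k \<theta>) * ll.dc ^ (q ^ k)"
      using Suc by (simp add: g_eq Delta_eq)
    also have "\<dots> = (- 1) ^ Suc (Suc k) * L (Suc k) * (bracket (Suc (Suc k)) * ll.r (Suc (Suc k)) \<theta>)"
      unfolding r by (simp add: L_Suc algebra_simps)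
    also have "\<dots> = (- 1) ^ Suc (Suc k) * L (Suc (Suc k)) * ll.r (Suc (Suc k)) \<theta>"
      by (simp only: L_Suc[of "Suc k"] mult_ac)
    finally show ?case
      using Suc by blast
  qed
  then show ?thesis by blast
qed

end

subsection \<open>Power series with geometrically bounded coefficients\<close>

text \<open>With no constant in front of M^i, one M serves for sums, products and inverses of series
  with constant term 1.\<close>

definition fps_bounded :: "real \<Rightarrow> 'a::nonarch_field fps \<Rightarrow> bool" where
  "fps_bounded M F \<longleftrightarrow> (\<forall>i. absv (fps_nth F i) \<le> M ^ i)"

definition fps_ev :: "'a::nonarch_field fps \<Rightarrow> 'a \<Rightarrow> 'a" where
  "fps_ev F v = (\<Sum>i. fps_nth F i * v ^ i)"

lemma fps_bounded_add: "0 \<le> M \<Longrightarrow> fps_bounded M F \<Longrightarrow> fps_bounded M G \<Longrightarrow> fps_bounded M (F + G)"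
  by (auto simp: fps_bounded_def intro: absv_add_le)

lemma fps_bounded_mult:
  assumes "0 \<le> M" "fps_bounded M F" "fps_bounded M G"
  shows "fps_bounded M (F * G)"
  unfolding fps_bounded_def
proof
  fix n
  have "absv (fps_nth F i * fps_nth G (n - i)) \<le> M ^ n" if "i \<in> {0..n}" for i
  proof -
    have "absv (fps_nth F i) * absv (fps_nth G (n - i)) \<le> M ^ i * M ^ (n - i)"
      using assms by (intro mult_mono) (auto simp: fps_bounded_def absv_nonneg)
    then show ?thesis
      using that by (simp add: absv_mult flip: power_add)
  qed
  then show "absv (fps_nth (F * G) n) \<le> M ^ n"
    unfolding fps_mult_nth using assms(1) by (intro absv_sum_le) auto
qed

lemma fps_bounded_1: "0 \<le> M \<Longrightarrow> fps_bounded M 1"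
  by (simp add: fps_bounded_def)

lemma fps_bounded_power: "0 \<le> M \<Longrightarrow> fps_bounded M F \<Longrightarrow> fps_bounded M (F ^ n)"
  by (induction n) (simp_all add: fps_bounded_1 fps_bounded_mult)

lemma fps_bounded_monom:
  assumes "0 \<le> M" "absv c \<le> M ^ m"
  shows "fps_bounded M (fps_const c * fps_X ^ m)"
  using assms by (auto simp: fps_bounded_def)

lemma fps_bounded_inverse:
  fixes F :: "'a::nonarch_field fps"
  assumes "0 \<le> M" "fps_bounded M F" "fps_nth F 0 = 1"
  shows "fps_bounded M (inverse F)"
proof -
  have "F * inverse F = 1"
    using assms(3) by (simp add: inverse_mult_eq_1')
  have "absv (fps_nth (inverse F) n) \<le> M ^ n" for n
  proof (induction n rule: less_induct)
    case (less n)
    show ?case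
    proof (cases "n = 0")
      case False
      have "0 = fps_nth (F * inverse F) n"
        using False by (simp add: \<open>F * inverse F = 1\<close>)
      also have "\<dots> = fps_nth (inverse F) n + (\<Sum>i = 1..n. fps_nth F i * fps_nth (inverse F) (n - i))"
        using assms(3) by (simp add: fps_mult_nth sum.atLeast_Suc_atMost)
      finally have "fps_nth (inverse F) n = - (\<Sum>i = 1..n. fps_nth F i * fps_nth (inverse F) (n - i))"
        by (simp add: eq_neg_iff_add_eq_0)
      also have "absv \<dots> \<le> M ^ n"
        unfolding absv_minus
      proof (rule absv_sum_le)
        fix i assume i: "i \<in> {1..n}"
        have "absv (fps_nth F i) * absv (fps_nth (inverse F) (n - i)) \<le> M ^ i * M ^ (n - i)"
          using assms less[of "n - i"] i by (intro mult_mono) (auto simp: fps_bounded_def absv_nonneg)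
        then show "absv (fps_nth F i * fps_nth (inverse F) (n - i)) \<le> M ^ n"
          using i by (simp add: absv_mult flip: power_add)
      qed (use assms in simp)
      finally show ?thesis .
    qed (use assms in simp)
  qed
  then show ?thesis
    by (simp add: fps_bounded_def)
qed

lemma absv_fps_term_le:
  assumes "fps_bounded M F"
  shows "absv (fps_nth F i * v ^ i) \<le> (M * absv v) ^ i"
  using assms by (auto simp: fps_bounded_def absv_mult absv_power power_mult_distrib absv_nonneg intro: mult_right_mono)

lemma fps_bounded_nonneg: "fps_bounded M F \<Longrightarrow> 0 \<le> M"
  using absv_nonneg[of "fps_nth F 1"] unfolding fps_bounded_def by (metis order_trans power_one_right)

lemma sums_fps_ev:
  fixes F :: "'a::{nonarch_field,complete_space} fps"
  assumes "fps_bounded M F" "M * absv v < 1"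
  shows "(\<lambda>i. fps_nth F i * v ^ i) sums fps_ev F v"
  unfolding fps_ev_def
proof (intro summable_sums summable_nonarch)
  have "(\<lambda>i. absv (fps_nth F i * v ^ i)) \<longlonglongrightarrow> 0"
  proof (rule tendsto_sandwich[OF _ _ tendsto_const])
    show "\<forall>\<^sub>F i in sequentially. absv (fps_nth F i * v ^ i) \<le> (M * absv v) ^ i"
      using absv_fps_term_le[OF assms(1)] by (intro always_eventually allI)
    show "(\<lambda>i. (M * absv v) ^ i) \<longlonglongrightarrow> 0"
      using assms fps_bounded_nonneg[OF assms(1)] absv_nonneg[of v]
      by (intro LIMSEQ_power_zero) simp
  qed (simp add: absv_nonneg)
  then show "(\<lambda>i. fps_nth F i * v ^ i) \<longlonglongrightarrow> 0"
    by (simp add: tendsto_absv_iff[of _ 0])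
qed

lemma fps_ev_add:
  fixes F :: "'a::{nonarch_field,complete_space} fps"
  assumes "fps_bounded M F" "fps_bounded M G" "M * absv v < 1"
  shows "fps_ev (F + G) v = fps_ev F v + fps_ev G v"
proof (rule sums_unique2[OF sums_fps_ev])
  show "(\<lambda>i. fps_nth (F + G) i * v ^ i) sums (fps_ev F v + fps_ev G v)"
    using sums_add[OF sums_fps_ev[OF assms(1,3)] sums_fps_ev[OF assms(2,3)]]
    by (simp add: distrib_right)
qed (use assms fps_bounded_add fps_bounded_nonneg in blast)+

text \<open>The product of two partial sums and the partial sum of the product differ by terms with
  i + j at least n, each of size at most s^n, so the number of these terms does not matter.\<close>

lemma fps_ev_mult:
  fixes F :: "'a::{nonarch_field,complete_space} fps"
  assumes F: "fps_bounded M F" and G: "fps_bounded M G" and v: "M * absv v < 1"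
  shows "fps_ev (F * G) v = fps_ev F v * fps_ev G v"
proof -
  note M = fps_bounded_nonneg[OF F]
  define s where "s = M * absv v"
  have s: "0 \<le> s" "s < 1"
    using M v absv_nonneg[of v] by (simp_all add: s_def)
  define f where "f i = fps_nth F i * v ^ i" for i
  define k where "k i = fps_nth G i * v ^ i" for i
  have le: "absv (f i) \<le> s ^ i" "absv (k i) \<le> s ^ i" for i
    using absv_fps_term_le[OF F] absv_fps_term_le[OF G] by (simp_all add: f_def k_def s_def)
  have nth: "fps_nth (F * G) m * v ^ m = (\<Sum>i\<le>m. f i * k (m - i))" for m
    unfolding fps_mult_nth sum_distrib_right atLeast0AtMost
    by (intro sum.cong) (auto simp: f_def k_def mult_ac simp flip: power_add)
  have "(\<Sum>m<n. fps_nth (F * G) m * v ^ m) = (\<Sum>(i, j)\<in>{(i, j). i + j < n}. f i * k j)" for n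
    unfolding nth by (rule sum.triangle_reindex[symmetric])
  moreover have "(\<Sum>i<n. f i) * (\<Sum>j<n. k j) = (\<Sum>(i, j)\<in>{..<n} \<times> {..<n}. f i * k j)" for n
    by (simp add: sum_product sum.cartesian_product)
  moreover have "(\<Sum>(i, j)\<in>{..<n} \<times> {..<n}. f i * k j) - (\<Sum>(i, j)\<in>{(i, j). i + j < n}. f i * k j)
      = (\<Sum>(i, j)\<in>{..<n} \<times> {..<n} - {(i, j). i + j < n}. f i * k j)" for n
    by (subst sum_diff) auto
  moreover have "absv (\<Sum>(i, j)\<in>{..<n} \<times> {..<n} - {(i, j). i + j < n}. f i * k j) \<le> s ^ n" for n
  proof (rule absv_sum_le)
    fix y assume "y \<in> {..<n} \<times> {..<n} - {(i, j). i + j < n}"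
    then obtain i j where y: "y = (i, j)" "n \<le> i + j"
      by (cases y) auto
    have "absv (f i) * absv (k j) \<le> s ^ i * s ^ j"
      using le s by (intro mult_mono) (auto simp: absv_nonneg)
    also have "\<dots> \<le> s ^ n"
      using s y unfolding power_add[symmetric] by (intro power_decreasing) auto
    finally show "absv (case y of (i, j) \<Rightarrow> f i * k j) \<le> s ^ n"
      by (simp add: y absv_mult)
  qed (use s in simp)
  ultimately have diff: "absv ((\<Sum>i<n. f i) * (\<Sum>j<n. k j) - (\<Sum>m<n. fps_nth (F * G) m * v ^ m)) \<le> s ^ n" for n
    by simp
  have sums: "(\<lambda>m. fps_nth (F * G) m * v ^ m) sums fps_ev (F * G) v" "f sums fps_ev F v" "k sums fps_ev G v"
    unfolding f_def k_def by (intro sums_fps_ev[OF _ v] fps_bounded_mult M F G)+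
  have "(\<lambda>n. (\<Sum>i<n. f i) * (\<Sum>j<n. k j) - (\<Sum>m<n. fps_nth (F * G) m * v ^ m)) \<longlonglongrightarrow> 0"
    unfolding tendsto_absv_iff
  proof (rule tendsto_sandwich[OF _ _ tendsto_const])
    show "\<forall>\<^sub>F n in sequentially. absv ((\<Sum>i<n. f i) * (\<Sum>j<n. k j) - (\<Sum>m<n. fps_nth (F * G) m * v ^ m) - 0) \<le> s ^ n"
      using diff by simp
    show "(\<lambda>n. s ^ n) \<longlonglongrightarrow> 0"
      using s by (intro LIMSEQ_power_zero) simp
  qed (simp add: absv_nonneg)
  moreover have "(\<lambda>n. (\<Sum>i<n. f i) * (\<Sum>j<n. k j) - (\<Sum>m<n. fps_nth (F * G) m * v ^ m))
      \<longlonglongrightarrow> fps_ev F v * fps_ev G v - fps_ev (F * G) v"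
    using sums unfolding sums_def by (intro tendsto_diff tendsto_mult)
  ultimately have "fps_ev F v * fps_ev G v - fps_ev (F * G) v = 0"
    using LIMSEQ_unique by blast
  then show ?thesis
    by simp
qed

lemma fps_ev_monom: "fps_ev (fps_const c * fps_X ^ m) v = (c * v ^ m :: 'a::nonarch_field)"
proof -
  have "(\<lambda>i. fps_nth (fps_const c * fps_X ^ m) i * v ^ i) = (\<lambda>i. if i = m then c * v ^ m else 0)"
    by (auto simp: fun_eq_iff)
  then show ?thesis
    unfolding fps_ev_def using sums_single[of m "\<lambda>_. c * v ^ m"] by (simp add: sums_iff)
qed

lemma fps_ev_1 [simp]: "fps_ev 1 v = (1 :: 'a::nonarch_field)"
  using fps_ev_monom[of 1 0 v] by simp

lemma fps_ev_power:
  fixes F :: "'a::{nonarch_field,complete_space} fps"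
  assumes "fps_bounded M F" "M * absv v < 1"
  shows "fps_ev (F ^ n) v = fps_ev F v ^ n"
proof (induction n)
  case (Suc n)
  then show ?case
    using fps_ev_mult[OF assms(1) fps_bounded_power[OF fps_bounded_nonneg[OF assms(1)] assms(1), of n] assms(2)] by simp
qed simp

text \<open>Zeros are isolated: convergence at one point v1 bounds the coefficients, and for v much
  closer to 0 the lowest nonzero term exceeds all later ones.\<close>

lemma fps_eq_0_of_small_zeros:
  fixes F :: "'a::{nonarch_field,complete_space} fps"
  assumes z: "\<And>s. s > 0 \<Longrightarrow> \<exists>v. v \<noteq> 0 \<and> absv v < s \<and> (\<lambda>i. fps_nth F i * v ^ i) sums 0"
  shows "F = 0"
proof (rule ccontr)
  assume "F \<noteq> 0"
  define n where "n = subdegree F"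
  have n: "fps_nth F n \<noteq> 0" "\<And>i. i < n \<Longrightarrow> fps_nth F i = 0"
    using \<open>F \<noteq> 0\<close> by (auto simp: n_def)
  obtain v1 where v1: "v1 \<noteq> 0" "(\<lambda>i. fps_nth F i * v1 ^ i) sums 0"
    using z[of 1] by auto
  have "(\<lambda>m. (\<Sum>i<Suc m. fps_nth F i * v1 ^ i) - (\<Sum>i<m. fps_nth F i * v1 ^ i)) \<longlonglongrightarrow> 0 - 0"
    using v1(2) unfolding sums_def by (intro tendsto_diff LIMSEQ_Suc)
  then have lim: "(\<lambda>m. absv (fps_nth F m * v1 ^ m)) \<longlonglongrightarrow> 0"
    by (simp add: tendsto_absv_iff[of _ 0])
  obtain C where C: "C > 0" "\<And>m. norm (absv (fps_nth F m * v1 ^ m)) \<le> C"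
    using convergent_imp_Bseq[OF convergentI[OF lim]] unfolding Bseq_def by blast
  \<comment> \<open>The first entry gives t \<le> 1 for t = |v| / |v1|; the second one makes the
    lowest term larger than the bound C t^(n+1) for the others.\<close>
  define s where "s = min (absv v1) (absv (fps_nth F n) * absv v1 ^ Suc n / C)"
  have "s > 0"
    using C n v1 by (auto simp: s_def intro!: divide_pos_pos mult_pos_pos zero_less_power)
  then obtain v where v: "v \<noteq> 0" "absv v < s" "(\<lambda>i. fps_nth F i * v ^ i) sums 0"
    using z by blast
  define t where "t = absv v / absv v1"
  have t: "0 \<le> t" "t \<le> 1"
    using v v1 by (auto simp: t_def s_def absv_nonneg divide_le_eq_1)
  have "(\<lambda>i. fps_nth F i * v ^ i - (if i = n then fps_nth F n * v ^ n else 0)) sums (0 - fps_nth F n * v ^ n)"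
    by (intro sums_diff_nonarch v sums_single)
  then have "absv (0 - fps_nth F n * v ^ n) \<le> C * t ^ Suc n"
  proof (rule absv_sums_le)
    fix i
    show "absv (fps_nth F i * v ^ i - (if i = n then fps_nth F n * v ^ n else 0)) \<le> C * t ^ Suc n"
    proof (cases "n < i")
      case True
      have "absv (fps_nth F i * v ^ i) = absv (fps_nth F i * v1 ^ i) * t ^ i"
        using v1 by (simp add: absv_mult absv_power t_def power_divide)
      also have "\<dots> \<le> C * t ^ i"
        using C(2)[of i] t by (intro mult_right_mono) auto
      also have "\<dots> \<le> C * t ^ Suc n"
        using True C t by (intro mult_left_mono power_decreasing) auto
      finally show ?thesis
        using True by simp
    next
      case False
      then have "fps_nth F i * v ^ i - (if i = n then fps_nth F n * v ^ n else 0) = 0"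
        using n(2)[of i] by auto
      then show ?thesis
        using C t by simp
    qed
  qed
  then have "absv (fps_nth F n) * absv v ^ n \<le> C * t * t ^ n"
    by (simp add: absv_mult absv_power mult_ac)
  also have "\<dots> = (C * t / absv v1 ^ n) * absv v ^ n"
    by (simp add: t_def power_divide)
  finally have "absv (fps_nth F n) \<le> C * t / absv v1 ^ n"
    by (rule mult_right_le_imp_le) (simp add: v(1))
  then have "absv (fps_nth F n) * absv v1 ^ Suc n \<le> C * absv v"
    using v1 by (simp add: t_def field_simps)
  moreover have "C * absv v < absv (fps_nth F n) * absv v1 ^ Suc n"
    using v(2) C by (simp add: s_def less_divide_eq mult.commute)
  ultimately show False
    by simp
qed

section \<open>Expansions of u(a z) in powers of u\<close>

lemma (in good_point) q_absv_u_less_1: "real q * absv (u z) < 1"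
proof -
  have "real q \<le> real q ^ 2"
    using q_ge_2 by (intro self_le_power) auto
  then have "real q < absv (carlitz_exp (\<pi> * z))"
    using large by linarith
  then show ?thesis
    using q_ge_2 by (simp add: u_def absv_divide divide_less_eq)
qed

context drinfeld_setting
begin

lemma ex_good_radius: "\<exists>s>0. \<forall>z\<in>\<Omega>. absv (u z) < s \<longrightarrow> good_point p e q \<iota> \<pi> z"
proof -
  obtain C where C: "C > 0" "\<And>w. absv w \<le> absv \<pi> \<Longrightarrow> absv (carlitz_exp w) \<le> C"
    using carlitz_exp_bounded[of "absv \<pi>"] absv_nonneg[of \<pi>] by blast
  define B where "B = max (real q ^ 2) C"
  have B: "B > 0"
    using C by (simp add: B_def)
  have "good_point p e q \<iota> \<pi> z" if z: "z \<in> \<Omega>" "absv (u z) < 1 / B" for z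
  proof -
    \<comment> \<open>This is where z in \<Omega> matters: at z in the polynomial ring the
      convention 1 / 0 = 0 would make \<open>u z\<close> small.\<close>
    have "carlitz_exp (\<pi> * z) \<noteq> 0"
    proof
      assume "carlitz_exp (\<pi> * z) = 0"
      then obtain a where "\<pi> * z = \<pi> * of_A a"
        by (auto simp: carlitz_exp_eq_0_iff \<Lambda>_def)
      then have "z = of_A a"
        using pi_nonzero by simp
      then show False
        using z(1) of_A_in_Kinf[of a] by (simp add: \<Omega>_def)
    qed
    then have "B < absv (carlitz_exp (\<pi> * z))"
      using z(2) B by (simp add: u_def absv_divide field_simps)
    then show ?thesis
      using C(2) by unfold_locales (auto simp: B_def intro: le_less_trans)
  qed
  then show ?thesis
    using B by (intro exI[of _ "1 / B"]) auto
qed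

text \<open>R is the reversed Carlitz polynomial of a. In the step, multiplication by u^N with N =
  q^(n+1) turns the q-th power into R^q and leaves positive powers of u in the two other summands,
  so the constant term stays 1. The bound q is the size of \<theta>.\<close>

lemma reciprocal_expansion:
  assumes "lead_coeff a = 1"
  shows "\<exists>R. fps_bounded (real q) R \<and> fps_nth R 0 = 1 \<and>
    (\<forall>z. good_point p e q \<iota> \<pi> z \<longrightarrow> carlitz_exp (\<pi> * (of_A a * z)) * u z ^ (q ^ degree a) = fps_ev R (u z))"
  using assms
proof (induction a)
  case (pCons c a)
  show ?case
  proof (cases "a = 0")
    case True
    then have "c = 1"
      using pCons.prems by simp
    moreover have "carlitz_exp (\<pi> * z) * u z = 1" if "good_point p e q \<iota> \<pi> z" for z
    proof -
      interpret good_point p e q \<iota> \<pi> z by fact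
      show ?thesis
        using lam_nonzero[of 1] by (simp add: lam_1 u_def)
    qed
    ultimately show ?thesis
      using True by (intro exI[of _ 1]) (simp add: fps_bounded_1 of_A_pCons of_Kinf_1)
  next
    case False
    define n where "n = degree a"
    obtain R where R: "fps_bounded (real q) R" "fps_nth R 0 = 1"
      "\<And>z. good_point p e q \<iota> \<pi> z \<Longrightarrow> carlitz_exp (\<pi> * (of_A a * z)) * u z ^ (q ^ n) = fps_ev R (u z)"
      using pCons False by (auto simp: n_def)
    define N where "N = q ^ Suc n"
    have "q ^ n < N"
      unfolding N_def using q_ge_2 by (intro power_strict_increasing) auto
    then have N: "0 < N - 1" "0 < N - q ^ n" "N - 1 + 1 = N" "N - q ^ n + q ^ n = N"
      using q_pos(4)[of n] by linarith+
    define P1 where "P1 = fps_const (\<kappa> c) * fps_X ^ (N - 1)"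
    define P2 where "P2 = fps_const \<theta> * fps_X ^ (N - q ^ n)"
    have "1 \<le> real q"
      using q_ge_2 by simp
    have b: "fps_bounded (real q) P1" "fps_bounded (real q) P2" "fps_bounded (real q) (P2 * R)" "fps_bounded (real q) (R ^ q)"
    proof -
      show "fps_bounded (real q) P1"
        unfolding P1_def using absv_kappa_le[of c] one_le_power[OF \<open>1 \<le> real q\<close>, of "N - 1"]
        by (intro fps_bounded_monom) linarith+
      show P2: "fps_bounded (real q) P2"
        unfolding P2_def using self_le_power[OF \<open>1 \<le> real q\<close> N(2)]
        by (intro fps_bounded_monom) (simp_all add: absv_theta)
      show "fps_bounded (real q) (P2 * R)" "fps_bounded (real q) (R ^ q)"
        by (intro fps_bounded_mult fps_bounded_power P2 R; simp)+
    qed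
    have "carlitz_exp (\<pi> * (of_A (pCons c a) * z)) * u z ^ N = fps_ev (P1 + (P2 * R + R ^ q)) (u z)"
      if "good_point p e q \<iota> \<pi> z" for z
    proof -
      interpret good_point p e q \<iota> \<pi> z by fact
      have v: "real q * absv (u z) < 1"
        by (rule q_absv_u_less_1)
      have v1: "lam 1 * u z = 1"
        using lam_nonzero[of 1] by (simp add: lam_1 u_def)
      have "lam (pCons c a) = \<kappa> c * lam 1 + (\<theta> * lam a + lam a ^ q)"
        using lam_add[of "[:c:]" "pCons 0 a"] lam_smult[of c 1] by (simp add: lam_pCons_0)
      then have "lam (pCons c a) * u z ^ N = \<kappa> c * (lam 1 * u z ^ N) + \<theta> * (lam a * u z ^ N) + lam a ^ q * u z ^ N"
        by (simp add: algebra_simps)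
      also have "lam 1 * u z ^ N = u z ^ (N - 1)"
      proof -
        have "u z ^ N = u z ^ (N - 1) * u z"
          using N(3) by (metis power_add power_one_right)
        then show ?thesis
          using v1 by (simp add: mult.left_commute)
      qed
      also have "lam a * u z ^ N = u z ^ (N - q ^ n) * fps_ev R (u z)"
      proof -
        have "u z ^ N = u z ^ (N - q ^ n) * u z ^ (q ^ n)"
          using N(4) by (metis power_add)
        then show ?thesis
          using R(3)[OF that] by (simp add: lam_def mult.left_commute)
      qed
      also have "lam a ^ q * u z ^ N = fps_ev R (u z) ^ q"
        unfolding R(3)[OF that, symmetric] by (simp add: lam_def N_def power_mult_distrib mult.commute flip: power_mult)
      also have "\<kappa> c * u z ^ (N - 1) + \<theta> * (u z ^ (N - q ^ n) * fps_ev R (u z)) + fps_ev R (u z) ^ q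
          = fps_ev P1 (u z) + (fps_ev P2 (u z) * fps_ev R (u z) + fps_ev (R ^ q) (u z))"
        unfolding P1_def P2_def fps_ev_monom fps_ev_power[OF R(1) v] by (simp add: mult.assoc)
      also have "\<dots> = fps_ev (P1 + (P2 * R + R ^ q)) (u z)"
        using fps_ev_add[OF b(1) fps_bounded_add[OF _ b(3,4)] v] fps_ev_add[OF b(3,4) v] fps_ev_mult[OF b(2) R(1) v]
        by simp
      finally show ?thesis
        by (simp add: lam_def)
    qed
    moreover have "fps_nth (P1 + (P2 * R + R ^ q)) 0 = 1"
      using N(1,2) by (simp add: P1_def P2_def R(2) fps_power_zeroth zero_power)
    moreover have "fps_bounded (real q) (P1 + (P2 * R + R ^ q))"
      by (intro fps_bounded_add b) auto
    ultimately show ?thesis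
      using False unfolding N_def n_def by (intro exI[of _ "P1 + (P2 * R + R ^ q)"]) auto
  qed
qed simp

lemma ua_expansion:
  assumes "lead_coeff a = 1"
  shows "\<exists>S. fps_bounded (real q) S \<and> fps_nth S 0 = 1 \<and>
    (\<forall>z. good_point p e q \<iota> \<pi> z \<longrightarrow> 1 / carlitz_exp (\<pi> * (of_A a * z)) = u z ^ (q ^ degree a) * fps_ev S (u z))"
proof -
  obtain R where R: "fps_bounded (real q) R" "fps_nth R 0 = 1"
    "\<And>z. good_point p e q \<iota> \<pi> z \<Longrightarrow> carlitz_exp (\<pi> * (of_A a * z)) * u z ^ (q ^ degree a) = fps_ev R (u z)"
    using reciprocal_expansion[OF assms] by blast
  have S: "fps_bounded (real q) (inverse R)"
    by (rule fps_bounded_inverse[OF _ R(1,2)]) simp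
  have "1 / carlitz_exp (\<pi> * (of_A a * z)) = u z ^ (q ^ degree a) * fps_ev (inverse R) (u z)"
    if "good_point p e q \<iota> \<pi> z" for z
  proof -
    interpret good_point p e q \<iota> \<pi> z by fact
    have v: "real q * absv (u z) < 1"
      by (rule q_absv_u_less_1)
    have "a \<noteq> 0"
      using assms by auto
    have "fps_ev R (u z) * fps_ev (inverse R) (u z) = 1"
      using fps_ev_mult[OF R(1) S v] R(2) by (simp add: inverse_mult_eq_1')
    then have "lam a * (u z ^ (q ^ degree a) * fps_ev (inverse R) (u z)) = 1"
      unfolding R(3)[OF that, symmetric] by (simp add: lam_def mult.assoc)
    then have "u z ^ (q ^ degree a) * fps_ev (inverse R) (u z) = 1 / lam a"
      using lam_nonzero[OF \<open>a \<noteq> 0\<close>] by (metis nonzero_eq_divide_eq mult.commute)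
    then show ?thesis
      by (simp only: lam_def)
  qed
  moreover have "fps_nth (inverse R) 0 = 1"
    using R(2) by simp
  ultimately show ?thesis
    using S by blast
qed

end

subsection \<open>The expansions\<close>

context drinfeld_setting
begin

text \<open>Interchanges the sum over a with the sum over powers of u, which is legitimate because
  the double family is summable. The series F is chosen independently of z.\<close>

lemma sum_expansion:
  "\<exists>F. (\<forall>i<q ^ k. fps_nth F i = 0) \<and> fps_nth F (q ^ k) = 1 \<and>
    (\<forall>z t. good_point p e q \<iota> \<pi> z \<longrightarrow>
      ((\<lambda>a. of_A a / carlitz_exp (\<pi> * (of_A a * z)) ^ (q ^ k)) has_sum t) monic \<longrightarrow>
      (\<lambda>i. fps_nth F i * u z ^ i) sums t)"
proof -
  have "\<forall>a\<in>monic. \<exists>S. fps_bounded (real q) S \<and> fps_nth S 0 = 1 \<and>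
      (\<forall>z. good_point p e q \<iota> \<pi> z \<longrightarrow> 1 / carlitz_exp (\<pi> * (of_A a * z)) = u z ^ (q ^ degree a) * fps_ev S (u z))"
    using ua_expansion by (auto simp: monic_def)
  from bchoice[OF this] obtain S where S: "\<forall>a\<in>monic. fps_bounded (real q) (S a) \<and> fps_nth (S a) 0 = 1 \<and>
      (\<forall>z. good_point p e q \<iota> \<pi> z \<longrightarrow> 1 / carlitz_exp (\<pi> * (of_A a * z)) = u z ^ (q ^ degree a) * fps_ev (S a) (u z))"
    by (rule exE)
  define m where "m a = q ^ (k + degree a)" for a :: "'f poly"
  define W where "W a = fps_X ^ m a * S a ^ (q ^ k)" for a
  have W_bounded: "fps_bounded (real q) (W a)" if "a \<in> monic" for a
  proof -
    have "fps_bounded (real q) (fps_const 1 * fps_X ^ m a)"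
      using q_ge_2 by (intro fps_bounded_monom) (simp_all add: one_le_power)
    moreover have "fps_bounded (real q) (S a ^ (q ^ k))"
      using S that by (intro fps_bounded_power) auto
    ultimately have "fps_bounded (real q) (fps_const 1 * fps_X ^ m a * S a ^ (q ^ k))"
      by (rule fps_bounded_mult[rotated]) simp
    then show ?thesis
      by (simp add: W_def)
  qed
  have W_nth: "fps_nth (W a) i = (if i < m a then 0 else fps_nth (S a ^ (q ^ k)) (i - m a))" for a i
    by (simp add: W_def fps_X_power_mult_nth)
  have deg_less_m: "degree a < m a" "real q ^ degree a \<le> real (m a)" for a
  proof -
    have "q ^ degree a \<le> m a"
      unfolding m_def using q_ge_2 by (intro power_increasing) auto
    then show "degree a < m a" "real q ^ degree a \<le> real (m a)"
      using le_q_power_minus_1[of "degree a"] q_pos(3)[of "degree a"]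
      by (linarith, metis of_nat_le_iff of_nat_power)
  qed
  \<comment> \<open>The series \<open>W a\<close> starts at u^(m a) with m a > degree a, so
    \<open>deg_less i\<close> contains every a that contributes to u^i and the coefficient is a
    finite sum.\<close>
  define F where "F = Abs_fps (\<lambda>i. \<Sum>a\<in>monic \<inter> deg_less i. of_A a * fps_nth (W a) i)"
  have "fps_nth F i = 0" if "i < q ^ k" for i
  proof -
    have "i < m a" for a
    proof -
      have "q ^ k \<le> m a"
        unfolding m_def using q_ge_2 by (intro power_increasing) auto
      then show ?thesis
        using that by linarith
    qed
    then show ?thesis
      by (simp add: F_def W_nth)
  qed
  moreover have "fps_nth F (q ^ k) = 1"
  proof -
    have one: "1 \<in> monic \<inter> deg_less (q ^ k)"
      by (simp add: monic_def deg_less_iff)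
    have "fps_nth (W a) (q ^ k) = 0" if a: "a \<in> monic" "a \<noteq> 1" for a
    proof -
      have "degree a \<noteq> 0"
      proof
        assume "degree a = 0"
        then obtain c where "a = [:c:]"
          by (rule degree_eq_zeroE)
        then show False
          using a by (simp add: monic_def one_pCons)
      qed
      then have "q ^ k < m a"
        unfolding m_def using q_ge_2 by (intro power_strict_increasing) auto
      then show ?thesis
        by (simp add: W_nth)
    qed
    moreover have "fps_nth (W 1) (q ^ k) = 1"
      using S by (simp add: W_nth m_def monic_def fps_power_zeroth)
    ultimately have "(\<Sum>a\<in>monic \<inter> deg_less (q ^ k). of_A a * fps_nth (W a) (q ^ k)) = (\<Sum>a\<in>{1}. of_A a * fps_nth (W a) (q ^ k))"
      using one by (intro sum.mono_neutral_right) auto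
    then show ?thesis
      using \<open>fps_nth (W 1) (q ^ k) = 1\<close> by (simp add: F_def)
  qed
  moreover have "(\<lambda>i. fps_nth F i * u z ^ i) sums t"
    if z: "good_point p e q \<iota> \<pi> z"
      and t: "((\<lambda>a. of_A a / carlitz_exp (\<pi> * (of_A a * z)) ^ (q ^ k)) has_sum t) monic" for z t
  proof -
    interpret good_point p e q \<iota> \<pi> z by (rule z)
    define v where "v = u z"
    define s where "s = real q * absv v"
    have s: "0 \<le> s" "s < 1"
      using q_absv_u_less_1 absv_nonneg[of v] by (simp_all add: s_def v_def)
    have ev_eq: "of_A a / carlitz_exp (\<pi> * (of_A a * z)) ^ (q ^ k) = of_A a * fps_ev (W a) v" if a: "a \<in> monic" for a
    proof -
      have S': "fps_bounded (real q) (S a)" "1 / carlitz_exp (\<pi> * (of_A a * z)) = v ^ (q ^ degree a) * fps_ev (S a) v"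
        using S a z by (auto simp: v_def)
      have v: "real q * absv v < 1"
        using s by (simp add: s_def)
      have X: "fps_bounded (real q) (fps_const 1 * fps_X ^ m a)"
        using q_ge_2 by (intro fps_bounded_monom) (simp_all add: one_le_power)
      have "fps_ev (W a) v = v ^ m a * fps_ev (S a) v ^ (q ^ k)"
        using fps_ev_mult[OF X fps_bounded_power[OF _ S'(1)] v] fps_ev_monom[of 1 "m a" v] fps_ev_power[OF S'(1) v]
        by (simp add: W_def)
      also have "\<dots> = (1 / carlitz_exp (\<pi> * (of_A a * z))) ^ (q ^ k)"
        unfolding S'(2) by (simp add: power_mult_distrib m_def power_add mult.commute flip: power_mult)
      finally show ?thesis
        by (simp add: power_one_over)
    qed
    define c where "c a i = of_A a * fps_nth (W a) i * v ^ i" for a i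
    have c_zero: "c a i = 0" if "\<not> degree a < i" for a i
      using that deg_less_m(1)[of a] by (simp add: c_def W_nth)
    \<comment> \<open>Wherever the coefficient is nonzero, |a| = q^(degree a) \<le> m a \<le> i;
      this replaces the unbounded weight by i, which the geometric factor outweighs.\<close>
    have c_le: "absv (c a i) \<le> real i * s ^ i" if a: "a \<in> monic" for a i
    proof (cases "i < m a")
      case False
      have "absv (fps_nth (W a) i * v ^ i) \<le> s ^ i"
        unfolding s_def by (rule absv_fps_term_le[OF W_bounded[OF a]])
      moreover have "absv (of_A a) \<le> real i"
        using False deg_less_m(2)[of a] a zero_notin_monic absv_of_A[of a] by (cases "a = 0") auto
      ultimately have "absv (of_A a) * absv (fps_nth (W a) i * v ^ i) \<le> real i * s ^ i"
        by (intro mult_mono) (auto simp: absv_nonneg)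
      then show ?thesis
        by (simp add: c_def absv_mult mult.assoc)
    qed (use s in \<open>simp add: c_def W_nth\<close>)
    have tail: "\<exists>N. \<forall>i. \<epsilon> \<le> real i * s ^ i \<longrightarrow> i < N" if "\<epsilon> > 0" for \<epsilon>
    proof -
      have "(\<lambda>i. real i * s ^ i) \<longlonglongrightarrow> 0"
        using s by (intro powser_times_n_limit_0) simp
      then have "\<forall>\<^sub>F i in sequentially. real i * s ^ i < \<epsilon>"
        using that by (rule order_tendstoD(2))
      then show ?thesis
        unfolding eventually_sequentially by (meson not_le)
    qed
    have "(\<lambda>(a, i). c a i) summable_on monic \<times> UNIV"
    proof (rule summable_on_nonarch)
      fix \<epsilon> :: real assume \<epsilon>: "0 < \<epsilon>"
      obtain N where N: "\<And>i. \<epsilon> \<le> real i * s ^ i \<Longrightarrow> i < N"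
        using tail[OF \<epsilon>] by blast
      have "y \<in> deg_less N \<times> {..<N}" if y: "y \<in> monic \<times> UNIV" "\<epsilon> \<le> absv (case y of (a, i) \<Rightarrow> c a i)" for y
      proof -
        obtain a i where ai: "y = (a, i)"
          by (cases y)
        have "\<epsilon> \<le> real i * s ^ i"
          using y c_le[of a i] by (simp add: ai)
        then have "i < N"
          by (rule N)
        moreover have "degree a < i"
        proof (rule ccontr)
          assume "\<not> degree a < i"
          then show False
            using y \<epsilon> by (simp add: ai c_zero)
        qed
        ultimately show ?thesis
          by (simp add: ai deg_less_iff)
      qed
      then have "{y \<in> monic \<times> UNIV. \<epsilon> \<le> absv (case y of (a, i) \<Rightarrow> c a i)} \<subseteq> deg_less N \<times> {..<N}"
        by blast
      then show "finite {y \<in> monic \<times> UNIV. \<epsilon> \<le> absv (case y of (a, i) \<Rightarrow> c a i)}"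
        by (rule finite_subset) simp
    qed
    then obtain t' where t': "((\<lambda>(a, i). c a i) has_sum t') (monic \<times> UNIV)"
      unfolding summable_on_def by blast
    have row: "(c a has_sum of_A a * fps_ev (W a) v) UNIV" if a: "a \<in> monic" for a
    proof -
      have "c a summable_on UNIV"
      proof (rule summable_on_nonarch)
        fix \<epsilon> :: real assume \<epsilon>: "0 < \<epsilon>"
        obtain N where N: "\<And>i. \<epsilon> \<le> real i * s ^ i \<Longrightarrow> i < N"
          using tail[OF \<epsilon>] by blast
        have "{i \<in> UNIV. \<epsilon> \<le> absv (c a i)} \<subseteq> {..<N}"
          using N order_trans[OF _ c_le[OF a]] by blast
        then show "finite {i \<in> UNIV. \<epsilon> \<le> absv (c a i)}"
          by (rule finite_subset) simp
      qed
      then obtain w where w: "(c a has_sum w) UNIV"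
        unfolding summable_on_def by blast
      have "c a sums (of_A a * fps_ev (W a) v)"
        using sums_cmult_nonarch[OF sums_fps_ev[OF W_bounded[OF a]], of v "of_A a"] s
        by (simp add: c_def[abs_def] s_def mult.assoc)
      then have "w = of_A a * fps_ev (W a) v"
        using has_sum_imp_sums[OF w] sums_unique2 by blast
      then show ?thesis
        using w by simp
    qed
    have "((\<lambda>a. of_A a * fps_ev (W a) v) has_sum t') monic"
      using t' row by (intro has_sum_Sigma_nonarch[where f = "\<lambda>(a, i). c a i"]) auto
    moreover have "((\<lambda>a. of_A a * fps_ev (W a) v) has_sum t) monic"
      using t by (subst (asm) has_sum_cong[OF ev_eq])
    ultimately have "t' = t"
      by (rule has_sum_unique)
    have "((\<lambda>(i, a). c a i) has_sum t) (UNIV \<times> monic)"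
      using t' unfolding \<open>t' = t\<close> by (subst has_sum_swap) simp
    moreover have "((\<lambda>a. c a i) has_sum fps_nth F i * v ^ i) monic" for i
    proof -
      have "((\<lambda>a. c a i) has_sum (\<Sum>a\<in>monic \<inter> deg_less i. c a i)) (monic \<inter> deg_less i)"
        by (intro has_sum_finite) simp
      also have "(\<Sum>a\<in>monic \<inter> deg_less i. c a i) = fps_nth F i * v ^ i"
        by (simp add: F_def c_def sum_distrib_right)
      finally show ?thesis
        using c_zero by (subst has_sum_cong_neutral[of "monic \<inter> deg_less i" monic "\<lambda>a. c a i"]) (auto simp: deg_less_iff)
    qed
    ultimately have "((\<lambda>i. fps_nth F i * v ^ i) has_sum t) UNIV"
      by (intro has_sum_Sigma_nonarch[where f = "\<lambda>(i, a). c a i" and B = "\<lambda>_. monic"]) auto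
    then show ?thesis
      unfolding v_def by (rule has_sum_imp_sums)
  qed
  ultimately show ?thesis
    by (intro exI[of _ F]) auto
qed

section \<open>Existence and uniqueness of the expansion of x_k\<close>

lemma x_expansion:
  "\<exists>F. has_u_expansion (x k) F \<and> (\<forall>i<q ^ k. fps_nth F i = 0) \<and> fps_nth F (q ^ k) = (- 1) ^ (k + 1) * L k"
proof -
  obtain F where F: "\<forall>i<q ^ k. fps_nth F i = 0" "fps_nth F (q ^ k) = 1"
    "\<And>z t. good_point p e q \<iota> \<pi> z \<Longrightarrow>
      ((\<lambda>a. of_A a / carlitz_exp (\<pi> * (of_A a * z)) ^ (q ^ k)) has_sum t) monic \<Longrightarrow>
      (\<lambda>i. fps_nth F i * u z ^ i) sums t"
    using sum_expansion[of k] by blast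
  obtain s where s: "s > 0" "\<forall>z\<in>\<Omega>. absv (u z) < s \<longrightarrow> good_point p e q \<iota> \<pi> z"
    using ex_good_radius by blast
  let ?c = "(- 1) ^ (k + 1) * L k"
  have "(\<lambda>i. fps_nth (fps_const ?c * F) i * u z ^ i) sums x k z" if z: "z \<in> \<Omega>" "absv (u z) < s" for z
  proof -
    interpret good_point p e q \<iota> \<pi> z
      using s z by blast
    have "(\<lambda>i. fps_nth F i * u z ^ i) sums (- ll.r k \<theta>)"
      using has_sum_monic_r[of k] by (intro F(3) good_point_axioms) (simp add: lam_def)
    from sums_cmult_nonarch[OF this, of ?c] show ?thesis
      by (simp add: x_eq mult.assoc)
  qed
  then show ?thesis
    using s F unfolding has_u_expansion_def by (intro exI[of _ "fps_const ?c * F"]) auto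
qed

text \<open>Take z = sqrt(\<theta>) \<theta>^n. The half-integral exponent of |z| keeps z out of
  K_\<infinity> and |\<pi> z| away from the sizes of all periods, so |carlitz_exp(\<pi> z)| \<ge>
  |\<pi> z|, which is unbounded in n. Such points are what uniqueness of expansions needs.\<close>

lemma ex_small_u:
  assumes "s > 0"
  shows "\<exists>z\<in>\<Omega>. u z \<noteq> 0 \<and> absv (u z) < s"
proof -
  obtain y :: "'f fls alg_closure" where y: "y ^ 2 = to_ac fls_X_inv"
    using nth_root_exists[of 2 "to_ac fls_X_inv"] by auto
  define z0 where "z0 = \<iota> y"
  have "z0 ^ 2 = \<theta>"
    using iota_mult[of y y] y by (simp add: z0_def \<theta>_def of_Kinf_def power2_eq_square)
  then have "absv (z0 ^ 2) = real q"
    by (simp add: absv_theta)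
  then have sq: "absv (z0 * \<theta> ^ n) ^ 2 = real q ^ (2 * n + 1)" for n
    by (simp add: absv_mult absv_power absv_theta power_mult_distrib mult.commute flip: power_mult)
  have "filterlim (\<lambda>n. absv \<pi> * real n) at_top sequentially"
    using pi_nonzero by (intro filterlim_tendsto_pos_mult_at_top[OF tendsto_const _ filterlim_real_sequentially]) simp
  then obtain n where n: "1 / s < absv \<pi> * real n"
    unfolding filterlim_at_top_dense eventually_sequentially by blast
  define z where "z = z0 * \<theta> ^ n"
  have z_sq: "absv z ^ 2 = real q powi (2 * int n + 1)"
    using sq[of n] q_ge_2 by (simp add: z_def power_int_add power_int_mult power_mult)
  have inj: "a = b" if "real q powi a = real q powi b" for a b
    using power_int_strict_increasing[of a b "real q"] power_int_strict_increasing[of b a "real q"] that q_ge_2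
    by (cases a b rule: linorder_cases) auto
  have "z \<notin> range of_Kinf"
  proof
    assume "z \<in> range of_Kinf"
    then obtain f where f: "z = of_Kinf f"
      by blast
    have "absv z ^ 2 \<noteq> 0"
      using sq[of n] q_ge_2 by (simp add: z_def)
    then have "f \<noteq> 0"
      using f by auto
    then have "absv z ^ 2 = real q powi (- 2 * fls_subdegree f)"
      using power_int_add[of "real q" "- fls_subdegree f" "- fls_subdegree f"] q_ge_2
      by (simp add: f absv_of_Kinf abs_infty_def card_f power2_eq_square)
    then have "2 * int n + 1 = - 2 * fls_subdegree f"
      unfolding z_sq by (rule inj)
    then show False
      by presburger
  qed
  then have "z \<in> \<Omega>"
    by (simp add: \<Omega>_def)
  have ne: "absv (\<pi> * z) \<noteq> absv (pl.bas m)" for m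
  proof
    have "absv (pl.bas m) = absv \<pi> * real q ^ m"
      using absv_of_A[of "monom 1 m"] by (simp add: pl.bas_def \<Lambda>_def absv_mult degree_monom_eq)
    moreover assume "absv (\<pi> * z) = absv (pl.bas m)"
    ultimately have "absv z ^ 2 = real q ^ (2 * m)"
      using pi_nonzero by (simp add: absv_mult mult.commute flip: power_mult)
    then have "real q powi (2 * int n + 1) = real q powi (2 * int m)"
      unfolding z_sq by (simp add: power_int_def nat_mult_distrib)
    then have "2 * int n + 1 = 2 * int m"
      by (rule inj)
    then show False
      by presburger
  qed
  have "absv (\<pi> * z) \<le> absv (carlitz_exp (\<pi> * z))"
    using pl.absv_en_inf_ge[OF ne] by (simp add: en_inf_eq_carlitz_exp)
  moreover have "real n \<le> absv z"
  proof -
    have "n \<le> q ^ n"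
      using le_q_power_minus_1[of n] by linarith
    then have "real n ^ 2 \<le> (real q ^ n) ^ 2"
      by (intro power_mono) (metis of_nat_le_iff of_nat_power, simp)
    also have "\<dots> \<le> real q ^ (2 * n + 1)"
      unfolding power_mult[symmetric] using q_ge_2 by (intro power_increasing) auto
    also have "\<dots> = absv z ^ 2"
      by (simp add: z_def sq)
    finally show ?thesis
      using absv_nonneg by (rule power2_le_imp_le)
  qed
  moreover define T where "T = absv (carlitz_exp (\<pi> * z))"
  ultimately have T: "1 / s < T"
    using n mult_left_mono[of "real n" "absv z" "absv \<pi>"] absv_nonneg[of \<pi>] by (simp add: absv_mult)
  moreover have "0 < 1 / s"
    using assms by simp
  ultimately have "0 < T"
    by (rule less_trans[rotated])
  then have "1 / T < s"
    using T assms by (simp only: pos_divide_less_eq mult.commute)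
  moreover have "absv (u z) = 1 / T"
    by (simp add: u_def absv_divide T_def)
  moreover have "u z \<noteq> 0"
    using \<open>0 < T\<close> by (simp add: u_def T_def)
  ultimately have "u z \<noteq> 0 \<and> absv (u z) < s"
    by simp
  then show ?thesis
    using \<open>z \<in> \<Omega>\<close> by blast
qed

lemma u_expansion_unique:
  assumes F: "has_u_expansion f F" and G: "has_u_expansion f G"
  shows "F = G"
proof -
  obtain s1 s2 where s: "s1 > 0" "s2 > 0"
    "\<And>z. z \<in> \<Omega> \<Longrightarrow> absv (u z) < s1 \<Longrightarrow> (\<lambda>i. fps_nth F i * u z ^ i) sums f z"
    "\<And>z. z \<in> \<Omega> \<Longrightarrow> absv (u z) < s2 \<Longrightarrow> (\<lambda>i. fps_nth G i * u z ^ i) sums f z"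
    using F G unfolding has_u_expansion_def by blast
  have "F - G = 0"
  proof (rule fps_eq_0_of_small_zeros)
    fix s :: real assume "s > 0"
    then obtain z where z: "z \<in> \<Omega>" "u z \<noteq> 0" "absv (u z) < min s (min s1 s2)"
      using ex_small_u[of "min s (min s1 s2)"] s by auto
    have "(\<lambda>i. fps_nth F i * u z ^ i - fps_nth G i * u z ^ i) sums (f z - f z)"
      using z s by (intro sums_diff_nonarch) auto
    then show "\<exists>v. v \<noteq> 0 \<and> absv v < s \<and> (\<lambda>i. fps_nth (F - G) i * v ^ i) sums 0"
      using z by (intro exI[of _ "u z"]) (simp add: left_diff_distrib)
  qed
  then show ?thesis
    by simp
qed

lemma L_nonzero: "L k \<noteq> 0"
proof -
  have "bracket j \<noteq> 0" if "1 \<le> j" for j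
    using absv_theta_diff[of 0 j] that q_ge_2 by (auto simp: bracket_def)
  then show ?thesis
    by (simp add: L_def)
qed

end

theorem proposition2p3:
  fixes p e q k :: nat
    and \<iota> :: "'f::{field,finite} fls alg_closure \<Rightarrow> 'c::{nonarch_field,complete_space}"
    and \<pi> :: 'c
  assumes "drinfeld_setting p e q \<iota> \<pi>"
  shows "\<exists>F. drinfeld_setting.has_u_expansion q \<iota> \<pi> (drinfeld_setting.x q \<iota> \<pi> k) F \<and>
           F = drinfeld_setting.u_expansion q \<iota> \<pi> (drinfeld_setting.x q \<iota> \<pi> k) \<and>
           (\<forall>i < q ^ k. fps_nth F i = 0) \<and>
           fps_nth F (q ^ k) = (- 1) ^ (k + 1) * carlitz_setting.L q \<iota> k \<and>
           drinfeld_setting.nu_infty q \<iota> \<pi> (drinfeld_setting.x q \<iota> \<pi> k) = q ^ k"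
proof -
  interpret drinfeld_setting p e q \<iota> \<pi>
    by (rule assms)
  obtain F where F: "has_u_expansion (x k) F" "\<forall>i<q ^ k. fps_nth F i = 0"
    "fps_nth F (q ^ k) = (- 1) ^ (k + 1) * L k"
    using x_expansion[of k] by blast
  have u_exp: "u_expansion (x k) = F"
    unfolding u_expansion_def
  proof (rule the_equality)
    show "G = F" if "has_u_expansion (x k) G" for G
      using that F(1) by (rule u_expansion_unique)
  qed (rule F(1))
  have "fps_nth F (q ^ k) \<noteq> 0"
    using L_nonzero[of k] by (simp add: F(3))
  then have "nu_infty (x k) = q ^ k"
    unfolding nu_infty_def u_exp using F(2) by (intro Least_equality) (auto simp: not_less[symmetric])
  then show ?thesis
    using F u_exp by (intro exI[of _ F]) auto
qed

end
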